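(* Let $n$ take values only in an infinite set of odd square-free integers greater than $1$ such that \[ \frac{(\log n)^7}{p_n}\to 0 \quad\text{as } n\to\infty, \] where $p_n$ is the smallest prime factor of $n$, and let $r$ be real. Let $J(z)=\sum_{j=1}^{n-1}\left(\frac{j}{n}\right)z^j$ be the character polynomial of degree $n-1$ and let $V$ be drawn uniformly at random from $\mathcal{V}_n$. Then, as $n\to\infty$, \[ F(J_r+V_r)\to f(r)\quad\text{in probability}. \]
   Context: For real $\alpha\ge1$ and $A\in\mathbb{C}[z]$, $\|A\|_\alpha=\left(\frac{1}{2\pi}\int_0^{2\pi}|A(e^{i\theta})|^\alpha d\theta\right)^{1/\alpha}$. The merit factor of $A$ is $F(A)=\frac{\|A\|_2^4}{\|A\|_4^4-\|A\|_2^4}$. For a polynomial $A$ of degree at most $n-1$ and real $r$, the rotation is $A_r(z)=z^{-\lfloor nr\rfloor}A(z)\bmod (z^n-1)$. $\left(\frac{\cdot}{n}\right)$ denotes the Jacobi symbol. $\mathcal{V}_n$ is the set of polynomials $\sum_{j=0}^{n-1}v_jz^j$ with $v_j\in\{0,-1,+1\}$ and $v_j=0$ if and only if $\gcd(j,n)=1$. The function $f$ is $1$-periodic with $f(r)=\dfrac{1}{\frac16+8\left(|r|-\frac14\right)^2}$ for $-\frac12<r\le\frac12$. *)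

theory Defs
  imports "HOL-Analysis.Analysis" "HOL-Number_Theory.Number_Theory"
    "HOL-Computational_Algebra.Polynomial" "HOL-Computational_Algebra.Squarefree"
begin

definition Jacobi :: "int \<Rightarrow> nat \<Rightarrow> int" where
  "Jacobi a n = (\<Prod>p\<in>prime_factors n. Legendre a (int p) ^ multiplicity p n)"

definition lnorm :: "real \<Rightarrow> complex poly \<Rightarrow> real" where
  "lnorm \<alpha> A = ((1 / (2 * pi)) *
     integral {0..2*pi} (\<lambda>\<theta>. cmod (poly A (cis \<theta>)) powr \<alpha>)) powr (1 / \<alpha>)"

definition merit :: "complex poly \<Rightarrow> real" where
  "merit A = lnorm 2 A ^ 4 / (lnorm 4 A ^ 4 - lnorm 2 A ^ 4)"

text \<open>Rotation A_r(z) = z^(-floor(n r)) A(z) mod (z^n - 1); z^(-k) is represented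
  modulo z^n - 1 by z^((-k) mod n).\<close>
definition rot :: "nat \<Rightarrow> real \<Rightarrow> complex poly \<Rightarrow> complex poly" where
  "rot n r A = (Polynomial.monom 1 (nat ((- \<lfloor>real n * r\<rfloor>) mod int n)) * A) mod (Polynomial.monom 1 n - 1)"

definition charpoly :: "nat \<Rightarrow> complex poly" where
  "charpoly n = (\<Sum>j=1..n-1. Polynomial.monom (of_int (Jacobi (int j) n)) j)"

definition Vset :: "nat \<Rightarrow> complex poly set" where
  "Vset n = {V. (\<forall>j\<ge>n. Polynomial.coeff V j = 0) \<and>
      (\<forall>j<n. Polynomial.coeff V j \<in> {0, -1, 1} \<and> (Polynomial.coeff V j = 0 \<longleftrightarrow> gcd j n = 1))}"

definition fper :: "real \<Rightarrow> real" where
  "fper r = (let s = r - real_of_int \<lceil>r - 1/2\<rceil> in 1 / (1/6 + 8 * (\<bar>s\<bar> - 1/4)^2))"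

definition smallest_prime_factor :: "nat \<Rightarrow> nat" where
  "smallest_prime_factor n = Min (prime_factors n)"

end

theory Submission
  imports Defs "HOL-Real_Asymp.Real_Asymp"
begin

text \<open>
  All coefficients of J_r + V_r are 1 or -1, so the merit factor is determined by the fourth power
  of the L4 norm. The number of nonzero coefficients of V is n - phi(n) = o(n), and random signs
  give a mean fourth power O((n - phi(n))^2) = o(n^2); hence V_r is negligible in probability and it
  remains to find the limit of the fourth power of the L4 norm of J_r, divided by n^2.

  That fourth power is the average over the 2n-th roots of unity. At the n-th roots of unity J_r is
  a Gauss sum of absolute value sqrt n or 0. At the remaining points, interpolation gives
  sqrt n times a convolution of the Jacobi symbol with weights w(m) of size O(1/|m|). Weights with
  |m| greater than the square root of the least prime factor p of n are discarded: the discarded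
  part has mean square O(1/sqrt p) by Parseval and supremum O(log n). In the fourth moment of
  the rest, pairwise equal indices give the main term, and the others give correlations of four
  shifted Jacobi symbols. These need only a power saving in p, since the retained weights have sum
  O(log p). By inversion, the correlations modulo p become sums of the Legendre symbol over a cubic,
  which are O(p^(3/4)) by the method of Mordell and Davenport: the fourth moment over all
  polynomials of degree at most 3 is at most 3 p^6, while the absolute value of the sum is the
  same for the polynomials c f(u x + v), of which there are at least p (p - 1)^2 / 9.
\<close>

text \<open>Only one prime factor p is used for cancellation: a correlation modulo n factors over p
  and n / p, and the cofactor is bounded trivially. This is what forces the truncation. Two indices
  that differ but are congruent modulo p look equal from p, so an unpaired quadruple could lose its
  saving; indices of absolute value below p / 2 exclude this.

  Degree 3 is what leaves room to hold three values of a polynomial fixed while a fourth one runs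
  through all residues, so that the fourth moment over the family vanishes exactly on unpaired
  arguments.

  With s the representative of r in (-1/2, 1/2], the limit of the fourth power is 1 + 1/f(r) = 1/2 +
  (4/3 + (4|s| - 1)^2) / 2. The first 1/2 comes from the n-th roots of unity; 4/3 = 2 - 2/3 comes
  from the sums of |w|^2 and |w|^4, which do not see the rotation; the square is the limit of |sum
  of w^2|^2, the only term that does.

  Both the discarded weights and V are removed by one stability argument, in which factors (1 + t)^4
  and (1 + 1/t)^4 stand in for the triangle inequality in L4.\<close>

section \<open>Sums over complete residue systems\<close>

lemma sum_affine_residues:
  fixes f :: "int \<Rightarrow> 'a :: comm_monoid_add"
  assumes n: "n > 0" and per: "\<And>x. f (x mod n) = f x" and cop: "coprime u n"
  shows "(\<Sum>x\<in>{0..<n}. f (u * x + v)) = (\<Sum>x\<in>{0..<n}. f x)"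
proof -
  define h where "h = (\<lambda>x. (u * x + v) mod n)"
  have inj: "inj_on h {0..<n}"
  proof (rule inj_onI)
    fix x y assume x: "x \<in> {0..<n}" and y: "y \<in> {0..<n}" and "h x = h y"
    hence "[u * x + v = u * y + v] (mod n)" by (simp add: h_def cong_def)
    hence "[u * x = u * y] (mod n)" by (simp add: cong_add_rcancel)
    hence "[x = y] (mod n)" using cop by (simp add: cong_mult_lcancel)
    thus "x = y" using x y by (simp add: cong_def)
  qed
  have "h ` {0..<n} \<subseteq> {0..<n}" using n by (auto simp: h_def)
  hence "h ` {0..<n} = {0..<n}"
    using inj by (intro card_subset_eq) (auto simp: card_image)
  hence bij: "bij_betw h {0..<n} {0..<n}" using inj by (simp add: bij_betw_def)
  have "(\<Sum>x\<in>{0..<n}. f (u * x + v)) = (\<Sum>x\<in>{0..<n}. f (h x))"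
    by (simp add: h_def per)
  also have "\<dots> = (\<Sum>x\<in>{0..<n}. f x)" by (rule sum.reindex_bij_betw[OF bij])
  finally show ?thesis .
qed

lemma sum_shift_residues:
  fixes f :: "int \<Rightarrow> 'a :: comm_monoid_add"
  assumes "n > 0" and "\<And>x. f (x mod n) = f x"
  shows "(\<Sum>x\<in>{0..<n}. f (x + v)) = (\<Sum>x\<in>{0..<n}. f x)"
  using sum_affine_residues[of n f 1 v] assms by simp

lemma sum_reflect_residues:
  fixes f :: "int \<Rightarrow> 'a :: comm_monoid_add"
  assumes "n > 0" and "\<And>x. f (x mod n) = f x"
  shows "(\<Sum>x\<in>{0..<n}. f (v - x)) = (\<Sum>x\<in>{0..<n}. f x)"
  using sum_affine_residues[of n f "-1" v] assms by simp

text \<open>Allows the passage to the residues of least absolute value, on which the interpolation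
  weights visibly decay.\<close>

lemma sum_centered_residues:
  fixes f :: "int \<Rightarrow> 'a :: comm_monoid_add"
  assumes n: "n = 2 * h + 1" "h \<ge> 0" and per: "\<And>x. f (x mod n) = f x"
  shows "(\<Sum>x\<in>{-h..h}. f x) = (\<Sum>x\<in>{0..<n}. f x)"
proof -
  have "(\<Sum>x\<in>{-h..h}. f x) = (\<Sum>x\<in>{0..<n}. f (x + - h))"
    by (rule sum.reindex_bij_witness[of _ "\<lambda>x. x - h" "\<lambda>x. x + h"]) (use n in auto)
  also have "\<dots> = (\<Sum>x\<in>{0..<n}. f x)"
    by (rule sum_shift_residues) (use n per in auto)
  finally show ?thesis .
qed

text \<open>Chinese remaindering in the form x = p b + a: \<open>f\<close> sees only a, and for
  fixed a the map b -> p b + a permutes the residues modulo m because p is a unit there.\<close>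

lemma sum_residues_mult:
  fixes f g :: "int \<Rightarrow> 'a :: comm_semiring_0"
  assumes p: "p > 0" and m: "m > 0" and cop: "coprime p m"
    and f: "\<And>x. f (x mod p) = f x" and g: "\<And>x. g (x mod m) = g x"
  shows "(\<Sum>x\<in>{0..<p * m}. f x * g x) = (\<Sum>x\<in>{0..<p}. f x) * (\<Sum>x\<in>{0..<m}. g x)"
proof -
  have "(\<Sum>x\<in>{0..<p * m}. f x * g x) = (\<Sum>(a, b)\<in>{0..<p} \<times> {0..<m}. f (p * b + a) * g (p * b + a))"
  proof (rule sum.reindex_bij_witness[of _ "\<lambda>(a, b). p * b + a" "\<lambda>x. (x mod p, x div p)"])
    fix x assume x: "x \<in> {0..<p * m}"
    show "(x mod p, x div p) \<in> {0..<p} \<times> {0..<m}"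
    proof -
      have "p * (x div p) \<le> x" using minus_mod_eq_mult_div[of x p] pos_mod_sign[of p x] p by linarith
      also have "x < p * m" using x by simp
      finally have "x div p < m" using p by simp
      thus ?thesis using x p by (simp add: pos_imp_zdiv_nonneg_iff)
    qed
  next
    fix y assume y: "y \<in> {0..<p} \<times> {0..<m}"
    obtain a b where ab: "y = (a, b)" by force
    have "p * b + a < p * (b + 1)" using y ab by (simp add: distrib_left)
    also have "\<dots> \<le> p * m" using y ab p by (intro mult_left_mono) auto
    finally show "(case y of (a, b) \<Rightarrow> p * b + a) \<in> {0..<p * m}"
      using y ab p by auto
  qed (use p in auto)
  also have "\<dots> = (\<Sum>a\<in>{0..<p}. \<Sum>b\<in>{0..<m}. f (p * b + a) * g (p * b + a))"
    by (simp add: sum.cartesian_product)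
  also have "\<dots> = (\<Sum>a\<in>{0..<p}. \<Sum>b\<in>{0..<m}. f a * g (p * b + a))"
  proof (intro sum.cong refl)
    fix a b
    have "f (p * b + a) = f a" using f[of "p * b + a"] f[of a] by simp
    thus "f (p * b + a) * g (p * b + a) = f a * g (p * b + a)" by simp
  qed
  also have "\<dots> = (\<Sum>a\<in>{0..<p}. f a * (\<Sum>x\<in>{0..<m}. g x))"
    using sum_affine_residues[of m g p, OF m g cop] by (simp add: sum_distrib_left[symmetric])
  finally show ?thesis by (simp add: sum_distrib_right)
qed

section \<open>Legendre and Jacobi symbols\<close>

lemma Legendre_mod: "Legendre (x mod p) p = Legendre x p"
  by (simp add: Legendre_def QuadRes_def cong_def)

lemma Legendre_cong: "[x = y] (mod p) \<Longrightarrow> Legendre x p = Legendre y p"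
  by (metis Legendre_mod cong_def)

lemma Legendre_eq_0_iff: "Legendre x p = 0 \<longleftrightarrow> p dvd x"
  by (simp add: Legendre_def cong_0_iff)

lemma Legendre_cases: "Legendre x p \<in> {0, 1, -1}"
  by (simp add: Legendre_def)

text \<open>Euler's criterion gives the identity modulo p; the two sides differ by at most 2, which
  is less than p, so they are equal.\<close>

lemma Legendre_mult:
  fixes p :: int
  assumes p: "prime p" "p > 2"
  shows "Legendre (a * b) p = Legendre a p * Legendre b p"
proof -
  have p': "prime (nat p)" "2 < nat p" using p by auto
  have E: "[Legendre x p = x ^ ((nat p - 1) div 2)] (mod p)" for x
    using euler_criterion[OF p', of x] p by simp
  have "[Legendre (a * b) p = Legendre a p * Legendre b p] (mod p)"
    using E[of "a * b"] cong_mult[OF E[of a] E[of b]]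
    by (metis cong_sym cong_trans power_mult_distrib)
  hence "p dvd Legendre (a * b) p - Legendre a p * Legendre b p" by (simp add: cong_iff_dvd_diff)
  moreover have "\<bar>Legendre (a * b) p - Legendre a p * Legendre b p\<bar> < p"
    using Legendre_cases[of "a * b" p] Legendre_cases[of a p] Legendre_cases[of b p] p(2) by auto
  ultimately show ?thesis using dvd_imp_le_int[of _ p] by (metis abs_of_pos eq_iff_diff_eq_0 not_le p(1) prime_gt_0_int)
qed

text \<open>Otherwise squaring would be onto on \<open>{1..<p}\<close>, hence injective by counting,
  although 1 and p - 1 have the same square.\<close>

lemma Legendre_nonresidue_exists:
  fixes p :: int
  assumes p: "prime p" "p > 2"
  shows "\<exists>u. Legendre u p = -1"
proof (rule ccontr)
  assume "\<not> ?thesis"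
  hence all: "Legendre u p = 0 \<or> Legendre u p = 1" for u
    using Legendre_cases[of u p] by auto
  have sq: "\<exists>y. [y\<^sup>2 = u] (mod p)" if "\<not> p dvd u" for u
    using all[of u] that by (auto simp: Legendre_def QuadRes_def cong_0_iff split: if_splits)
  have surj: "(\<lambda>y. y\<^sup>2 mod p) ` {1..<p} = {1..<p}"
  proof
    show "(\<lambda>y. y\<^sup>2 mod p) ` {1..<p} \<subseteq> {1..<p}"
    proof safe
      fix y assume y: "y \<in> {1..<p}"
      hence "\<not> p dvd y" using zdvd_not_zless by auto
      hence "\<not> p dvd y\<^sup>2" using p prime_dvd_power by blast
      hence "y\<^sup>2 mod p \<noteq> 0" by (simp add: dvd_eq_mod_eq_0)
      thus "y\<^sup>2 mod p \<in> {1..<p}" using p pos_mod_sign[of p "y\<^sup>2"] pos_mod_bound[of p "y\<^sup>2"]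
        unfolding atLeastLessThan_iff by linarith
    qed
    show "{1..<p} \<subseteq> (\<lambda>y. y\<^sup>2 mod p) ` {1..<p}"
    proof
      fix u assume u: "u \<in> {1..<p}"
      hence nd: "\<not> p dvd u" using zdvd_not_zless by auto
      then obtain y where y: "[y\<^sup>2 = u] (mod p)" using sq by blast
      have "\<not> p dvd y" using y nd
        by (metis cong_dvd_iff dvd_mult power2_eq_square)
      hence "y mod p \<noteq> 0" by (simp add: dvd_eq_mod_eq_0)
      hence "y mod p \<in> {1..<p}" using p pos_mod_sign[of p y] pos_mod_bound[of p y]
        unfolding atLeastLessThan_iff by linarith
      moreover have "(y mod p)\<^sup>2 mod p = u" using y u by (simp add: cong_def power_mod)
      ultimately show "u \<in> (\<lambda>y. y\<^sup>2 mod p) ` {1..<p}" by force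
    qed
  qed
  hence inj: "inj_on (\<lambda>y. y\<^sup>2 mod p) {1..<p}" by (intro eq_card_imp_inj_on) auto
  have "(p - 1)\<^sup>2 = p * (p - 2) + 1\<^sup>2" by (simp add: power2_eq_square algebra_simps)
  hence "(1::int)\<^sup>2 mod p = (p - 1)\<^sup>2 mod p" by simp
  hence "1 = p - 1" using p by (rule_tac inj_onD[OF inj]) simp_all
  thus False using p by simp
qed

text \<open>Multiplication by a nonresidue permutes the residues and changes the sign of the
  sum.\<close>

lemma sum_Legendre:
  fixes p :: int
  assumes p: "prime p" "p > 2"
  shows "(\<Sum>x\<in>{0..<p}. Legendre x p) = 0"
proof -
  obtain u where u: "Legendre u p = -1" using Legendre_nonresidue_exists[OF p] by blast
  hence "\<not> p dvd u" using Legendre_eq_0_iff[of u p] by auto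
  hence "coprime u p" using p by (metis coprime_commute prime_imp_coprime)
  hence "(\<Sum>x\<in>{0..<p}. Legendre (u * x + 0) p) = (\<Sum>x\<in>{0..<p}. Legendre x p)"
    using p by (intro sum_affine_residues) (auto simp: Legendre_mod)
  moreover have "(\<Sum>x\<in>{0..<p}. Legendre (u * x + 0) p) = - (\<Sum>x\<in>{0..<p}. Legendre x p)"
    by (simp add: Legendre_mult[OF p] u sum_negf)
  ultimately show ?thesis by simp
qed

lemma sum_Legendre_affine:
  fixes p :: int
  assumes p: "prime p" "p > 2" and "\<not> p dvd u"
  shows "(\<Sum>x\<in>{0..<p}. Legendre (u * x + v) p) = 0"
proof -
  have "coprime u p" using p assms(3) by (metis coprime_commute prime_imp_coprime)
  hence "(\<Sum>x\<in>{0..<p}. Legendre (u * x + v) p) = (\<Sum>x\<in>{0..<p}. Legendre x p)"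
    using p by (intro sum_affine_residues) (auto simp: Legendre_mod)
  thus ?thesis using sum_Legendre[OF p] by simp
qed

lemma Jacobi_mod:
  "Jacobi (x mod int n) n = Jacobi x n"
  unfolding Jacobi_def
proof (intro prod.cong refl)
  fix p assume "p \<in> prime_factors n"
  hence "int p dvd int n" by auto
  hence "[x mod int n = x] (mod int p)" by (metis cong_def mod_mod_cancel)
  thus "Legendre (x mod int n) (int p) ^ multiplicity p n = Legendre x (int p) ^ multiplicity p n"
    using Legendre_cong by metis
qed

lemma Jacobi_cong: "[x = y] (mod int n) \<Longrightarrow> Jacobi x n = Jacobi y n"
  by (metis Jacobi_mod cong_def)

lemma odd_prime_factor:
  assumes "odd n" "p \<in> prime_factors n"
  shows "prime (int p)" "int p > 2"
proof -
  have "prime p" "p dvd n" using assms by auto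
  moreover have "p \<noteq> 2" using assms(1) \<open>p dvd n\<close> by auto
  ultimately show "prime (int p)" "int p > 2" using prime_ge_2_nat[of p] by auto
qed

lemma Jacobi_mult:
  assumes "odd n"
  shows "Jacobi (a * b) n = Jacobi a n * Jacobi b n"
  unfolding Jacobi_def prod.distrib[symmetric]
  by (intro prod.cong refl) (use assms in \<open>simp only: Legendre_mult odd_prime_factor power_mult_distrib\<close>)

lemma Jacobi_cases: "Jacobi x n \<in> {0, 1, -1}"
proof -
  have "Legendre x q ^ k \<in> {0, 1, -1 :: int}" for q k
    using Legendre_cases[of x q] by (cases "even k"; cases "k = 0") auto
  hence "(\<Prod>p\<in>A. Legendre x (int p) ^ multiplicity p n) \<in> {0, 1, -1}" for A :: "nat set"
  proof (induction A rule: infinite_finite_induct)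
    case (insert q A)
    have "Legendre x (int q) ^ multiplicity q n \<in> {0, 1, -1}" by (rule insert(4))
    with insert(3)[OF insert(4)] show ?case unfolding prod.insert[OF insert(1,2)] by force
  qed auto
  thus ?thesis unfolding Jacobi_def .
qed

lemma abs_Jacobi_le_1: "\<bar>Jacobi x n\<bar> \<le> 1"
  using Jacobi_cases[of x n] by auto

lemma Jacobi_eq_0_iff:
  assumes n: "n > 0"
  shows "Jacobi x n = 0 \<longleftrightarrow> \<not> coprime x (int n)"
proof -
  have "Jacobi x n = 0 \<longleftrightarrow> (\<exists>p\<in>prime_factors n. int p dvd x)"
    unfolding Jacobi_def
    by (subst prod_zero_iff)
      (auto simp: Legendre_eq_0_iff dest: prime_factors_multiplicity[THEN equalityD1, THEN subsetD])
  also have "\<dots> \<longleftrightarrow> \<not> coprime x (int n)"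
  proof
    assume "\<exists>p\<in>prime_factors n. int p dvd x"
    then obtain p where p: "prime p" "p dvd n" "int p dvd x" by auto
    have "p \<noteq> 1" using p by auto
    thus "\<not> coprime x (int n)" using p not_coprimeI[of "int p" x "int n"] by auto
  next
    assume "\<not> coprime x (int n)"
    hence "gcd x (int n) \<noteq> 1" by (simp add: coprime_iff_gcd_eq_1)
    then obtain q where q: "prime q" "q dvd gcd x (int n)" using prime_factor_int[of "gcd x (int n)"] by auto
    have "nat q \<in> prime_factors n" using q n
      by (auto simp: prime_factors_dvd prime_ge_0_int nat_dvd_iff)
    moreover have "int (nat q) dvd x" using q prime_gt_0_int[of q] by simp
    ultimately show "\<exists>p\<in>prime_factors n. int p dvd x" by blast
  qed
  finally show ?thesis .
qed

lemma Jacobi_squared: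
  "n > 0 \<Longrightarrow> (Jacobi x n)\<^sup>2 = of_bool (coprime x (int n))"
  using Jacobi_cases[of x n] Jacobi_eq_0_iff[of n x] by auto

text \<open>Splits one prime off the modulus, so that a complete sum modulo n becomes a Legendre sum
  modulo p times a Jacobi sum modulo the cofactor.\<close>

lemma Jacobi_prime_times:
  assumes p: "prime p" and m: "m > 0" "\<not> p dvd m"
  shows "Jacobi x (p * m) = Legendre x (int p) * Jacobi x m"
proof -
  have pf: "prime_factors (p * m) = insert p (prime_factors m)" "p \<notin> prime_factors m"
    using p m by (auto simp: prime_factors_product prime_factorization_prime prime_gt_0_nat)
  have mult: "multiplicity p (p * m) = 1"
    using p m by (simp add: prime_elem_multiplicity_mult_distrib not_dvd_imp_multiplicity_0 prime_gt_0_nat)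
  have "multiplicity q (p * m) = multiplicity q m" if "q \<in> prime_factors m" for q
  proof -
    have "prime q" "q \<noteq> p" using that pf by auto
    hence "multiplicity q p = 0" using p primes_dvd_imp_eq by (auto intro: not_dvd_imp_multiplicity_0)
    thus ?thesis using p m \<open>prime q\<close> prime_gt_0_nat[OF p]
      by (subst prime_elem_multiplicity_mult_distrib) auto
  qed
  hence "(\<Prod>q\<in>prime_factors m. Legendre x (int q) ^ multiplicity q (p * m)) = Jacobi x m"
    unfolding Jacobi_def by (intro prod.cong) auto
  thus ?thesis unfolding Jacobi_def[of x "p * m"] pf(1) using pf(2) mult by simp
qed

section \<open>Quartic character sums\<close>

definition cubic :: "int \<times> int \<times> int \<times> int \<Rightarrow> int \<Rightarrow> int" where
  "cubic a x = (case a of (a0, a1, a2, a3) \<Rightarrow> a0 + a1 * x + a2 * x ^ 2 + a3 * x ^ 3)"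

text \<open>The patterns in which a product of four sign values is a product of two squares. Outside
  them some entry differs from the three others (\<open>not_paired_cases\<close>), and that isolated
  entry is what produces cancellation, both in the family of cubics and in the correlations.\<close>

definition paired :: "'a \<Rightarrow> 'a \<Rightarrow> 'a \<Rightarrow> 'a \<Rightarrow> bool" where
  "paired a b c d \<longleftrightarrow> (a = b \<and> c = d) \<or> (a = c \<and> b = d) \<or> (a = d \<and> b = c)"

lemma not_paired_cases:
  assumes "\<not> paired a b c d"
  obtains "a \<notin> {b, c, d}" | "b \<notin> {a, c, d}" | "c \<notin> {a, b, d}" | "d \<notin> {a, b, c}"
  using assms unfolding paired_def by blast

lemma sum_product4:
  fixes f g h k :: "'b \<Rightarrow> 'a :: comm_semiring_1"
  shows "(\<Sum>a\<in>A. f a) * (\<Sum>b\<in>A. g b) * (\<Sum>c\<in>A. h c) * (\<Sum>d\<in>A. k d) =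
    (\<Sum>a\<in>A. \<Sum>b\<in>A. \<Sum>c\<in>A. \<Sum>d\<in>A. f a * g b * h c * k d)"
  by (simp only: sum_distrib_left[symmetric] sum_distrib_right[symmetric])

text \<open>Inclusion and exclusion: any two of the three pairings hold together only when all four
  indices agree, so the diagonal is counted three times and must be removed twice.\<close>

lemma sum_paired:
  fixes g :: "'b \<Rightarrow> 'b \<Rightarrow> 'b \<Rightarrow> 'b \<Rightarrow> 'a :: comm_ring_1"
  assumes "finite A"
  shows "(\<Sum>a\<in>A. \<Sum>b\<in>A. \<Sum>c\<in>A. \<Sum>d\<in>A. of_bool (paired a b c d) * g a b c d) =
    (\<Sum>a\<in>A. \<Sum>c\<in>A. g a a c c) + (\<Sum>a\<in>A. \<Sum>b\<in>A. g a b a b) + (\<Sum>a\<in>A. \<Sum>b\<in>A. g a b b a)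
    - 2 * (\<Sum>a\<in>A. g a a a a)"
proof -
  have "of_bool (paired a b c d) * g a b c d =
      (if a = b then if c = d then g a b c d else 0 else 0) + (if a = c then if b = d then g a b c d else 0 else 0)
       + (if a = d then if b = c then g a b c d else 0 else 0)
       - 2 * (if a = b then if a = c then if a = d then g a b c d else 0 else 0 else 0)" for a b c d
    by (auto simp: paired_def)
  hence "(\<Sum>a\<in>A. \<Sum>b\<in>A. \<Sum>c\<in>A. \<Sum>d\<in>A. of_bool (paired a b c d) * g a b c d)
    = (\<Sum>a\<in>A. \<Sum>b\<in>A. \<Sum>c\<in>A. \<Sum>d\<in>A. (if a = b then if c = d then g a b c d else 0 else 0)) +
       (\<Sum>a\<in>A. \<Sum>b\<in>A. \<Sum>c\<in>A. \<Sum>d\<in>A. (if a = c then if b = d then g a b c d else 0 else 0)) +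
       (\<Sum>a\<in>A. \<Sum>b\<in>A. \<Sum>c\<in>A. \<Sum>d\<in>A. (if a = d then if b = c then g a b c d else 0 else 0)) -
       2 * (\<Sum>a\<in>A. \<Sum>b\<in>A. \<Sum>c\<in>A. \<Sum>d\<in>A. (if a = b then if a = c then if a = d then g a b c d else 0 else 0 else 0))"
    by (simp only: sum.distrib sum_subtractf sum_distrib_left[symmetric])
  also have "(\<Sum>a\<in>A. \<Sum>b\<in>A. \<Sum>c\<in>A. \<Sum>d\<in>A. (if a = b then if c = d then g a b c d else 0 else 0))
     = (\<Sum>a\<in>A. \<Sum>b\<in>A. if a = b then \<Sum>c\<in>A. g a b c c else 0)"
    using assms by (intro sum.cong refl) (simp add: sum.delta')
  also have "\<dots> = (\<Sum>a\<in>A. \<Sum>c\<in>A. g a a c c)"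
    using assms by (simp add: sum.delta)
  also have "(\<Sum>a\<in>A. \<Sum>b\<in>A. \<Sum>c\<in>A. \<Sum>d\<in>A. (if a = c then if b = d then g a b c d else 0 else 0))
    = (\<Sum>a\<in>A. \<Sum>b\<in>A. \<Sum>c\<in>A. if a = c then g a b c b else 0)"
    using assms by (intro sum.cong refl) (simp add: sum.delta')
  also have "\<dots> = (\<Sum>a\<in>A. \<Sum>b\<in>A. g a b a b)"
    using assms by (simp add: sum.delta)
  also have "(\<Sum>a\<in>A. \<Sum>b\<in>A. \<Sum>c\<in>A. \<Sum>d\<in>A. (if a = d then if b = c then g a b c d else 0 else 0))
    = (\<Sum>a\<in>A. \<Sum>b\<in>A. \<Sum>d\<in>A. \<Sum>c\<in>A. (if a = d then if b = c then g a b c d else 0 else 0))"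
    by (intro sum.cong refl sum.swap)
  also have "\<dots> = (\<Sum>a\<in>A. \<Sum>b\<in>A. \<Sum>d\<in>A. if a = d then g a b b d else 0)"
    using assms by (intro sum.cong refl) (simp add: sum.delta')
  also have "\<dots> = (\<Sum>a\<in>A. \<Sum>b\<in>A. g a b b a)"
    using assms by (simp add: sum.delta)
  also have "(\<Sum>a\<in>A. \<Sum>b\<in>A. \<Sum>c\<in>A. \<Sum>d\<in>A. (if a = b then if a = c then if a = d then g a b c d else 0 else 0 else 0))
    = (\<Sum>a\<in>A. \<Sum>b\<in>A. if a = b then g a b a a else 0)"
  proof (intro sum.cong refl)
    fix a b assume "a \<in> A"
    have "(\<Sum>c\<in>A. \<Sum>d\<in>A. (if a = b then if a = c then if a = d then g a b c d else 0 else 0 else 0))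
       = (\<Sum>c\<in>A. if a = c then if a = b then g a b c a else 0 else 0)"
    proof (intro sum.cong refl)
      fix c
      show "(\<Sum>d\<in>A. (if a = b then if a = c then if a = d then g a b c d else 0 else 0 else 0)) =
        (if a = c then if a = b then g a b c a else 0 else 0)"
        using assms \<open>a \<in> A\<close> by (cases "a = b"; cases "a = c") (simp_all add: sum.delta')
    qed
    also have "\<dots> = (if a = b then g a b a a else 0)" using assms \<open>a \<in> A\<close> by (simp only: sum.delta' if_True)
    finally show "(\<Sum>c\<in>A. \<Sum>d\<in>A. (if a = b then if a = c then if a = d then g a b c d else 0 else 0 else 0)) =
      (if a = b then g a b a a else 0)" .
  qed
  also have "\<dots> = (\<Sum>a\<in>A. g a a a a)"
    using assms by (simp add: sum.delta)
  finally show ?thesis .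
qed

text \<open>Each pairing contributes the square of the sum of squares, and the diagonal that is
  subtracted is nonnegative.\<close>

lemma sum_paired_le:
  fixes f :: "'b \<Rightarrow> real"
  assumes "finite A"
  shows "(\<Sum>a\<in>A. \<Sum>b\<in>A. \<Sum>c\<in>A. \<Sum>d\<in>A. of_bool (paired a b c d) * (f a * f b * f c * f d))
    \<le> 3 * (\<Sum>x\<in>A. (f x)\<^sup>2)\<^sup>2"
proof -
  have "f a * f a * f a * f a = (f a * f a)\<^sup>2" for a by (simp add: power2_eq_square mult.assoc)
  hence "(\<Sum>a\<in>A. f a * f a * f a * f a) \<ge> 0" by (simp add: sum_nonneg)
  moreover have "(\<Sum>a\<in>A. \<Sum>b\<in>A. f a * f b * f a * f b) = (\<Sum>a\<in>A. \<Sum>b\<in>A. f a * f a * f b * f b)"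
    "(\<Sum>a\<in>A. \<Sum>b\<in>A. f a * f b * f b * f a) = (\<Sum>a\<in>A. \<Sum>b\<in>A. f a * f a * f b * f b)"
    by (simp_all add: mult_ac)
  moreover have "(\<Sum>a\<in>A. \<Sum>b\<in>A. f a * f a * f b * f b) = (\<Sum>x\<in>A. (f x)\<^sup>2)\<^sup>2"
    by (simp add: power2_eq_square sum_product mult_ac)
  ultimately show ?thesis unfolding sum_paired[OF assms] by linarith
qed

section \<open>Fourth moment method modulo an odd prime\<close>

context
  fixes p :: int
  assumes p: "prime p" "p > 2"
begin

private abbreviation (input) P where "P \<equiv> {0..<p}"

text \<open>Adding t (x - x2) (x - x3) (x - x4) to the cubic permutes the coefficient vectors modulo
  p and leaves the values at x2, x3, x4 alone, while the value at x1 moves by \<open>L * t\<close>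
  with \<open>L\<close> a unit. Averaging over t leaves a complete linear Legendre sum, which is
  0.\<close>

lemma sum_cubic_correlation_eq_0:
  assumes "\<not> p dvd x1 - x2" "\<not> p dvd x1 - x3" "\<not> p dvd x1 - x4"
  shows "(\<Sum>a\<in>P \<times> P \<times> P \<times> P. Legendre (cubic a x1) p * Legendre (cubic a x2) p *
      Legendre (cubic a x3) p * Legendre (cubic a x4) p) = 0"
proof -
  define \<Phi> where "\<Phi> = (\<lambda>a. Legendre (cubic a x1) p * Legendre (cubic a x2) p *
      Legendre (cubic a x3) p * Legendre (cubic a x4) p)"
  \<comment> \<open>The lower coefficients of the monic cubic with roots x2, x3, x4;
    \<open>sh t\<close> adds t times this cubic.\<close>
  define l0 l1 l2 where "l0 = - (x2 * x3 * x4)" "l1 = x2 * x3 + x2 * x4 + x3 * x4" "l2 = - (x2 + x3 + x4)"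
  define sh :: "int \<Rightarrow> int \<times> int \<times> int \<times> int \<Rightarrow> int \<times> int \<times> int \<times> int" where
    "sh = (\<lambda>t (a0, a1, a2, a3). (a0 + t * l0, a1 + t * l1, a2 + t * l2, a3 + t))"
  have cub: "cubic (sh t a) x = cubic a x + t * ((x - x2) * (x - x3) * (x - x4))" for t a x
    by (cases a) (simp add: cubic_def sh_def l0_l1_l2_def power2_eq_square power3_eq_cube algebra_simps)
  have cubmod: "[cubic (b0, b1, b2, b3) x = cubic (a0, a1, a2, a3) x] (mod p)"
    if "[b0 = a0] (mod p)" "[b1 = a1] (mod p)" "[b2 = a2] (mod p)" "[b3 = a3] (mod p)"
    for b0 b1 b2 b3 a0 a1 a2 a3 x
    unfolding cubic_def prod.case by (intro cong_add cong_mult that cong_refl)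
  have Phi_cong: "\<Phi> (b0, b1, b2, b3) = \<Phi> (a0, a1, a2, a3)"
    if "[b0 = a0] (mod p)" "[b1 = a1] (mod p)" "[b2 = a2] (mod p)" "[b3 = a3] (mod p)"
    for b0 b1 b2 b3 a0 a1 a2 a3
    unfolding \<Phi>_def using Legendre_cong[OF cubmod[OF that]] by simp
  have m: "[x mod p = x] (mod p)" for x by simp
  have p0: "p > 0" using p by simp
  have shift: "(\<Sum>a\<in>P \<times> P \<times> P \<times> P. \<Phi> (sh t a)) = (\<Sum>a\<in>P \<times> P \<times> P \<times> P. \<Phi> a)" for t
  proof -
    have "(\<Sum>a\<in>P \<times> P \<times> P \<times> P. \<Phi> (sh t a)) =
      (\<Sum>a0\<in>P. \<Sum>a1\<in>P. \<Sum>a2\<in>P. \<Sum>a3\<in>P. \<Phi> (a0 + t * l0, a1 + t * l1, a2 + t * l2, a3 + t))"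
      by (simp add: sum.cartesian_product' sh_def)
    also have "\<dots> = (\<Sum>a0\<in>P. \<Sum>a1\<in>P. \<Sum>a2\<in>P. \<Sum>a3\<in>P. \<Phi> (a0 + t * l0, a1 + t * l1, a2 + t * l2, a3))"
      by (intro sum.cong refl sum_shift_residues[where f = "\<lambda>y. \<Phi> (_, _, _, y)"] p0 Phi_cong m cong_refl)
    also have "\<dots> = (\<Sum>a0\<in>P. \<Sum>a1\<in>P. \<Sum>a2\<in>P. \<Sum>a3\<in>P. \<Phi> (a0 + t * l0, a1 + t * l1, a2, a3))"
      by (intro sum.cong refl sum_shift_residues[where f = "\<lambda>y. \<Sum>a3\<in>P. \<Phi> (_, _, y, a3)"] p0 Phi_cong m cong_refl)
    also have "\<dots> = (\<Sum>a0\<in>P. \<Sum>a1\<in>P. \<Sum>a2\<in>P. \<Sum>a3\<in>P. \<Phi> (a0 + t * l0, a1, a2, a3))"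
      by (intro sum.cong refl sum_shift_residues[where f = "\<lambda>y. \<Sum>a2\<in>P. \<Sum>a3\<in>P. \<Phi> (_, y, a2, a3)"] p0 Phi_cong m cong_refl)
    also have "\<dots> = (\<Sum>a0\<in>P. \<Sum>a1\<in>P. \<Sum>a2\<in>P. \<Sum>a3\<in>P. \<Phi> (a0, a1, a2, a3))"
      by (intro sum.cong refl sum_shift_residues[where f = "\<lambda>y. \<Sum>a1\<in>P. \<Sum>a2\<in>P. \<Sum>a3\<in>P. \<Phi> (y, a1, a2, a3)"] p0 Phi_cong m cong_refl)
    also have "\<dots> = (\<Sum>a\<in>P \<times> P \<times> P \<times> P. \<Phi> a)" by (simp add: sum.cartesian_product')
    finally show ?thesis .
  qed
  define L where "L = (x1 - x2) * (x1 - x3) * (x1 - x4)"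
  have L: "\<not> p dvd L" using assms p(1) by (simp add: L_def prime_dvd_mult_iff)
  have zero: "(\<Sum>t\<in>P. \<Phi> (sh t a)) = 0" for a
  proof -
    have "(\<Sum>t\<in>P. \<Phi> (sh t a)) = (\<Sum>t\<in>P. Legendre (L * t + cubic a x1) p *
       (Legendre (cubic a x2) p * Legendre (cubic a x3) p * Legendre (cubic a x4) p))"
      by (simp add: \<Phi>_def cub L_def mult_ac add_ac)
    also have "\<dots> = 0"
      by (simp only: sum_distrib_right[symmetric] sum_Legendre_affine[OF p L] mult_zero_left)
    finally show ?thesis .
  qed
  have "p * (\<Sum>a\<in>P \<times> P \<times> P \<times> P. \<Phi> a) = (\<Sum>t\<in>P. \<Sum>a\<in>P \<times> P \<times> P \<times> P. \<Phi> (sh t a))"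
    using p0 by (simp add: shift)
  also have "\<dots> = (\<Sum>a\<in>P \<times> P \<times> P \<times> P. \<Sum>t\<in>P. \<Phi> (sh t a))" by (rule sum.swap)
  also have "\<dots> = 0" by (simp add: zero)
  finally show ?thesis using p0 by (simp add: \<Phi>_def)
qed

text \<open>Expand the fourth power. Unpaired arguments contribute 0, since an isolated one can play
  the part of x1; there are at most 3 p^2 paired ones, each contributing at most p^4.\<close>

lemma sum_cubic_fourth_moment:
  "(\<Sum>a\<in>P \<times> P \<times> P \<times> P. (\<Sum>x\<in>P. real_of_int (Legendre (cubic a x) p)) ^ 4) \<le> 3 * real_of_int p ^ 6"
proof -
  let ?A = "P \<times> P \<times> P \<times> P"
  define X where "X = (\<lambda>a x. real_of_int (Legendre (cubic a x) p))"
  have X1: "\<bar>X a x\<bar> \<le> 1" for a x using Legendre_cases[of "cubic a x" p] by (auto simp: X_def)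
  have ndvd: "\<not> p dvd x - y" if "x \<in> P" "y \<in> P" "x \<noteq> y" for x y
    using that p by (auto simp: mod_eq_dvd_iff[symmetric])
  have cor: "(\<Sum>a\<in>?A. X a x1 * X a x2 * X a x3 * X a x4) \<le> of_bool (paired x1 x2 x3 x4) * p ^ 4"
    if "x1 \<in> P" "x2 \<in> P" "x3 \<in> P" "x4 \<in> P" for x1 x2 x3 x4
  proof (cases "paired x1 x2 x3 x4")
    case True
    have "(\<Sum>a\<in>?A. X a x1 * X a x2 * X a x3 * X a x4) \<le> (\<Sum>a\<in>?A. 1)"
    proof (rule sum_mono)
      fix a
      have "\<bar>X a x1 * X a x2 * X a x3 * X a x4\<bar> \<le> 1"
        unfolding abs_mult using X1 by (intro mult_le_one mult_nonneg_nonneg abs_ge_zero) auto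
      thus "X a x1 * X a x2 * X a x3 * X a x4 \<le> 1" by linarith
    qed
    also have "\<dots> = real_of_int p ^ 4" using p by (simp add: power4_eq_xxxx mult.assoc)
    finally show ?thesis using True by simp
  next
    case False
    have Z: "(\<Sum>a\<in>?A. X a y1 * X a y2 * X a y3 * X a y4) = 0"
      if "y1 \<in> P" "y2 \<in> P" "y3 \<in> P" "y4 \<in> P" "y1 \<notin> {y2, y3, y4}" for y1 y2 y3 y4
      using sum_cubic_correlation_eq_0[of y1 y2 y3 y4] ndvd[of y1 y2] ndvd[of y1 y3] ndvd[of y1 y4] that
      unfolding X_def of_int_mult[symmetric] of_int_sum[symmetric] by simp
    from False show ?thesis
    proof (cases rule: not_paired_cases)
      case 1 thus ?thesis using Z[of x1 x2 x3 x4] that False by simp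
    next
      case 2 thus ?thesis using Z[of x2 x1 x3 x4] that False by (simp add: mult_ac)
    next
      case 3 thus ?thesis using Z[of x3 x1 x2 x4] that False by (simp add: mult_ac)
    next
      case 4 thus ?thesis using Z[of x4 x1 x2 x3] that False by (simp add: mult_ac)
    qed
  qed
  have "(\<Sum>a\<in>?A. (\<Sum>x\<in>P. X a x) ^ 4)
     = (\<Sum>a\<in>?A. \<Sum>x1\<in>P. \<Sum>x2\<in>P. \<Sum>x3\<in>P. \<Sum>x4\<in>P. X a x1 * X a x2 * X a x3 * X a x4)"
    by (simp only: power4_eq_xxxx sum_product4)
  also have "\<dots> = (\<Sum>x1\<in>P. \<Sum>x2\<in>P. \<Sum>x3\<in>P. \<Sum>x4\<in>P. \<Sum>a\<in>?A. X a x1 * X a x2 * X a x3 * X a x4)"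
    by (simp only: sum.swap[of _ _ ?A])
  also have "\<dots> \<le> (\<Sum>x1\<in>P. \<Sum>x2\<in>P. \<Sum>x3\<in>P. \<Sum>x4\<in>P. of_bool (paired x1 x2 x3 x4) * real_of_int p ^ 4)"
    using cor by (intro sum_mono) auto
  also have "\<dots> = (\<Sum>x1\<in>P. \<Sum>x2\<in>P. \<Sum>x3\<in>P. \<Sum>x4\<in>P. of_bool (paired x1 x2 x3 x4) * (1 * 1 * 1 * 1)) * real_of_int p ^ 4"
    by (simp add: sum_distrib_right)
  also have "\<dots> \<le> (3 * (\<Sum>x\<in>P. 1\<^sup>2)\<^sup>2) * real_of_int p ^ 4"
    using sum_paired_le[of P "\<lambda>_. 1"] p by (intro mult_right_mono) auto
  also have "\<dots> = 3 * real_of_int p ^ 6" using p by (simp add: power_add[symmetric])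
  finally show ?thesis by (simp add: X_def)
qed

lemma coprime_prime: "\<not> p dvd u \<Longrightarrow> coprime u p"
  using p(1) by (metis coprime_commute prime_imp_coprime)

text \<open>Every polynomial c f(u x + v) with c and u units has a character sum of the same
  absolute value, so the sum to be bounded occurs many times in the fourth moment. The constant 81 =
  3^4 is chosen for its fourth root.\<close>

lemma cubic_character_sum_le:
  assumes r: "\<not> p dvd r1 - r2" "\<not> p dvd r1 - r3" "\<not> p dvd r2 - r3"
  shows "(\<Sum>t\<in>P. real_of_int (Legendre ((t - r1) * (t - r2) * (t - r3)) p)) ^ 4 \<le> 81 * real_of_int p ^ 3"
proof -
  define U where "U = (\<Sum>t\<in>P. real_of_int (Legendre ((t - r1) * (t - r2) * (t - r3)) p))"
  define T where "T = (\<lambda>a. \<Sum>x\<in>P. real_of_int (Legendre (cubic a x) p))"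
  let ?W = "{1..<p} \<times> {1..<p} \<times> P"
  let ?A = "P \<times> P \<times> P \<times> P"
  \<comment> \<open>The roots of the transformed cubic: \<open>r1\<close>, \<open>r2\<close>,
    \<open>r3\<close> moved by x -> u x + v. \<open>\<theta>\<close> lists the reduced coefficients
    of c times the monic cubic with these roots.\<close>
  define X1 X2 X3 where "X1 = (\<lambda>(c::int, u, v). u * r1 + v)" "X2 = (\<lambda>(c::int, u, v). u * r2 + v)"
    "X3 = (\<lambda>(c::int, u, v). u * r3 + v)"
  define \<theta> where "\<theta> = (\<lambda>w. (- (fst w * X1 w * X2 w * X3 w) mod p,
     (fst w * (X1 w * X2 w + X1 w * X3 w + X2 w * X3 w)) mod p,
     (- (fst w * (X1 w + X2 w + X3 w))) mod p, fst w mod p))"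
  have p0: "p > 0" using p by simp
  have theta: "[cubic (\<theta> w) t = fst w * ((t - X1 w) * (t - X2 w) * (t - X3 w))] (mod p)" for w t
  proof -
    have "[cubic (\<theta> w) t = - (fst w * X1 w * X2 w * X3 w) + fst w * (X1 w * X2 w + X1 w * X3 w + X2 w * X3 w) * t
       + - (fst w * (X1 w + X2 w + X3 w)) * t\<^sup>2 + fst w * t ^ 3] (mod p)"
      unfolding cubic_def \<theta>_def prod.case by (intro cong_add cong_mult cong_refl) simp_all
    thus ?thesis by (simp add: power2_eq_square power3_eq_cube algebra_simps)
  qed
  \<comment> \<open>Substituting t -> u t + v turns the roots back into \<open>r1\<close>,
    \<open>r2\<close>, \<open>r3\<close> and pulls out c u^3, whose symbol is a sign that the fourth
    power removes.\<close>
  have T: "T (\<theta> w) ^ 4 = U ^ 4" if w: "w \<in> ?W" for w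
  proof -
    obtain c u v where cuv: "w = (c, u, v)" by (cases w)
    have nd: "\<not> p dvd c" "\<not> p dvd u" using w cuv zdvd_not_zless by auto
    have "T (\<theta> w) = (\<Sum>t\<in>P. real_of_int (Legendre (c * ((t - X1 w) * (t - X2 w) * (t - X3 w))) p))"
      unfolding T_def using Legendre_cong[OF theta[of w]] cuv by simp
    also have "\<dots> = (\<Sum>t\<in>P. real_of_int (Legendre (c * ((u * t + v - X1 w) * (u * t + v - X2 w) * (u * t + v - X3 w))) p))"
    proof (rule sum_affine_residues[symmetric, OF p0 _ coprime_prime[OF nd(2)]])
      fix x
      have "[c * ((x mod p - X1 w) * (x mod p - X2 w) * (x mod p - X3 w)) = c * ((x - X1 w) * (x - X2 w) * (x - X3 w))] (mod p)"
        by (intro cong_mult cong_diff cong_refl) auto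
      from Legendre_cong[OF this]
      show "real_of_int (Legendre (c * ((x mod p - X1 w) * (x mod p - X2 w) * (x mod p - X3 w))) p)
        = real_of_int (Legendre (c * ((x - X1 w) * (x - X2 w) * (x - X3 w))) p)" by simp
    qed
    also have "\<dots> = (\<Sum>t\<in>P. real_of_int (Legendre ((c * u ^ 3) * ((t - r1) * (t - r2) * (t - r3))) p))"
    proof (intro sum.cong refl)
      fix t
      have "c * ((u * t + v - X1 w) * (u * t + v - X2 w) * (u * t + v - X3 w)) = (c * u ^ 3) * ((t - r1) * (t - r2) * (t - r3))"
        by (simp add: cuv X1_X2_X3_def power3_eq_cube algebra_simps)
      thus "real_of_int (Legendre (c * ((u * t + v - X1 w) * (u * t + v - X2 w) * (u * t + v - X3 w))) p)
        = real_of_int (Legendre ((c * u ^ 3) * ((t - r1) * (t - r2) * (t - r3))) p)" by (simp only:)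
    qed
    also have "\<dots> = Legendre (c * u ^ 3) p * U"
      by (simp only: Legendre_mult[OF p, of "c * u ^ 3"] of_int_mult U_def sum_distrib_left)
    finally have "T (\<theta> w) ^ 4 = real_of_int (Legendre (c * u ^ 3) p) ^ 4 * U ^ 4" by (simp add: power_mult_distrib)
    moreover have "\<not> p dvd c * u ^ 3" using nd p(1) by (metis prime_dvd_mult_iff prime_dvd_power)
    hence "Legendre (c * u ^ 3) p \<in> {1, -1}"
      using Legendre_cases[of "c * u ^ 3" p] Legendre_eq_0_iff[of "c * u ^ 3" p] by auto
    ultimately show ?thesis by auto
  qed
  \<comment> \<open>The coefficient vector determines c, its leading entry, and the set of at most
    three roots modulo p. Given c, the residues of the first two roots determine u and v, because r1
    and r2 are incongruent; this leaves at most 3 * 3 triples.\<close>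
  have fiber: "card {w \<in> ?W. \<theta> w = a} \<le> 9" for a
  proof (cases "{w \<in> ?W. \<theta> w = a} = {}")
    case False
    then obtain w0 where w0: "w0 \<in> ?W" "\<theta> w0 = a" by blast
    define R where "R = {X1 w0 mod p, X2 w0 mod p, X3 w0 mod p}"
    have R: "x mod p \<in> R" if "p dvd cubic a x" for x
    proof -
      have "p dvd fst w0 * ((x - X1 w0) * (x - X2 w0) * (x - X3 w0))"
        using that theta[of w0 x] w0(2) cong_dvd_iff by blast
      moreover have "\<not> p dvd fst w0" using w0(1) zdvd_not_zless by auto
      ultimately have "p dvd x - X1 w0 \<or> p dvd x - X2 w0 \<or> p dvd x - X3 w0"
        using p(1) by (simp add: prime_dvd_mult_iff)
      thus ?thesis by (auto simp: R_def mod_eq_dvd_iff)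
    qed
    define F where "F = {w \<in> ?W. \<theta> w = a}"
    define q where "q = (\<lambda>w. (X1 w mod p, X2 w mod p))"
    have q: "q w \<in> R \<times> R" if "w \<in> F" for w
    proof -
      have "\<theta> w = a" using that by (simp add: F_def)
      hence "p dvd cubic a (X1 w)" "p dvd cubic a (X2 w)"
        using theta[of w "X1 w"] theta[of w "X2 w"] by (auto simp: cong_dvd_iff)
      thus ?thesis using R by (simp add: q_def)
    qed
    have inj: "inj_on q F"
    proof (rule inj_onI)
      fix w w' assume w: "w \<in> F" "w' \<in> F" and e: "q w = q w'"
      obtain c u v where cuv: "w = (c, u, v)" by (cases w)
      obtain c' u' v' where cuv': "w' = (c', u', v')" by (cases w')
      have "c mod p = c' mod p" using w cuv cuv' by (auto simp: F_def \<theta>_def)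
      hence c: "c = c'" using w cuv cuv' by (auto simp: F_def)
      have 1: "[u * r1 + v = u' * r1 + v'] (mod p)" and 2: "[u * r2 + v = u' * r2 + v'] (mod p)"
        using e cuv cuv' by (auto simp: q_def X1_X2_X3_def cong_def)
      have "[u * (r1 - r2) = u' * (r1 - r2)] (mod p)"
        using cong_diff[OF 1 2] by (simp add: algebra_simps)
      hence "[u = u'] (mod p)" using coprime_prime[OF r(1)] by (simp add: cong_mult_rcancel)
      hence u: "u = u'" using w cuv cuv' by (auto simp: F_def cong_def)
      have "[v = v'] (mod p)" using 1 u by (simp add: cong_add_lcancel)
      hence v: "v = v'" using w cuv cuv' by (auto simp: F_def cong_def)
      show "w = w'" using c u v cuv cuv' by simp
    qed
    have "card F \<le> card (R \<times> R)"
      by (rule card_inj_on_le[OF inj]) (use q in blast, simp add: R_def)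
    also have "\<dots> \<le> 3 * 3"
    proof -
      have "card R \<le> 3" unfolding R_def by (simp add: card_insert_if)
      thus ?thesis unfolding card_cartesian_product by (rule mult_le_mono) fact
    qed
    finally show ?thesis by (simp add: F_def)
  next
    case True thus ?thesis by (simp only: card.empty)
  qed
  have cardW: "real (card ?W) = (real_of_int p - 1)\<^sup>2 * p" using p by (simp add: power2_eq_square of_nat_diff)
  have "real (card ?W) * U ^ 4 = (\<Sum>w\<in>?W. T (\<theta> w) ^ 4)" using T by simp
  also have "\<dots> = (\<Sum>a\<in>\<theta> ` ?W. \<Sum>w\<in>{w \<in> ?W. \<theta> w = a}. T (\<theta> w) ^ 4)"
    by (rule sum.image_gen) simp
  also have "\<dots> = (\<Sum>a\<in>\<theta> ` ?W. real (card {w \<in> ?W. \<theta> w = a}) * T a ^ 4)"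
    by (intro sum.cong refl) simp
  also have "\<dots> \<le> (\<Sum>a\<in>\<theta> ` ?W. 9 * T a ^ 4)"
    using fiber by (intro sum_mono mult_right_mono) (auto simp: of_nat_le_iff[of _ 9, where 'a = real, simplified])
  also have "\<dots> \<le> (\<Sum>a\<in>?A. 9 * T a ^ 4)"
    using p0 by (intro sum_mono2) (auto simp: \<theta>_def)
  also have "\<dots> = 9 * (\<Sum>a\<in>?A. T a ^ 4)" by (simp add: sum_distrib_left)
  also have "\<dots> \<le> 9 * (3 * real_of_int p ^ 6)"
    using sum_cubic_fourth_moment unfolding T_def by simp
  finally have main: "(real_of_int p - 1)\<^sup>2 * p * U ^ 4 \<le> 27 * real_of_int p ^ 6" using cardW by simp
  have p3: "real_of_int p \<ge> 3" using p by simp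
  \<comment> \<open>For p >= 3 one has p - 1 >= 2 p / 3, so the fourth power is at most 27 * 9/4 =
    60.75 times p^3, below the claimed 81 p^3.\<close>
  have "(2 / 3 * real_of_int p)\<^sup>2 \<le> (real_of_int p - 1)\<^sup>2" using p3 by (intro power_mono) auto
  hence "(2 / 3 * real_of_int p)\<^sup>2 * p * U ^ 4 \<le> (real_of_int p - 1)\<^sup>2 * p * U ^ 4"
    using p3 by (intro mult_right_mono) auto
  with main have "real_of_int p ^ 3 * (4 / 9 * U ^ 4) \<le> real_of_int p ^ 3 * (27 * real_of_int p ^ 3)"
    by (simp add: power2_eq_square power3_eq_cube algebra_simps eval_nat_numeral)
  hence "4 / 9 * U ^ 4 \<le> 27 * real_of_int p ^ 3" using p3 by (subst (asm) mult_le_cancel_left_pos) auto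
  moreover have "real_of_int p ^ 3 \<ge> 0" using p3 by simp
  ultimately show ?thesis unfolding U_def[symmetric] by linarith
qed

lemma ex_inverse_mod: "\<not> p dvd k \<Longrightarrow> \<exists>t\<in>{1..<p}. [k * t = 1] (mod p)"
proof -
  assume "\<not> p dvd k"
  hence "coprime k p" by (rule coprime_prime)
  then obtain t where t: "[k * t = 1] (mod p)" using cong_solve_coprime_int by blast
  have t2: "[k * (t mod p) = 1] (mod p)" using t by (simp add: cong_def mod_mult_right_eq)
  have "t mod p \<noteq> 0"
  proof
    assume "t mod p = 0"
    with t2 show False using p by (simp add: cong_def)
  qed
  hence "t mod p \<in> {1..<p}" using p pos_mod_sign[of p t] pos_mod_bound[of p t]
    unfolding atLeastLessThan_iff by linarith
  thus ?thesis using t2 by blast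
qed

text \<open>Shift so that d becomes 0 and put k = 1/t. Pulling k out of each factor leaves the
  fourth power of k, a square, times a product of three linear factors in t. Only d has to be
  isolated; a, b, c may coincide modulo p, which is treated separately.\<close>

lemma quartic_character_sum_le:
  assumes nd: "\<not> p dvd d - a" "\<not> p dvd d - b" "\<not> p dvd d - c"
  shows "\<bar>\<Sum>k\<in>P. real_of_int (Legendre ((k - a) * (k - b) * (k - c) * (k - d)) p)\<bar> \<le> 4 * real_of_int p powr (3 / 4)"
proof -
  define \<alpha> \<beta> \<gamma> where "\<alpha> = d - a" "\<beta> = d - b" "\<gamma> = d - c"
  note abc = \<alpha>_\<beta>_\<gamma>_def
  have nd': "\<not> p dvd \<alpha>" "\<not> p dvd \<beta>" "\<not> p dvd \<gamma>" using nd by (auto simp: abc)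
  have p0: "p > 0" using p by simp
  define f where "f = (\<lambda>k. real_of_int (Legendre ((k - a) * (k - b) * (k - c) * (k - d)) p))"
  define g where "g = (\<lambda>t. real_of_int (Legendre ((1 + \<alpha> * t) * (1 + \<beta> * t) * (1 + \<gamma> * t)) p))"
  define Y where "Y = (\<Sum>t\<in>P. g t)"
  have "\<forall>k\<in>{1..<p}. \<exists>t\<in>{1..<p}. [k * t = 1] (mod p)"
    using ex_inverse_mod zdvd_not_zless by fastforce
  then obtain \<iota> where io: "\<And>k. k \<in> {1..<p} \<Longrightarrow> \<iota> k \<in> {1..<p}" "\<And>k. k \<in> {1..<p} \<Longrightarrow> [k * \<iota> k = 1] (mod p)"
    by metis
  have inj: "inj_on \<iota> {1..<p}"
  proof (rule inj_onI)
    fix x y assume x: "x \<in> {1..<p}" and y: "y \<in> {1..<p}" and e: "\<iota> x = \<iota> y"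
    have "[x * (y * \<iota> y) = x * 1] (mod p)" by (intro cong_mult cong_refl io y)
    moreover have "[y * (x * \<iota> x) = y * 1] (mod p)" by (intro cong_mult cong_refl io x)
    ultimately have "[x = y] (mod p)" using e by (simp add: cong_def mult_ac)
    thus "x = y" using x y by (simp add: cong_def)
  qed
  have "\<iota> ` {1..<p} = {1..<p}" using io(1) inj by (intro card_subset_eq) (auto simp: card_image)
  hence bij: "bij_betw \<iota> {1..<p} {1..<p}" using inj by (simp add: bij_betw_def)
  have P: "P = insert 0 {1..<p}" using p0 by auto
  have "(\<Sum>k\<in>P. f k) = (\<Sum>k\<in>P. f (k + d))"
  proof (rule sum_shift_residues[symmetric, OF p0])
    fix x
    have "[(x mod p - a) * (x mod p - b) * (x mod p - c) * (x mod p - d) = (x - a) * (x - b) * (x - c) * (x - d)] (mod p)"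
      by (intro cong_mult cong_diff cong_refl) auto
    thus "f (x mod p) = f x" unfolding f_def using Legendre_cong by simp
  qed
  \<comment> \<open>The term k = 0 vanishes, since the last factor is then 0.\<close>
  also have "\<dots> = (\<Sum>k\<in>{1..<p}. f (k + d))"
    unfolding P by (subst sum.insert) (auto simp: f_def Legendre_eq_0_iff)
  also have "\<dots> = (\<Sum>k\<in>{1..<p}. g (\<iota> k))"
  proof (intro sum.cong refl)
    fix k assume k: "k \<in> {1..<p}"
    hence "\<not> p dvd k" using zdvd_not_zless by auto
    hence "\<not> p dvd k\<^sup>2" using p(1) prime_dvd_power by blast
    hence L4: "Legendre (k\<^sup>2 * k\<^sup>2) p = 1"
      unfolding Legendre_mult[OF p] using Legendre_cases[of "k\<^sup>2" p] Legendre_eq_0_iff[of "k\<^sup>2" p] by auto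
    have "[(k + d - a) * (k + d - b) * (k + d - c) * (k + d - d) =
       (k * 1 + (k * \<iota> k) * \<alpha>) * (k * 1 + (k * \<iota> k) * \<beta>) * (k * 1 + (k * \<iota> k) * \<gamma>) * k] (mod p)"
    proof -
      have *: "[k + z = k * 1 + (k * \<iota> k) * z] (mod p)" for z
        using cong_add[OF cong_refl[of k p] cong_mult[OF cong_sym[OF io(2)[OF k]] cong_refl[of z p]]] by simp
      show ?thesis
        using cong_mult[OF cong_mult[OF cong_mult[OF *[of \<alpha>] *[of \<beta>]] *[of \<gamma>]] cong_refl[of k p]]
        by (simp add: abc add_diff_eq)
    qed
    also have "(k * 1 + (k * \<iota> k) * \<alpha>) * (k * 1 + (k * \<iota> k) * \<beta>) * (k * 1 + (k * \<iota> k) * \<gamma>) * k =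
       (k\<^sup>2 * k\<^sup>2) * ((1 + \<alpha> * \<iota> k) * (1 + \<beta> * \<iota> k) * (1 + \<gamma> * \<iota> k))"
      by (simp add: power2_eq_square algebra_simps)
    finally have "Legendre ((k + d - a) * (k + d - b) * (k + d - c) * (k + d - d)) p =
      Legendre ((k\<^sup>2 * k\<^sup>2) * ((1 + \<alpha> * \<iota> k) * (1 + \<beta> * \<iota> k) * (1 + \<gamma> * \<iota> k))) p" by (rule Legendre_cong)
    also have "\<dots> = Legendre ((1 + \<alpha> * \<iota> k) * (1 + \<beta> * \<iota> k) * (1 + \<gamma> * \<iota> k)) p"
      by (simp only: Legendre_mult[OF p, of "k\<^sup>2 * k\<^sup>2"] L4 mult_1)
    finally show "f (k + d) = g (\<iota> k)" by (simp add: f_def g_def)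
  qed
  also have "\<dots> = (\<Sum>t\<in>{1..<p}. g t)" by (rule sum.reindex_bij_betw[OF bij])
  \<comment> \<open>\<open>Y\<close> also includes t = 0, which is no inverse and contributes the
    value 1. This costs the step from 3 to 4 in the final constant.\<close>
  also have "\<dots> = Y - 1"
  proof -
    have "Legendre 1 p = 1"
      using p by (auto simp: Legendre_def QuadRes_def cong_0_iff intro: exI[of _ 1])
    thus ?thesis unfolding Y_def P by (subst sum.insert) (auto simp: g_def)
  qed
  finally have fY: "(\<Sum>k\<in>P. f k) = Y - 1" .
  have p1: "1 \<le> real_of_int p powr (3 / 4)" using p by (intro ge_one_powr_ge_zero) auto
  \<comment> \<open>If two linear factors agree modulo p, their product has symbol 1 except at the
    single zero, so the sum is a complete linear Legendre sum, which is 0, minus at most one term of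
    absolute value at most 1.\<close>
  have double: "\<bar>\<Sum>t\<in>P. real_of_int (Legendre ((1 + x * t) * (1 + y * t) * (1 + z * t)) p)\<bar> \<le> 1"
    if xyz: "p dvd x - y" "\<not> p dvd y" "\<not> p dvd z" for x y z
  proof -
    have "Legendre ((1 + x * t) * (1 + y * t) * (1 + z * t)) p =
       Legendre (z * t + 1) p - (if p dvd 1 + y * t then Legendre (z * t + 1) p else 0)" for t
    proof -
      have "[x = y] (mod p)" using xyz by (simp add: cong_iff_dvd_diff)
      hence "[1 + x * t = 1 + y * t] (mod p)" by (intro cong_add cong_mult cong_refl)
      hence "Legendre (1 + x * t) p = Legendre (1 + y * t) p" by (rule Legendre_cong)
      moreover have "Legendre (1 + y * t) p * Legendre (1 + y * t) p = (if p dvd 1 + y * t then 0 else 1)"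
        using Legendre_cases[of "1 + y * t" p] Legendre_eq_0_iff[of "1 + y * t" p] by auto
      ultimately show ?thesis by (simp add: Legendre_mult[OF p] add.commute)
    qed
    hence "(\<Sum>t\<in>P. real_of_int (Legendre ((1 + x * t) * (1 + y * t) * (1 + z * t)) p))
      = real_of_int (\<Sum>t\<in>P. Legendre (z * t + 1) p) - (\<Sum>t\<in>P. if p dvd 1 + y * t then real_of_int (Legendre (z * t + 1) p) else 0)"
      unfolding of_int_sum sum_subtractf[symmetric] by (intro sum.cong refl) (simp split: if_splits)
    also have "(\<Sum>t\<in>P. Legendre (z * t + 1) p) = 0" by (rule sum_Legendre_affine[OF p xyz(3)])
    finally have eq: "\<bar>\<Sum>t\<in>P. real_of_int (Legendre ((1 + x * t) * (1 + y * t) * (1 + z * t)) p)\<bar>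
      = \<bar>\<Sum>t\<in>P. if p dvd 1 + y * t then real_of_int (Legendre (z * t + 1) p) else 0\<bar>" by simp
    also have "\<dots> \<le> (\<Sum>t\<in>P. \<bar>if p dvd 1 + y * t then real_of_int (Legendre (z * t + 1) p) else 0\<bar>)" by (rule sum_abs)
    also have "\<dots> \<le> (\<Sum>t\<in>P. if p dvd 1 + y * t then 1 else 0)"
    proof (rule sum_mono)
      fix t show "\<bar>if p dvd 1 + y * t then real_of_int (Legendre (z * t + 1) p) else 0\<bar> \<le> (if p dvd 1 + y * t then 1 else 0)"
        using Legendre_cases[of "z * t + 1" p] by auto
    qed
    also have "\<dots> = real (card {t \<in> P. p dvd 1 + y * t})" by (simp add: sum.If_cases Int_def)
    also have "\<dots> \<le> 1"
    proof -
     have "s = t" if s: "s \<in> {t \<in> P. p dvd 1 + y * t}" and t: "t \<in> {t \<in> P. p dvd 1 + y * t}" for s t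
     proof -
      have "p dvd (1 + y * s) - (1 + y * t)" using s t by (intro dvd_diff) auto
      hence "p dvd y * (s - t)" by (simp add: algebra_simps)
      hence "p dvd s - t" using xyz(2) p(1) prime_dvd_mult_iff by blast
      thus "s = t" using s t by (auto simp: mod_eq_dvd_iff[symmetric])
     qed
     moreover have "finite {t \<in> P. p dvd 1 + y * t}" by (rule finite_subset[of _ P]) auto
     ultimately have "card {t \<in> P. p dvd 1 + y * t} \<le> Suc 0" using card_le_Suc0_iff_eq by blast
     thus ?thesis by simp
    qed
    finally show ?thesis by simp
  qed
  have Y: "\<bar>Y\<bar> \<le> 3 * real_of_int p powr (3 / 4)"
  proof (cases "p dvd \<alpha> - \<beta> \<or> p dvd \<alpha> - \<gamma> \<or> p dvd \<beta> - \<gamma>")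
    case True
    hence "\<bar>Y\<bar> \<le> 1"
      using double[of \<alpha> \<beta> \<gamma>] double[of \<alpha> \<gamma> \<beta>] double[of \<beta> \<gamma> \<alpha>] nd'
      unfolding Y_def g_def by (auto simp: mult_ac)
    thus ?thesis using p1 by linarith
  next
    case False
    obtain A where A: "[\<alpha> * A = 1] (mod p)" using ex_inverse_mod[OF nd'(1)] ..
    obtain B where B: "[\<beta> * B = 1] (mod p)" using ex_inverse_mod[OF nd'(2)] ..
    obtain C where C: "[\<gamma> * C = 1] (mod p)" using ex_inverse_mod[OF nd'(3)] ..
    note ABC = A B C
    \<comment> \<open>Inverses of incongruent units are incongruent, so the roots -A, -B, -C satisfy
      the hypotheses of the cubic bound.\<close>
    have ne: "\<not> p dvd - X - - Y" if "[x * X = 1] (mod p)" "[y * Y = 1] (mod p)" "\<not> p dvd x - y" for x X y Y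
    proof
      assume "p dvd - X - - Y"
      hence "p dvd Y - X" by (simp add: algebra_simps)
      hence "p dvd (Y - X) * (x * y)" by (rule dvd_mult2)
      moreover have "[(Y - X) * (x * y) = x - y] (mod p)"
        using cong_diff[OF cong_mult[OF cong_refl[of x p] that(2)] cong_mult[OF cong_refl[of y p] that(1)]]
        by (simp add: algebra_simps)
      ultimately show False using that(3) cong_dvd_iff by blast
    qed
    define U where "U = (\<Sum>t\<in>P. real_of_int (Legendre ((t - (- A)) * (t - (- B)) * (t - (- C))) p))"
    have "U ^ 4 \<le> 81 * real_of_int p ^ 3"
      unfolding U_def using False ne[OF ABC(1,2)] ne[OF ABC(1,3)] ne[OF ABC(2,3)] by (intro cubic_character_sum_le) auto
    also have "81 * real_of_int p ^ 3 = (3 * real_of_int p powr (3 / 4)) ^ 4"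
      using p by (simp add: power_mult_distrib powr_powr flip: powr_realpow powr_numeral)
    finally have "\<bar>U\<bar> ^ 4 \<le> (3 * real_of_int p powr (3 / 4)) ^ 4" by simp
    hence U: "\<bar>U\<bar> \<le> 3 * real_of_int p powr (3 / 4)" by (rule power_le_imp_le_base[where n = 3, simplified]) simp
    have "Legendre ((1 + \<alpha> * t) * (1 + \<beta> * t) * (1 + \<gamma> * t)) p =
       Legendre (\<alpha> * \<beta> * \<gamma>) p * Legendre ((t - (- A)) * (t - (- B)) * (t - (- C))) p" for t
    proof -
      have "[(\<alpha> * A + \<alpha> * t) * (\<beta> * B + \<beta> * t) * (\<gamma> * C + \<gamma> * t) = (1 + \<alpha> * t) * (1 + \<beta> * t) * (1 + \<gamma> * t)] (mod p)"
        by (intro cong_mult cong_add ABC cong_refl)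
      hence "Legendre ((1 + \<alpha> * t) * (1 + \<beta> * t) * (1 + \<gamma> * t)) p = Legendre ((\<alpha> * A + \<alpha> * t) * (\<beta> * B + \<beta> * t) * (\<gamma> * C + \<gamma> * t)) p"
        by (rule Legendre_cong[symmetric])
      also have "(\<alpha> * A + \<alpha> * t) * (\<beta> * B + \<beta> * t) * (\<gamma> * C + \<gamma> * t) = (\<alpha> * \<beta> * \<gamma>) * ((t - (- A)) * (t - (- B)) * (t - (- C)))"
        by (simp add: algebra_simps)
      finally show ?thesis by (simp only: Legendre_mult[OF p, of "\<alpha> * \<beta> * \<gamma>"])
    qed
    hence "Y = Legendre (\<alpha> * \<beta> * \<gamma>) p * U"
      by (simp only: Y_def g_def U_def of_int_mult sum_distrib_left)
    hence "\<bar>Y\<bar> \<le> \<bar>U\<bar>" using Legendre_cases[of "\<alpha> * \<beta> * \<gamma>" p] by auto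
    thus ?thesis using U by linarith
  qed
  show ?thesis using Y fY p1 unfolding f_def[symmetric] by linarith
qed

end

section \<open>Sampling the fourth norm at roots of unity\<close>

definition eexp :: "nat \<Rightarrow> real \<Rightarrow> complex" where
  "eexp n x = cis (2 * pi * x / real n)"

lemma eexp_add: "eexp n (x + y) = eexp n x * eexp n y"
  by (simp add: eexp_def cis_mult add_divide_distrib distrib_left)

lemma eexp_diff: "eexp n (x - y) = eexp n x * cnj (eexp n y)"
  by (simp add: eexp_def cis_cnj cis_mult diff_divide_distrib right_diff_distrib)

lemma norm_eexp [simp]: "cmod (eexp n x) = 1"
  by (simp add: eexp_def)

lemma eexp_power: "eexp n x ^ k = eexp n (real k * x)"
  by (simp add: eexp_def Complex.DeMoivre mult_ac)

lemma eexp_eq_1_iff: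
  assumes "n > 0"
  shows "eexp n (of_int j) = 1 \<longleftrightarrow> int n dvd j"
proof -
  have "eexp n (of_int j) = 1 \<longleftrightarrow> (\<exists>k::int. 2 * pi * of_int j / real n = of_int (2 * k) * pi)"
    unfolding eexp_def cis_conv_exp exp_eq_1 by simp
  also have "\<dots> \<longleftrightarrow> (\<exists>k::int. real_of_int j = real_of_int (int n * k))"
    using assms by (intro ex_cong1) (auto simp: field_simps)
  also have "\<dots> \<longleftrightarrow> int n dvd j" unfolding of_int_eq_iff dvd_def ..
  finally show ?thesis .
qed

lemma eexp_add_period: "n > 0 \<Longrightarrow> eexp n (x + of_int (int n * k)) = eexp n x"
  using eexp_eq_1_iff[of n "int n * k"] by (simp only: eexp_add) simp

lemma eexp_cong: "n > 0 \<Longrightarrow> [i = j] (mod int n) \<Longrightarrow> eexp n (of_int i) = eexp n (of_int j)"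
  using eexp_add_period[of n "of_int i"] by (metis cong_iff_lin of_int_add)

lemma sum_eexp:
  assumes n: "n > 0"
  shows "(\<Sum>k\<in>{0..<int n}. eexp n (of_int (k * j))) = (if int n dvd j then of_nat n else 0)"
proof (cases "int n dvd j")
  case True
  hence "eexp n (of_int (k * j)) = 1" for k using eexp_eq_1_iff[OF n, of "k * j"] by simp
  thus ?thesis using True by simp
next
  case False
  have "(\<Sum>k\<in>{0..<int n}. eexp n (of_int ((k + 1) * j))) = (\<Sum>k\<in>{0..<int n}. eexp n (of_int (k * j)))"
    using n by (intro sum_shift_residues[where f = "\<lambda>k. eexp n (of_int (k * j))"] eexp_cong cong_mult) auto
  moreover have "(\<Sum>k\<in>{0..<int n}. eexp n (of_int ((k + 1) * j))) = eexp n (of_int j) * (\<Sum>k\<in>{0..<int n}. eexp n (of_int (k * j)))"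
    unfolding sum_distrib_left by (intro sum.cong refl) (simp only: distrib_right of_int_add eexp_add mult_1_left mult.commute[of "eexp n (of_int j)"])
  ultimately have "(eexp n (of_int j) - 1) * (\<Sum>k\<in>{0..<int n}. eexp n (of_int (k * j))) = 0" by (simp add: algebra_simps)
  moreover have "eexp n (of_int j) \<noteq> 1" using False eexp_eq_1_iff[OF n] by blast
  ultimately show ?thesis using False by simp
qed

section \<open>Parseval identities over residues and over the circle\<close>

lemma norm_square_sum:
  fixes f :: "'b \<Rightarrow> complex"
  shows "complex_of_real ((cmod (\<Sum>x\<in>A. f x))\<^sup>2) = (\<Sum>x\<in>A. \<Sum>y\<in>A. f x * cnj (f y))"
  by (simp add: complex_norm_square sum_product del: of_real_power)

text \<open>The frequencies may be any finite set of pairwise incongruent integers, so that the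
  identity serves full residue systems and truncated index sets alike.\<close>

lemma parseval_residues:
  assumes n: "n > 0" and J: "finite J" "\<And>i j. i \<in> J \<Longrightarrow> j \<in> J \<Longrightarrow> [i = j] (mod int n) \<Longrightarrow> i = j"
  shows "(\<Sum>k\<in>{0..<int n}. (cmod (\<Sum>j\<in>J. c j * eexp n (of_int (j * k))))\<^sup>2) = n * (\<Sum>j\<in>J. (cmod (c j))\<^sup>2)"
proof -
  let ?N = "{0..<int n}"
  have "complex_of_real (\<Sum>k\<in>?N. (cmod (\<Sum>j\<in>J. c j * eexp n (of_int (j * k))))\<^sup>2)
    = (\<Sum>k\<in>?N. \<Sum>i\<in>J. \<Sum>j\<in>J. (c i * cnj (c j)) * eexp n (of_int (k * (i - j))))"
    unfolding of_real_sum norm_square_sum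
    by (intro sum.cong refl) (simp add: right_diff_distrib eexp_diff mult_ac)
  also have "\<dots> = (\<Sum>i\<in>J. \<Sum>j\<in>J. \<Sum>k\<in>?N. (c i * cnj (c j)) * eexp n (of_int (k * (i - j))))"
    by (simp only: sum.swap[of _ _ ?N])
  also have "\<dots> = (\<Sum>i\<in>J. \<Sum>j\<in>J. if i = j then c i * cnj (c j) * n else 0)"
  proof (intro sum.cong refl)
    fix i j assume "i \<in> J" "j \<in> J"
    hence "int n dvd i - j \<longleftrightarrow> i = j" using J(2)[of i j] by (auto simp: cong_iff_dvd_diff)
    thus "(\<Sum>k\<in>?N. (c i * cnj (c j)) * eexp n (of_int (k * (i - j)))) = (if i = j then c i * cnj (c j) * n else 0)"
      by (simp only: sum_distrib_left[symmetric] sum_eexp[OF n]) auto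
  qed
  also have "\<dots> = (\<Sum>i\<in>J. c i * cnj (c i) * n)" using J(1) by simp
  also have "\<dots> = complex_of_real (n * (\<Sum>j\<in>J. (cmod (c j))\<^sup>2))"
    by (simp add: complex_norm_square sum_distrib_left mult.commute del: of_real_power)
  finally show ?thesis unfolding of_real_eq_iff .
qed

lemma has_integral_cis_int:
  fixes m :: int
  shows "((\<lambda>\<theta>. cis (of_int m * \<theta>)) has_integral (if m = 0 then 2 * pi else 0)) {0..2*pi}"
proof (cases "m = 0")
  case True
  show ?thesis using has_integral_const_real[of "1::complex" 0 "2 * pi"] True by (simp add: scaleR_conv_of_real)
next
  case False
  define F where "F = (\<lambda>\<theta>. exp (\<i> * of_int m * of_real \<theta>) / (\<i> * of_int m))"
  have "((\<lambda>\<theta>. cis (of_int m * \<theta>)) has_integral (F (2 * pi) - F 0)) {0..2*pi}"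
  proof (rule fundamental_theorem_of_calculus)
    fix \<theta> :: real
    have "((\<lambda>z. exp (\<i> * of_int m * z) / (\<i> * of_int m)) has_field_derivative exp (\<i> * of_int m * of_real \<theta>)) (at (of_real \<theta>))"
      using False by (auto intro!: derivative_eq_intros)
    from has_vector_derivative_real_field[OF this]
    show "(F has_vector_derivative cis (of_int m * \<theta>)) (at \<theta> within {0..2*pi})"
      unfolding F_def cis_conv_exp by (auto simp: mult_ac intro: has_vector_derivative_at_within)
  qed auto
  moreover have "exp (\<i> * of_int m * of_real (2 * pi)) = 1"
    using cis_multiple_2pi[of "of_int m"] by (simp add: cis_conv_exp mult_ac)
  ultimately show ?thesis using False by (simp add: F_def)
qed

lemma poly_eq_sum:
  fixes A :: "'a :: comm_semiring_1 poly"
  assumes "\<And>j. j \<ge> N \<Longrightarrow> Polynomial.coeff A j = 0"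
  shows "poly A x = (\<Sum>j<N. Polynomial.coeff A j * x ^ j)"
proof -
  have "poly A x = (\<Sum>j\<le>degree A. Polynomial.coeff A j * x ^ j)" by (rule poly_altdef)
  also have "\<dots> = (\<Sum>j\<in>{..degree A} \<union> {..<N}. Polynomial.coeff A j * x ^ j)"
    by (intro sum.mono_neutral_left) (auto simp: coeff_eq_0)
  also have "\<dots> = (\<Sum>j<N. Polynomial.coeff A j * x ^ j)"
    by (intro sum.mono_neutral_right) (auto simp: assms)
  finally show ?thesis .
qed

lemma poly_eexp:
  assumes "\<And>j. j \<ge> N \<Longrightarrow> Polynomial.coeff A j = 0"
  shows "poly A (eexp n x) = (\<Sum>j\<in>{0..<int N}. Polynomial.coeff A (nat j) * eexp n (of_int j * x))"
proof -
  have "poly A (eexp n x) = (\<Sum>j<N. Polynomial.coeff A j * eexp n (real j * x))"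
    using poly_eq_sum[OF assms] by (simp add: eexp_power)
  also have "\<dots> = (\<Sum>j\<in>{0..<int N}. Polynomial.coeff A (nat j) * eexp n (of_int j * x))"
    by (rule sum.reindex_bij_witness[of _ nat int]) auto
  finally show ?thesis .
qed

lemma integral_norm_poly_square:
  assumes "\<And>j. j \<ge> N \<Longrightarrow> Polynomial.coeff A j = 0"
  shows "integral {0..2*pi} (\<lambda>\<theta>. (cmod (poly A (cis \<theta>)))\<^sup>2) = 2 * pi * (\<Sum>j<N. (cmod (Polynomial.coeff A j))\<^sup>2)"
proof -
  let ?c = "Polynomial.coeff A"
  have eq: "complex_of_real ((cmod (poly A (cis \<theta>)))\<^sup>2) = (\<Sum>i<N. \<Sum>j<N. (?c i * cnj (?c j)) * cis (of_int (int i - int j) * \<theta>))" for \<theta>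
  proof -
    have "poly A (cis \<theta>) = (\<Sum>j<N. ?c j * cis (real j * \<theta>))"
      using poly_eq_sum[OF assms] by (simp add: Complex.DeMoivre)
    hence "complex_of_real ((cmod (poly A (cis \<theta>)))\<^sup>2) =
      (\<Sum>i<N. \<Sum>j<N. ?c i * cis (real i * \<theta>) * cnj (?c j * cis (real j * \<theta>)))"
      by (simp only: norm_square_sum)
    also have "\<dots> = (\<Sum>i<N. \<Sum>j<N. (?c i * cnj (?c j)) * cis (of_int (int i - int j) * \<theta>))"
    proof (intro sum.cong refl)
      fix i j
      have "cis (of_int (int i - int j) * \<theta>) = cis (real i * \<theta>) * cis (- (real j * \<theta>))"
        by (simp add: cis_mult left_diff_distrib)
      thus "?c i * cis (real i * \<theta>) * cnj (?c j * cis (real j * \<theta>)) = (?c i * cnj (?c j)) * cis (of_int (int i - int j) * \<theta>)"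
        by (simp add: cis_cnj)
    qed
    finally show ?thesis .
  qed
  have "((\<lambda>\<theta>. complex_of_real ((cmod (poly A (cis \<theta>)))\<^sup>2)) has_integral
     (\<Sum>i<N. \<Sum>j<N. (?c i * cnj (?c j)) * (if int i - int j = 0 then 2 * pi else 0))) {0..2*pi}"
    unfolding eq by (intro has_integral_sum has_integral_mult_right has_integral_cis_int finite_lessThan)
  also have "(\<Sum>i<N. \<Sum>j<N. (?c i * cnj (?c j)) * (if int i - int j = 0 then 2 * pi else 0)) =
     (\<Sum>i<N. \<Sum>j<N. if i = j then ?c i * cnj (?c j) * (2 * pi) else 0)"
    by (intro sum.cong refl) auto
  also have "\<dots> = complex_of_real (2 * pi * (\<Sum>j<N. (cmod (?c j))\<^sup>2))"
    by (simp add: sum_distrib_left complex_norm_square mult.commute del: of_real_power)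
  finally have "((\<lambda>\<theta>. Re (complex_of_real ((cmod (poly A (cis \<theta>)))\<^sup>2))) has_integral
      Re (complex_of_real (2 * pi * (\<Sum>j<N. (cmod (?c j))\<^sup>2)))) {0..2*pi}"
    by (rule has_integral_Re)
  thus ?thesis by (simp add: integral_unique del: of_real_power)
qed

lemma lnorm_2_power4:
  assumes "\<And>j. j \<ge> N \<Longrightarrow> Polynomial.coeff A j = 0"
  shows "lnorm 2 A ^ 4 = (\<Sum>j<N. (cmod (Polynomial.coeff A j))\<^sup>2)\<^sup>2"
proof -
  define s where "s = (\<Sum>j<N. (cmod (Polynomial.coeff A j))\<^sup>2)"
  have s: "s \<ge> 0" by (simp add: s_def sum_nonneg)
  have "lnorm 2 A = s powr (1/2)"
    unfolding lnorm_def by (simp add: powr_numeral integral_norm_poly_square[OF assms] s_def)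
  also have "\<dots> = sqrt s" using s by (simp add: powr_half_sqrt)
  finally have "lnorm 2 A ^ 4 = ((sqrt s)\<^sup>2)\<^sup>2" by simp
  also have "\<dots> = s\<^sup>2" using s by (simp only: real_sqrt_pow2)
  finally show ?thesis by (simp add: s_def)
qed

text \<open>The fourth power of |A| is the square of |B| with B = A^2, whose coefficients vanish
  from index 2n on. Hence the integral and the average over 2n-th roots of unity both equal the sum
  of the squared moduli of the coefficients of B.\<close>

lemma lnorm_4_power4:
  assumes n: "n > 0" and A: "\<And>j. j \<ge> n \<Longrightarrow> Polynomial.coeff A j = 0"
  shows "lnorm 4 A ^ 4 = (\<Sum>k<2*n. cmod (poly A (eexp n (real k / 2))) ^ 4) / (2 * n)"
proof -
  define B where "B = A * A"
  have B: "Polynomial.coeff B j = 0" if "j \<ge> 2 * n" for j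
    unfolding B_def coeff_mult using that
    by (intro sum.neutral ballI) (metis A add_less_mono atMost_iff le_add_diff_inverse linorder_not_less mult_2 mult_zero_left mult_zero_right)
  have norm: "cmod (poly A x) ^ 4 = (cmod (poly B x))\<^sup>2" for x
    by (simp add: B_def norm_mult power4_eq_xxxx power2_eq_square)
  define s where "s = (\<Sum>j<2*n. (cmod (Polynomial.coeff B j))\<^sup>2)"
  have s: "s \<ge> 0" by (simp add: s_def sum_nonneg)
  have "lnorm 4 A = s powr (1/4)"
    unfolding lnorm_def by (simp add: powr_numeral norm integral_norm_poly_square[OF B] s_def)
  hence 1: "lnorm 4 A ^ 4 = s"
    using s by (cases "s = 0") (auto simp: powr_powr simp flip: powr_realpow powr_numeral)
  have E2: "eexp n (real k / 2) = eexp (2 * n) (real k)" for k by (simp add: eexp_def)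
  have "(\<Sum>k<2*n. cmod (poly A (eexp n (real k / 2))) ^ 4) = (\<Sum>k<2*n. (cmod (poly B (eexp (2 * n) (real_of_int (int k)))))\<^sup>2)"
    by (simp add: norm E2)
  also have "\<dots> = (\<Sum>k\<in>{0..<int (2 * n)}. (cmod (poly B (eexp (2 * n) (real_of_int k))))\<^sup>2)"
    by (rule sum.reindex_bij_witness[of _ nat int]) auto
  also have "\<dots> = (\<Sum>k\<in>{0..<int (2 * n)}. (cmod (\<Sum>j\<in>{0..<int (2 * n)}. Polynomial.coeff B (nat j) * eexp (2 * n) (of_int (j * k))))\<^sup>2)"
    using poly_eexp[of "2 * n" B "2 * n"] B by simp
  also have "\<dots> = real (2 * n) * (\<Sum>j\<in>{0..<int (2 * n)}. (cmod (Polynomial.coeff B (nat j)))\<^sup>2)"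
    using n by (intro parseval_residues) (auto simp: cong_def)
  also have "(\<Sum>j\<in>{0..<int (2 * n)}. (cmod (Polynomial.coeff B (nat j)))\<^sup>2) = s"
    unfolding s_def by (rule sum.reindex_bij_witness[of _ int nat]) auto
  finally show ?thesis using 1 n by simp
qed

section \<open>Coefficients of the rotated polynomials\<close>

text \<open>Modulo z^n - 1, multiplication by z^s is a cyclic shift of the coefficients. The proof
  exhibits remainder and quotient, and identifies them by the degree of the remainder.\<close>

lemma coeff_rot:
  assumes n: "n > 0" and A: "\<And>j. j \<ge> n \<Longrightarrow> Polynomial.coeff A j = 0"
  shows "Polynomial.coeff (rot n r A) i = (if i < n then Polynomial.coeff A (nat ((int i + \<lfloor>real n * r\<rfloor>) mod int n)) else 0)"
proof -
  define R where "R = \<lfloor>real n * r\<rfloor>"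
  define s where "s = nat ((- R) mod int n)"
  define X :: "complex poly" where "X = Polynomial.monom 1 n - 1"
  have s: "s < n" using n by (simp add: s_def nat_less_iff)
  \<comment> \<open>\<open>C\<close> is the cyclically shifted polynomial. \<open>Q\<close> collects
    the monomials that wrap around: z^(j+s) = z^(j+s-n) + z^(j+s-n) (z^n - 1).\<close>
  define C where "C = (\<Sum>j<n. Polynomial.monom (Polynomial.coeff A j) ((j + s) mod n))"
  define Q where "Q = (\<Sum>j<n. if j + s < n then 0 else Polynomial.monom (Polynomial.coeff A j) (j + s - n))"
  have "A = (\<Sum>j<n. Polynomial.monom (Polynomial.coeff A j) j)"
    by (rule poly_eqI) (simp add: coeff_sum A)
  hence "Polynomial.monom 1 s * A = (\<Sum>j<n. Polynomial.monom (Polynomial.coeff A j) (j + s))"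
    by (metis (no_types, lifting) add.commute mult_1 mult_monom sum.cong sum_distrib_left)
  also have "\<dots> = (\<Sum>j<n. Polynomial.monom (Polynomial.coeff A j) ((j + s) mod n) + (if j + s < n then 0 else Polynomial.monom (Polynomial.coeff A j) (j + s - n)) * X)"
  proof (intro sum.cong refl)
    fix j assume j: "j \<in> {..<n}"
    show "Polynomial.monom (Polynomial.coeff A j) (j + s) = Polynomial.monom (Polynomial.coeff A j) ((j + s) mod n) + (if j + s < n then 0 else Polynomial.monom (Polynomial.coeff A j) (j + s - n)) * X"
    proof (cases "j + s < n")
      case False
      hence "(j + s) mod n = j + s - n" using j s by (simp add: mod_if)
      thus ?thesis using False by (simp add: X_def right_diff_distrib mult_monom)
    qed simp
  qed
  also have "\<dots> = C + Q * X" by (simp add: C_def Q_def sum.distrib sum_distrib_right)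
  finally have eq: "Polynomial.monom 1 s * A = C + Q * X" .
  have cC: "Polynomial.coeff C i = (\<Sum>j<n. if (j + s) mod n = i then Polynomial.coeff A j else 0)" for i
    by (simp add: C_def coeff_sum)
  have "degree X = n"
  proof -
    have "degree (Polynomial.monom 1 n + (- 1 :: complex poly)) = degree (Polynomial.monom (1::complex) n)"
      using n by (intro degree_add_eq_left) (simp add: degree_monom_eq)
    thus ?thesis by (simp add: X_def degree_monom_eq)
  qed
  moreover have "degree C < n"
  proof -
    have "Polynomial.coeff C i = 0" if "i \<ge> n" for i unfolding cC using that n
      by (intro sum.neutral ballI) (metis leD mod_less_divisor)
    hence "degree C \<le> n - 1" by (intro degree_le) auto
    thus ?thesis using n by simp
  qed
  ultimately have "C mod X = C" by (intro mod_poly_less) simp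
  hence "rot n r A = C"
    unfolding rot_def R_def[symmetric] s_def[symmetric] X_def[symmetric] eq by simp
  moreover have "Polynomial.coeff C i = (if i < n then Polynomial.coeff A (nat ((int i + R) mod int n)) else 0)"
  proof (cases "i < n")
    case True
    define j0 where "j0 = nat ((int i + R) mod int n)"
    have j0: "j0 < n" using n by (simp add: j0_def nat_less_iff)
    have "(j + s) mod n = i \<longleftrightarrow> j = j0" if j: "j < n" for j
    proof -
      have "(j + s) mod n = i \<longleftrightarrow> (int j + int s) mod int n = int i mod int n"
        using True by (metis mod_less of_nat_add of_nat_eq_iff of_nat_mod)
      also have "\<dots> \<longleftrightarrow> [int j + int s = int i] (mod int n)" by (simp add: cong_def)
      also have "\<dots> \<longleftrightarrow> [int j + - R = int i] (mod int n)"
      proof -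
        have "[int s = - R] (mod int n)" using n by (simp add: s_def cong_def)
        hence "[int j + int s = int j + - R] (mod int n)" by (intro cong_add cong_refl)
        thus ?thesis using cong_sym cong_trans by blast
      qed
      also have "\<dots> \<longleftrightarrow> [int j = int i + R] (mod int n)"
        by (simp add: cong_iff_dvd_diff algebra_simps)
      also have "\<dots> \<longleftrightarrow> int j = (int i + R) mod int n" using j by (simp add: cong_def)
      also have "\<dots> \<longleftrightarrow> j = j0" using n by (auto simp: j0_def)
      finally show ?thesis .
    qed
    hence "Polynomial.coeff C i = (\<Sum>j<n. if j = j0 then Polynomial.coeff A j else 0)"
      unfolding cC by (intro sum.cong refl) auto
    thus ?thesis using True j0 by (simp add: j0_def)
  next
    case False
    thus ?thesis unfolding cC using n
      by (auto intro!: sum.neutral)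
  qed
  ultimately show ?thesis by (simp add: R_def)
qed

text \<open>The defining sum starts at 1, but the symbol vanishes at 0 for n > 1, so the formula
  also holds at index 0.\<close>

lemma coeff_charpoly:
  assumes "n > 1"
  shows "Polynomial.coeff (charpoly n) j = (if j < n then of_int (Jacobi (int j) n) else 0)"
proof -
  have "Jacobi 0 n = 0" using assms by (simp add: Jacobi_eq_0_iff)
  thus ?thesis using assms by (cases "j = 0") (auto simp: charpoly_def coeff_sum)
qed

section \<open>Gauss sums and interpolation\<close>

lemma sum_even_odd:
  fixes f :: "nat \<Rightarrow> 'a :: comm_monoid_add"
  shows "(\<Sum>k<2*n. f k) = (\<Sum>k<n. f (2 * k)) + (\<Sum>k<n. f (2 * k + 1))"
  by (induction n) (simp_all add: add_ac)

lemma squarefree_prime_split: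
  fixes n :: nat
  assumes "squarefree n" "n > 0" "prime p" "p dvd n"
  obtains m where "n = p * m" "m > 0" "\<not> p dvd m"
proof -
  obtain m where m: "n = p * m" using assms(4) by (elim dvdE)
  have "\<not> p dvd m"
  proof
    assume "p dvd m"
    hence "p ^ 2 dvd n" unfolding m power2_eq_square by (intro mult_dvd_mono) auto
    hence "is_unit p" using assms(1) unfolding squarefree_def by blast
    thus False using assms(3) by simp
  qed
  thus ?thesis using that[of m] m assms(2) by (cases m) auto
qed

definition gauss_sum :: "nat \<Rightarrow> complex" where
  "gauss_sum n = (\<Sum>j\<in>{0..<int n}. of_int (Jacobi j n) * eexp n (of_int j))"

lemma sqrt_power4: "x \<ge> 0 \<Longrightarrow> sqrt x ^ 4 = x\<^sup>2"
  using power_mult[of "sqrt x" 2 2] by simp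

text \<open>For l coprime to n, substitute j -> l j. Otherwise some prime p divides both, the
  exponential depends only on j modulo m = n / p, and the sum factors with the complete Legendre sum
  modulo p, which is 0. Squarefreeness makes p and m coprime.\<close>

lemma gauss_sum_twist:
  assumes n: "odd n" "squarefree n"
  shows "(\<Sum>j\<in>{0..<int n}. of_int (Jacobi j n) * eexp n (of_int (j * l))) = of_int (Jacobi l n) * gauss_sum n"
proof (cases "coprime l (int n)")
  case True
  have n0: "n > 0" using n by (cases n) auto
  have "gauss_sum n = (\<Sum>j\<in>{0..<int n}. of_int (Jacobi (l * j + 0) n) * eexp n (of_int (l * j + 0)))"
    unfolding gauss_sum_def
  proof (rule sum_affine_residues[symmetric, OF _ _ True])
    show "of_int (Jacobi (x mod int n) n) * eexp n (real_of_int (x mod int n)) = of_int (Jacobi x n) * eexp n (real_of_int x)" for x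
      using eexp_cong[OF n0, of "x mod int n" x] by (simp add: Jacobi_mod)
  qed (use n0 in simp)
  also have "\<dots> = of_int (Jacobi l n) * (\<Sum>j\<in>{0..<int n}. of_int (Jacobi j n) * eexp n (of_int (j * l)))"
    by (simp add: Jacobi_mult[OF n(1)] sum_distrib_left mult_ac)
  finally have "of_int (Jacobi l n) * gauss_sum n = of_int ((Jacobi l n)\<^sup>2) * (\<Sum>j\<in>{0..<int n}. of_int (Jacobi j n) * eexp n (of_int (j * l)))"
    by (simp add: power2_eq_square mult_ac)
  also have "(Jacobi l n)\<^sup>2 = 1" using True Jacobi_squared[OF n0, of l] by simp
  finally show ?thesis by simp
next
  case False
  have n0: "n > 0" using n by (cases n) auto
  obtain q where q: "prime q" "q dvd l" "q dvd int n"
    using False n0 prime_factor_int[of "gcd l (int n)"] by (auto simp: coprime_iff_gcd_eq_1)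
  define p where "p = nat q"
  have p: "prime p" "int p dvd l" "p dvd n" "int p = q"
    using q prime_ge_0_int[OF q(1)] by (auto simp: p_def nat_dvd_iff)
  obtain m where m: "n = p * m" "m > 0" "\<not> p dvd m"
    using squarefree_prime_split[OF n(2) n0 p(1,3)] by blast
  obtain l' where l': "l = int p * l'" using p(2) by (elim dvdE)
  have pp: "prime (int p)" "int p > 2" using odd_prime_factor[of n p] n p n0 by (auto simp: prime_factors_dvd)
  have E': "eexp n (of_int (j * l)) = eexp m (of_int (j * l'))" for j
    using pp by (simp add: eexp_def m l' mult.assoc)
  have "(\<Sum>j\<in>{0..<int n}. complex_of_int (Jacobi j n) * eexp n (of_int (j * l))) =
     (\<Sum>j\<in>{0..<int p * int m}. of_int (Legendre j p) * (of_int (Jacobi j m) * eexp m (of_int (j * l'))))"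
  proof -
    have J: "Jacobi j n = Legendre j p * Jacobi j m" for j
      unfolding m(1) by (rule Jacobi_prime_times[OF p(1) m(2,3)])
    have "int n = int p * int m" by (simp add: m(1))
    thus ?thesis unfolding E' J by (simp add: mult_ac)
  qed
  also have "\<dots> = (\<Sum>j\<in>{0..<int p}. of_int (Legendre j p)) * (\<Sum>j\<in>{0..<int m}. of_int (Jacobi j m) * eexp m (of_int (j * l')))"
  proof (rule sum_residues_mult)
    show "coprime (int p) (int m)" using prime_imp_coprime[OF p(1) m(3)] by (simp only: coprime_int_iff)
    show "of_int (Jacobi (x mod int m) m) * eexp m (real_of_int (x mod int m * l')) = of_int (Jacobi x m) * eexp m (real_of_int (x * l'))" for x
      using eexp_cong[OF m(2) cong_mult[OF _ cong_refl], of "x mod int m" x l'] by (simp add: Jacobi_mod)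
  qed (use pp m in \<open>auto simp: Legendre_mod\<close>)
  also have "(\<Sum>j\<in>{0..<int p}. complex_of_int (Legendre j p)) = 0"
    using sum_Legendre[OF pp] unfolding of_int_sum[symmetric] by simp
  finally show ?thesis using False Jacobi_eq_0_iff[OF n0, of l] by simp
qed

text \<open>Parseval for the symbol: all its Fourier coefficients are Gauss sums times symbol
  values, so both sides carry the same positive factor, the sum \<open>\<phi>\<close> of the squared
  symbol over a period.\<close>

lemma norm_gauss_sum:
  assumes n: "odd n" "squarefree n"
  shows "(cmod (gauss_sum n))\<^sup>2 = n"
proof -
  have n0: "n > 0" using n by (cases n) auto
  let ?N = "{0..<int n}"
  define \<phi> where "\<phi> = (\<Sum>j\<in>?N. real_of_int ((Jacobi j n)\<^sup>2))"
  have norm: "(cmod (of_int (Jacobi j n)))\<^sup>2 = real_of_int ((Jacobi j n)\<^sup>2)" for j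
    by simp
  have "(\<Sum>k\<in>?N. (cmod (\<Sum>j\<in>?N. of_int (Jacobi j n) * eexp n (of_int (j * k))))\<^sup>2) = n * \<phi>"
    unfolding \<phi>_def norm[symmetric] using n0 by (intro parseval_residues) (auto simp: cong_def)
  also have "(\<Sum>k\<in>?N. (cmod (\<Sum>j\<in>?N. of_int (Jacobi j n) * eexp n (of_int (j * k))))\<^sup>2) = \<phi> * (cmod (gauss_sum n))\<^sup>2"
    unfolding gauss_sum_twist[OF n] norm_mult power_mult_distrib norm \<phi>_def sum_distrib_right ..
  finally have "\<phi> * (cmod (gauss_sum n))\<^sup>2 = \<phi> * n" by simp
  moreover have "\<phi> > 0"
  proof -
    have "real_of_int ((Jacobi 1 n)\<^sup>2) = 1" using Jacobi_squared[OF n0, of 1] by simp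
    moreover have "real_of_int ((Jacobi 1 n)\<^sup>2) \<le> \<phi>" if "n > 1"
      unfolding \<phi>_def using that by (intro member_le_sum) auto
    moreover have "\<phi> = real_of_int ((Jacobi 1 n)\<^sup>2)" if "n = 1"
      using that by (simp add: \<phi>_def Jacobi_def)
    ultimately show ?thesis using n0 by (cases "n = 1") auto
  qed
  ultimately show ?thesis by simp
qed

text \<open>The Dirichlet kernel at half-odd integers, a geometric sum with ratio w where w^n = -1;
  its closed form is 2 / (1 - w).\<close>

definition half_kernel :: "nat \<Rightarrow> int \<Rightarrow> complex" where
  "half_kernel n m = (\<Sum>j\<in>{0..<int n}. eexp n (of_int j * (of_int m + 1/2)))"

text \<open>The coefficient with which a value at an n-th root of unity enters the value at an
  intermediate point, including the phase caused by the rotation by \<open>R\<close>. Its modulus is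
  independent of \<open>R\<close>.\<close>

definition weight :: "nat \<Rightarrow> int \<Rightarrow> int \<Rightarrow> complex" where
  "weight n R m = eexp n (of_int (m * R)) * half_kernel n m / of_nat n"

lemma half_kernel_mod: "n > 0 \<Longrightarrow> half_kernel n (m mod int n) = half_kernel n m"
  unfolding half_kernel_def
proof (intro sum.cong refl)
  fix j assume n: "n > 0"
  have *: "eexp n (of_int j * (of_int x + 1/2)) = eexp n (of_int (j * x)) * eexp n (of_int j / 2)" for x
    by (simp add: distrib_left eexp_add)
  have "eexp n (of_int (j * (m mod int n))) = eexp n (of_int (j * m))"
    using n by (intro eexp_cong cong_mult) auto
  thus "eexp n (of_int j * (of_int (m mod int n) + 1/2)) = eexp n (of_int j * (of_int m + 1/2))" unfolding * by simp
qed

lemma weight_mod: "n > 0 \<Longrightarrow> weight n R (m mod int n) = weight n R m"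
  unfolding weight_def using eexp_cong[OF _ cong_mult[OF _ cong_refl], of n "m mod int n" m R]
  by (simp add: half_kernel_mod)

text \<open>Shifting the summation index by \<open>R\<close> only produces a phase, and what is left
  is a twisted Gauss sum.\<close>

lemma norm_charpoly_even:
  assumes n: "odd n" "squarefree n" and J: "J = (\<lambda>x. \<Sum>j\<in>{0..<int n}. of_int (Jacobi (j + R) n) * eexp n (of_int j * x))"
  shows "cmod (J (of_int l)) = sqrt n * \<bar>of_int (Jacobi l n)\<bar>"
proof -
  have n0: "n > 0" using n by (cases n) auto
  have "J (of_int l) = (\<Sum>j\<in>{0..<int n}. of_int (Jacobi (j + R) n) * eexp n (of_int (((j + R) - R) * l)))"
    by (simp add: J)
  also have "\<dots> = (\<Sum>j\<in>{0..<int n}. of_int (Jacobi j n) * eexp n (of_int ((j - R) * l)))"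
  proof (rule sum_shift_residues[where f = "\<lambda>j. of_int (Jacobi j n) * eexp n (of_int ((j - R) * l))"])
    show "of_int (Jacobi (x mod int n) n) * eexp n (real_of_int ((x mod int n - R) * l)) = of_int (Jacobi x n) * eexp n (real_of_int ((x - R) * l))" for x
      using eexp_cong[OF n0 cong_mult[OF cong_diff[OF _ cong_refl] cong_refl], of "x mod int n" x R l] by (simp add: Jacobi_mod)
  qed (use n0 in simp)
  also have "\<dots> = cnj (eexp n (of_int (R * l))) * (of_int (Jacobi l n) * gauss_sum n)"
    unfolding gauss_sum_twist[OF n, symmetric] sum_distrib_left
    by (intro sum.cong refl) (simp add: left_diff_distrib eexp_diff)
  finally have "cmod (J (of_int l)) = \<bar>of_int (Jacobi l n)\<bar> * cmod (gauss_sum n)" by (simp add: norm_mult)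
  also have "cmod (gauss_sum n) = sqrt n" using norm_gauss_sum[OF n] by (metis norm_ge_zero real_sqrt_unique)
  finally show ?thesis by simp
qed

text \<open>Multiply by the Gauss sum and use the twist identity backwards to write each symbol as a
  sum over q. The sum over j is then a half-integer kernel at q + l; with m = q + l the result is a
  convolution, up to the unimodular factor with exponent -l R. Dividing n by the modulus of the
  Gauss sum leaves sqrt n.\<close>

lemma norm_charpoly_odd:
  assumes n: "odd n" "squarefree n" and J: "J = (\<lambda>x. \<Sum>j\<in>{0..<int n}. of_int (Jacobi (j + R) n) * eexp n (of_int j * x))"
  shows "cmod (J (of_int l + 1 / 2)) = sqrt n * cmod (\<Sum>m\<in>{0..<int n}. of_int (Jacobi (m - l) n) * weight n R m)"
proof -
  have n0: "n > 0" using n by (cases n) auto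
  let ?N = "{0..<int n}"
  have Ejq: "eexp n (of_int (q * (j + R))) * eexp n (of_int j * (of_int l + 1 / 2)) = eexp n (of_int (q * R)) * eexp n (of_int j * (of_int (q + l) + 1 / 2))" for j q
    unfolding eexp_add[symmetric] by (rule arg_cong[of _ _ "eexp n"]) (simp add: algebra_simps)
  have "gauss_sum n * J (of_int l + 1/2) = (\<Sum>j\<in>?N. (of_int (Jacobi (j + R) n) * gauss_sum n) * eexp n (of_int j * (of_int l + 1/2)))"
    by (simp add: J sum_distrib_left mult_ac)
  also have "\<dots> = (\<Sum>j\<in>?N. \<Sum>q\<in>?N. of_int (Jacobi q n) * (eexp n (of_int (q * (j + R))) * eexp n (of_int j * (of_int l + 1/2))))"
    unfolding gauss_sum_twist[OF n, symmetric] sum_distrib_right by (simp add: mult_ac)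
  also have "\<dots> = (\<Sum>q\<in>?N. \<Sum>j\<in>?N. of_int (Jacobi q n) * (eexp n (of_int (q * (j + R))) * eexp n (of_int j * (of_int l + 1/2))))"
    by (rule sum.swap)
  also have "\<dots> = (\<Sum>q\<in>?N. of_int (Jacobi q n) * eexp n (of_int (q * R)) * half_kernel n (q + l))"
    unfolding Ejq half_kernel_def sum_distrib_left by (simp add: mult_ac)
  also have "\<dots> = (\<Sum>q\<in>?N. of_int (Jacobi (q + l - l) n) * eexp n (of_int ((q + l - l) * R)) * half_kernel n (q + l))"
    by simp
  also have "\<dots> = (\<Sum>m\<in>?N. of_int (Jacobi (m - l) n) * eexp n (of_int ((m - l) * R)) * half_kernel n m)"
  proof (rule sum_shift_residues[where f = "\<lambda>m. of_int (Jacobi (m - l) n) * eexp n (of_int ((m - l) * R)) * half_kernel n m"])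
    fix x
    have c: "[x mod int n - l = x - l] (mod int n)" by (intro cong_diff) auto
    show "of_int (Jacobi (x mod int n - l) n) * eexp n (real_of_int ((x mod int n - l) * R)) * half_kernel n (x mod int n) =
         of_int (Jacobi (x - l) n) * eexp n (real_of_int ((x - l) * R)) * half_kernel n x"
      using eexp_cong[OF n0 cong_mult[OF c cong_refl], of R] Jacobi_cong[OF c] half_kernel_mod[OF n0] by simp
  qed (use n0 in simp)
  also have "\<dots> = (cnj (eexp n (of_int (l * R))) * n) * (\<Sum>m\<in>?N. of_int (Jacobi (m - l) n) * weight n R m)"
    unfolding sum_distrib_left using n0
    by (intro sum.cong refl) (simp add: left_diff_distrib eexp_diff weight_def)
  finally have "cmod (gauss_sum n) * cmod (J (of_int l + 1/2)) = n * cmod (\<Sum>m\<in>?N. of_int (Jacobi (m - l) n) * weight n R m)"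
    unfolding norm_mult[symmetric] by (simp add: norm_mult)
  moreover have "cmod (gauss_sum n) = sqrt n" using norm_gauss_sum[OF n] by (metis norm_ge_zero real_sqrt_unique)
  moreover have "real n = sqrt n * sqrt n" by simp
  ultimately have "sqrt n * cmod (J (of_int l + 1/2)) = sqrt n * (sqrt n * cmod (\<Sum>m\<in>?N. of_int (Jacobi (m - l) n) * weight n R m))"
    by (simp add: mult.assoc[symmetric])
  thus ?thesis using n0 by simp
qed

text \<open>Even multiples of 1/2 give the n-th roots of unity, where the normalised fourth power is
  1 or 0, hence a count of units; odd multiples give the convolution.\<close>

lemma lnorm_4_charpoly:
  assumes n: "odd n" "squarefree n" "n > 1" and R: "R = \<lfloor>real n * r\<rfloor>"
  shows "lnorm 4 (rot n r (charpoly n)) ^ 4 / (real n)\<^sup>2 =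
    real (card {j \<in> {0..<int n}. coprime j (int n)}) / (2 * n) +
    (\<Sum>l\<in>{0..<int n}. cmod (\<Sum>m\<in>{0..<int n}. of_int (Jacobi (m - l) n) * weight n R m) ^ 4) / (2 * n)"
proof -
  let ?N = "{0..<int n}"
  let ?A = "rot n r (charpoly n)"
  define J where "J = (\<lambda>x. \<Sum>j\<in>?N. of_int (Jacobi (j + R) n) * eexp n (of_int j * x))"
  have n0: "n > 0" using n by simp
  have c: "Polynomial.coeff ?A i = (if i < n then of_int (Jacobi (int i + R) n) else 0)" for i
    using n0 by (subst coeff_rot) (auto simp: coeff_charpoly[OF n(3)] R[symmetric] Jacobi_mod nat_less_iff)
  have polyA: "poly ?A (eexp n x) = J x" for x
    unfolding J_def by (subst poly_eexp[of n]) (auto simp: c intro!: sum.cong)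
  have to_int: "(\<Sum>k<n. f (int k)) = (\<Sum>k\<in>?N. f k)" for f :: "int \<Rightarrow> real"
    by (rule sum.reindex_bij_witness[of _ nat int]) auto
  have "lnorm 4 ?A ^ 4 = (\<Sum>k<2*n. cmod (J (real k / 2)) ^ 4) / (2 * n)"
    by (subst lnorm_4_power4[OF n0]) (auto simp: c polyA)
  also have "(\<Sum>k<2*n. cmod (J (real k / 2)) ^ 4) =
      (\<Sum>k<n. cmod (J (of_int (int k))) ^ 4) + (\<Sum>k<n. cmod (J (of_int (int k) + 1/2)) ^ 4)"
    unfolding sum_even_odd by (simp add: add_divide_distrib add.commute)
  also have "\<dots> = (\<Sum>k\<in>?N. cmod (J (of_int k)) ^ 4) + (\<Sum>k\<in>?N. cmod (J (of_int k + 1/2)) ^ 4)"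
    using to_int[of "\<lambda>k. cmod (J (of_int k)) ^ 4"] to_int[of "\<lambda>k. cmod (J (of_int k + 1/2)) ^ 4"] by (simp only:)
  also have "(\<Sum>k\<in>?N. cmod (J (of_int k)) ^ 4) = (\<Sum>k\<in>?N. (real n)\<^sup>2 * of_bool (coprime k (int n)))"
  proof (intro sum.cong refl)
    fix k
    have "cmod (J (of_int k)) ^ 4 = sqrt n ^ 4 * real_of_int (((Jacobi k n)\<^sup>2)\<^sup>2)"
      unfolding norm_charpoly_even[OF n(1,2) J_def] power_mult_distrib by (simp add: power_even_abs)
    thus "cmod (J (of_int k)) ^ 4 = (real n)\<^sup>2 * of_bool (coprime k (int n))"
      unfolding Jacobi_squared[OF n0] by (simp add: sqrt_power4)
  qed
  also have "\<dots> = (real n)\<^sup>2 * real (card {j \<in> ?N. coprime j (int n)})"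
    by (simp only: sum_distrib_left[symmetric]) (simp add: sum_of_bool_eq Int_def)
  also have "(\<Sum>k\<in>?N. cmod (J (of_int k + 1/2)) ^ 4) = (real n)\<^sup>2 * (\<Sum>l\<in>?N. cmod (\<Sum>m\<in>?N. of_int (Jacobi (m - l) n) * weight n R m) ^ 4)"
    unfolding sum_distrib_left
    unfolding norm_charpoly_odd[OF n(1,2) J_def] power_mult_distrib by (simp add: sqrt_power4)
  finally show ?thesis using n0 by (simp add: field_simps)
qed

text \<open>After multiplication by the Gauss sum, the convolution is the Fourier transform of
  \<open>G\<close> conjugated and multiplied by the symbol, up to conjugation. The symbol has
  absolute value at most 1, so Parseval in both directions gives the bound.\<close>

lemma mean_square_convolution_le:
  assumes n: "odd n" "squarefree n" and I: "finite I" "\<And>i j. i \<in> I \<Longrightarrow> j \<in> I \<Longrightarrow> [i = j] (mod int n) \<Longrightarrow> i = j"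
  shows "(\<Sum>l\<in>{0..<int n}. (cmod (\<Sum>m\<in>I. of_int (Jacobi (m - l) n) * w m))\<^sup>2) \<le> n * (\<Sum>m\<in>I. (cmod (w m))\<^sup>2)"
proof -
  have n0: "n > 0" using n by (cases n) auto
  let ?N = "{0..<int n}"
  define G where "G = (\<lambda>j. \<Sum>m\<in>I. w m * eexp n (of_int (m * j)))"
  have "gauss_sum n * (\<Sum>m\<in>I. of_int (Jacobi (m - l) n) * w m) =
     (\<Sum>j\<in>?N. (of_int (Jacobi j n) * G j) * cnj (eexp n (of_int (j * l))))" for l
  proof -
    have "gauss_sum n * (\<Sum>m\<in>I. of_int (Jacobi (m - l) n) * w m) = (\<Sum>m\<in>I. (of_int (Jacobi (m - l) n) * gauss_sum n) * w m)"
      by (simp add: sum_distrib_left mult_ac)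
    also have "\<dots> = (\<Sum>m\<in>I. \<Sum>j\<in>?N. of_int (Jacobi j n) * (w m * eexp n (of_int (m * j))) * cnj (eexp n (of_int (j * l))))"
      unfolding gauss_sum_twist[OF n, symmetric] sum_distrib_right
      by (intro sum.cong refl) (simp add: right_diff_distrib eexp_diff mult_ac)
    also have "\<dots> = (\<Sum>j\<in>?N. \<Sum>m\<in>I. of_int (Jacobi j n) * (w m * eexp n (of_int (m * j))) * cnj (eexp n (of_int (j * l))))"
      by (rule sum.swap)
    finally show ?thesis by (simp add: G_def sum_distrib_left sum_distrib_right)
  qed
  hence "cmod (gauss_sum n) * cmod (\<Sum>m\<in>I. of_int (Jacobi (m - l) n) * w m) =
     cmod (\<Sum>j\<in>?N. (of_int (Jacobi j n) * cnj (G j)) * eexp n (of_int (j * l)))" for l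
    unfolding norm_mult[symmetric]
    by (metis (no_types, lifting) cnj_sum complex_cnj_cnj complex_cnj_mult complex_cnj_of_int complex_mod_cnj sum.cong)
  hence "n * (\<Sum>l\<in>?N. (cmod (\<Sum>m\<in>I. of_int (Jacobi (m - l) n) * w m))\<^sup>2) =
     (\<Sum>l\<in>?N. (cmod (\<Sum>j\<in>?N. (of_int (Jacobi j n) * cnj (G j)) * eexp n (of_int (j * l))))\<^sup>2)"
    unfolding sum_distrib_left norm_gauss_sum[OF n, symmetric] power_mult_distrib[symmetric] by simp
  also have "\<dots> = n * (\<Sum>j\<in>?N. (cmod (of_int (Jacobi j n) * cnj (G j)))\<^sup>2)"
    using n0 by (intro parseval_residues) (auto simp: cong_def)
  also have "\<dots> \<le> n * (\<Sum>j\<in>?N. (cmod (G j))\<^sup>2)"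
  proof (intro mult_left_mono sum_mono power_mono)
    fix j
    have "real_of_int \<bar>Jacobi j n\<bar> \<le> 1" using abs_Jacobi_le_1[of j n] by linarith
    thus "cmod (of_int (Jacobi j n) * cnj (G j)) \<le> cmod (G j)"
      by (simp add: norm_mult mult_left_le_one_le)
  qed auto
  also have "(\<Sum>j\<in>?N. (cmod (G j))\<^sup>2) = n * (\<Sum>m\<in>I. (cmod (w m))\<^sup>2)"
    unfolding G_def using n0 I by (intro parseval_residues) auto
  finally show ?thesis using n0 by simp
qed

section \<open>The interpolation weights\<close>

text \<open>From sin x >= x - x^3 / 6 and x^2 <= 4, as pi / 2 < 2: the factor is 1 - 4/6.\<close>

lemma third_le_sin:
  assumes "0 \<le> x" "x \<le> pi / 2"
  shows "x / 3 \<le> sin x"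
proof -
  have "\<bar>sin x - (\<Sum>m<3. sin_coeff m * x ^ m)\<bar> \<le> inverse (fact 3) * \<bar>x\<bar> ^ 3"
    by (rule Maclaurin_sin_bound)
  hence "\<bar>sin x - x\<bar> \<le> x ^ 3 / 6"
    using assms by (simp add: eval_nat_numeral sin_coeff_def fact_numeral field_simps)
  hence "x - x * x\<^sup>2 / 6 \<le> sin x" by (simp add: power2_eq_square power3_eq_cube abs_if split: if_splits)
  moreover have "x\<^sup>2 \<le> 2\<^sup>2" using assms pi_half_less_two by (intro power_mono) auto
  hence "x * x\<^sup>2 \<le> x * 4" using assms by (intro mult_left_mono) auto
  ultimately show ?thesis by linarith
qed

text \<open>Multiplied by (1 - w)^2 so that no division occurs. With w^N = -1 and suitable c the
  right side collapses, which identifies both the square and the squared modulus of the half-integer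
  kernel.\<close>

lemma linear_geometric_sum:
  fixes w c :: "'a :: comm_ring_1"
  shows "(1 - w)\<^sup>2 * (\<Sum>u<N. (c - 2 * of_nat u) * w ^ u) =
    c - (c + 2) * w - (c - 2 * of_nat N) * w ^ N + (c - 2 * of_nat N + 2) * w ^ (N + 1)"
  by (induction N) (simp_all add: algebra_simps power2_eq_square)

lemma sum_int_conv_nat:
  "(\<Sum>j\<in>{0..<int n}. f (nat j)) = (\<Sum>j<n. f j)"
  by (rule sum.reindex_bij_witness[of _ int nat]) auto

section \<open>Exact moments and decay of the weights\<close>

context
  fixes n :: nat
  assumes n: "n > 0"
begin

lemma eexp_half_power: "eexp n (of_int m + 1/2) ^ n = -1"
proof -
  have "2 * pi * (real n * (of_int m + 1/2)) / real n = 2 * pi * of_int m + pi"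
    using n by (simp add: field_simps)
  hence "eexp n (of_int m + 1/2) ^ n = cis (2 * pi * of_int m + pi)"
    unfolding eexp_power by (simp only: eexp_def)
  also have "\<dots> = cis (2 * pi * of_int m) * cis pi" by (simp only: cis_mult)
  also have "\<dots> = -1" using cis_multiple_2pi[of "of_int m"] by simp
  finally show ?thesis .
qed

lemma half_kernel_eq_power_sum: "half_kernel n m = (\<Sum>j<n. eexp n (of_int m + 1/2) ^ j)"
  unfolding half_kernel_def eexp_power
  by (rule sum.reindex_bij_witness[of _ int nat]) auto

lemma half_kernel_times: "(1 - eexp n (of_int m + 1/2)) * half_kernel n m = 2"
  unfolding half_kernel_eq_power_sum using one_diff_power_eq[of "eexp n (of_int m + 1/2)" n] eexp_half_power[of m]
  by simp

lemma half_kernel_denominator: "1 - eexp n (of_int m + 1/2) \<noteq> 0"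
  using half_kernel_times[of m] by auto

text \<open>The square has powers of w up to 2n - 2; folding them back with w^n = -1 gives exponents
  below n, as orthogonality over the sample points requires. The proof compares closed forms instead
  of collecting coefficients.\<close>

lemma half_kernel_square:
  "(half_kernel n m)\<^sup>2 = (\<Sum>u<n. (2 * of_nat u + 2 - of_nat n) * eexp n (of_int m + 1/2) ^ u)"
proof -
  define w where "w = eexp n (of_int m + 1/2)"
  have w: "w ^ n = -1" unfolding w_def by (rule eexp_half_power)
  have "(1 - w)\<^sup>2 * (\<Sum>u<n. ((of_nat n - 2) - 2 * of_nat u) * w ^ u) = -4"
    unfolding linear_geometric_sum by (simp add: w algebra_simps)
  hence "(1 - w)\<^sup>2 * - (\<Sum>u<n. ((of_nat n - 2) - 2 * of_nat u) * w ^ u) = 4" by simp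
  also have "- (\<Sum>u<n. ((of_nat n - 2) - 2 * of_nat u) * w ^ u) = (\<Sum>u<n. (2 * of_nat u + 2 - of_nat n) * w ^ u)"
    unfolding sum_negf[symmetric] by (intro sum.cong refl) (simp add: algebra_simps)
  also have "4 = (1 - w)\<^sup>2 * (half_kernel n m)\<^sup>2"
    unfolding power_mult_distrib[symmetric] w_def half_kernel_times by simp
  finally show ?thesis using half_kernel_denominator[of m] by (simp add: w_def)
qed

text \<open>The same folding for the squared modulus, where w^(-u) = -w^(n-u) removes the negative
  powers.\<close>

lemma norm_half_kernel_square:
  "complex_of_real ((cmod (half_kernel n m))\<^sup>2) = (\<Sum>u<n. (of_nat n - 2 * of_nat u) * eexp n (of_int m + 1/2) ^ u)"
proof -
  define w where "w = eexp n (of_int m + 1/2)"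
  define Z where "Z = half_kernel n m"
  have w: "w ^ n = -1" unfolding w_def by (rule eexp_half_power)
  have ww: "w * cnj w = 1" using complex_norm_square[of w] by (simp add: w_def)
  have Z: "(1 - w) * Z = 2" unfolding w_def Z_def by (rule half_kernel_times)
  \<comment> \<open>Because the conjugate of w is 1/w, multiplying the conjugated closed form by w
    expresses it through w alone.\<close>
  have "(1 - cnj w) * cnj Z = 2" using arg_cong[OF Z, of cnj] by simp
  hence "w * ((1 - cnj w) * cnj Z) = 2 * w" by simp
  hence Z': "(w - 1) * cnj Z = 2 * w" using ww by (simp add: algebra_simps)
  have "(1 - w)\<^sup>2 * (\<Sum>u<n. (of_nat n - 2 * of_nat u) * w ^ u) = - 4 * w"
    unfolding linear_geometric_sum by (simp add: w algebra_simps)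
  also have "\<dots> = - (((1 - w) * Z) * ((w - 1) * cnj Z))" unfolding Z Z' by simp
  also have "\<dots> = (1 - w)\<^sup>2 * (Z * cnj Z)" by (simp add: power2_eq_square algebra_simps)
  finally show ?thesis using half_kernel_denominator[of m] unfolding complex_norm_square Z_def[symmetric]
    by (simp add: w_def)
qed

lemma eexp_half_power_split: "eexp n (of_int m + 1/2) ^ u = eexp n (real u / 2) * eexp n (of_int (int u * m))"
  unfolding eexp_power eexp_add[symmetric] by (simp add: distrib_left add.commute)

lemma sum_nat_eexp_to_int:
  "(\<Sum>u<n. c u * eexp n (of_int m + 1/2) ^ u) = (\<Sum>u\<in>{0..<int n}. (c (nat u) * eexp n (real (nat u) / 2)) * eexp n (of_int (u * m)))"
  unfolding eexp_half_power_split by (rule sum.reindex_bij_witness[of _ nat int]) (auto simp: mult_ac)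

text \<open>Parseval at the shifted points: the half-integer shift multiplies each coefficient by a
  number of modulus 1.\<close>

lemma sum_norm_power_sum_half:
  "(\<Sum>m\<in>{0..<int n}. (cmod (\<Sum>u<n. c u * eexp n (of_int m + 1/2) ^ u))\<^sup>2) = n * (\<Sum>u<n. (cmod (c u))\<^sup>2)"
proof -
  have "(\<Sum>m\<in>{0..<int n}. (cmod (\<Sum>u<n. c u * eexp n (of_int m + 1/2) ^ u))\<^sup>2) =
    n * (\<Sum>u\<in>{0..<int n}. (cmod (c (nat u) * eexp n (real (nat u) / 2)))\<^sup>2)"
    unfolding sum_nat_eexp_to_int using n by (intro parseval_residues) (auto simp: cong_def)
  thus ?thesis using sum_int_conv_nat[of "\<lambda>u. (cmod (c u))\<^sup>2" n] by (simp add: norm_mult)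
qed

lemma norm_weight: "cmod (weight n R m) = cmod (half_kernel n m) / n"
  by (simp add: weight_def norm_mult norm_divide)

lemma sum_norm_weight_square: "(\<Sum>m\<in>{0..<int n}. (cmod (weight n R m))\<^sup>2) = 1"
proof -
  have "(\<Sum>m\<in>{0..<int n}. (cmod (half_kernel n m))\<^sup>2) = real n * real n"
    using sum_norm_power_sum_half[of "\<lambda>_. 1"] by (simp add: half_kernel_eq_power_sum)
  thus ?thesis using n unfolding norm_weight power_divide sum_divide_distrib[symmetric]
    by (simp add: power2_eq_square)
qed

text \<open>Parseval applied to the expansion of the squared modulus: the sum of (n - 2u)^2 over u <
  n is n (n^2 + 2) / 3. The value tends to 1/3.\<close>

lemma sum_norm_weight_power4: "(\<Sum>m\<in>{0..<int n}. cmod (weight n R m) ^ 4) = ((real n)\<^sup>2 + 2) / (3 * (real n)\<^sup>2)"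
proof -
  \<comment> \<open>Generalised to an arbitrary x and upper limit, because the induction needs x
    fixed while the limit varies.\<close>
  have sq: "(\<Sum>u<k. (x - 2 * real u)\<^sup>2) = real k * x\<^sup>2 - 2 * x * real k * (real k - 1) + 2 / 3 * (real k - 1) * real k * (2 * real k - 1)" for k x
    by (induction k) (simp_all add: power2_eq_square field_simps)
  have "cmod (half_kernel n m) ^ 4 = (cmod (\<Sum>u<n. (of_nat n - 2 * of_nat u) * eexp n (of_int m + 1/2) ^ u))\<^sup>2" for m
    unfolding norm_half_kernel_square[symmetric] norm_of_real by (simp add: power_mult[symmetric])
  hence "(\<Sum>m\<in>{0..<int n}. cmod (half_kernel n m) ^ 4) = n * (\<Sum>u<n. (cmod (of_nat n - 2 * of_nat u))\<^sup>2)"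
    using sum_norm_power_sum_half[of "\<lambda>u. of_nat n - 2 * of_nat u"] by simp
  also have "(\<Sum>u<n. (cmod (of_nat n - 2 * of_nat u))\<^sup>2) = (\<Sum>u<n. (real n - 2 * real u)\<^sup>2)"
  proof (intro sum.cong refl)
    fix u
    have "(of_nat n - 2 * of_nat u :: complex) = of_real (real n - 2 * real u)" by simp
    thus "(cmod (of_nat n - 2 * of_nat u))\<^sup>2 = (real n - 2 * real u)\<^sup>2" by (simp only: norm_of_real) simp
  qed
  also have "real n * \<dots> = (real n)\<^sup>2 * ((real n)\<^sup>2 + 2) / 3"
    unfolding sq by (simp add: power2_eq_square field_simps)
  finally show ?thesis using n unfolding norm_weight power_divide sum_divide_distrib[symmetric]
    by (simp add: field_simps eval_nat_numeral)
qed

text \<open>Squaring the weight doubles the rotation phase. Summation over m then selects the one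
  frequency u congruent to -2R, and its coefficient in \<open>half_kernel_square\<close> is 2u + 2 -
  n. This is how the limit comes to depend on r.\<close>

lemma norm_sum_weight_square:
  "cmod (\<Sum>m\<in>{0..<int n}. (weight n R m)\<^sup>2) = \<bar>2 * of_int ((- 2 * R) mod int n) + 2 - real n\<bar> / n"
proof -
  let ?N = "{0..<int n}"
  define s where "s = (- 2 * R) mod int n"
  define c where "c = (\<lambda>u. (2 * of_nat (nat u) + 2 - of_nat n) * eexp n (real (nat u) / 2))"
  have s: "s \<in> ?N" using n by (simp add: s_def)
  have "of_nat n ^ 2 * (\<Sum>m\<in>?N. (weight n R m)\<^sup>2) = (\<Sum>m\<in>?N. eexp n (of_int (m * (2 * R))) * (half_kernel n m)\<^sup>2)"
  proof -
    have "eexp n (of_int (m * (2 * R))) = (eexp n (of_int (m * R)))\<^sup>2" for m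
      unfolding eexp_power by (simp add: mult_ac)
    thus ?thesis using n by (simp add: sum_distrib_left weight_def power_mult_distrib power_divide)
  qed
  also have "\<dots> = (\<Sum>m\<in>?N. \<Sum>u\<in>?N. c u * eexp n (of_int (m * (u + 2 * R))))"
    unfolding half_kernel_square sum_nat_eexp_to_int sum_distrib_left c_def
    by (intro sum.cong refl) (simp add: distrib_left eexp_add mult_ac)
  also have "\<dots> = (\<Sum>u\<in>?N. \<Sum>m\<in>?N. c u * eexp n (of_int (m * (u + 2 * R))))" by (rule sum.swap)
  also have "\<dots> = (\<Sum>u\<in>?N. if u = s then c u * n else 0)"
  proof (intro sum.cong refl)
    fix u assume u: "u \<in> ?N"
    have "int n dvd u + 2 * R \<longleftrightarrow> [u = - 2 * R] (mod int n)" by (simp add: cong_iff_dvd_diff)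
    also have "\<dots> \<longleftrightarrow> u = s" using u by (simp add: cong_def s_def)
    finally show "(\<Sum>m\<in>?N. c u * eexp n (of_int (m * (u + 2 * R)))) = (if u = s then c u * n else 0)"
      by (simp only: sum_distrib_left[symmetric] sum_eexp[OF n]) auto
  qed
  also have "\<dots> = c s * n" using s by simp
  finally have "cmod (of_nat n ^ 2 * (\<Sum>m\<in>?N. (weight n R m)\<^sup>2)) = cmod (c s) * n" by (simp add: norm_mult)
  hence "(real n)\<^sup>2 * cmod (\<Sum>m\<in>?N. (weight n R m)\<^sup>2) = cmod (c s) * n" by (simp add: norm_mult norm_power)
  moreover have "cmod (c s) = \<bar>2 * of_int s + 2 - real n\<bar>"
  proof -
    have "(2 * of_nat (nat s) + 2 - of_nat n :: complex) = of_real (2 * of_int s + 2 - real n)" using s by simp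
    thus ?thesis unfolding c_def norm_mult norm_eexp by (simp only: norm_of_real mult_1_right)
  qed
  ultimately have "real n * (real n * cmod (\<Sum>m\<in>?N. (weight n R m)\<^sup>2)) = real n * \<bar>2 * of_int s + 2 - real n\<bar>"
    by (simp add: power2_eq_square mult_ac)
  hence "real n * cmod (\<Sum>m\<in>?N. (weight n R m)\<^sup>2) = \<bar>2 * of_int s + 2 - real n\<bar>" using n by simp
  thus ?thesis using n unfolding s_def[symmetric] by (simp add: eq_divide_eq mult.commute)
qed

text \<open>The distance from 1 to the point with angle t is 2 |sin(t/2)|, and reducing t/2 to
  \<open>x\<close> in [0, pi/2] makes it at least 2x/3; so the kernel is at most 3/x, and x >= |2m +
  1| / n because pi >= 2.\<close>

lemma norm_weight_le:
  assumes "\<bar>2 * m + 1\<bar> \<le> int n"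
  shows "cmod (weight n R m) \<le> 3 / of_int \<bar>2 * m + 1\<bar>"
proof -
  define x where "x = pi * of_int \<bar>2 * m + 1\<bar> / (2 * n)"
  have "\<bar>2 * m + 1\<bar> > 0" by presburger
  hence pos: "real_of_int \<bar>2 * m + 1\<bar> > 0" by linarith
  have x0: "0 \<le> x" by (simp add: x_def)
  have "real_of_int \<bar>2 * m + 1\<bar> \<le> n" using assms by linarith
  hence x1: "x \<le> pi / 2" using n by (simp add: x_def field_simps)
  define t where "t = 2 * pi * (of_int m + 1/2) / real n"
  have t2: "t / 2 = pi * of_int (2 * m + 1) / (2 * n)" using n by (simp add: t_def field_simps)
  have "\<bar>sin (t / 2)\<bar> = \<bar>sin x\<bar>"
  proof (cases "2 * m + 1 \<ge> 0")
    case True thus ?thesis unfolding t2 x_def by simp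
  next
    case False
    hence "x = - (t / 2)" using n unfolding t2 x_def by (simp add: field_simps)
    thus ?thesis by simp
  qed
  also have "\<dots> \<ge> x / 3" using third_le_sin[OF x0 x1] by linarith
  finally have "2 * x / 3 \<le> cmod (eexp n (of_int m + 1/2) - 1)"
    using dist_exp_i_1[of t] by (simp add: eexp_def t_def cis_conv_exp)
  also have "\<dots> = cmod (1 - eexp n (of_int m + 1/2))" by (rule norm_minus_commute)
  finally have l: "2 * x / 3 \<le> cmod (1 - eexp n (of_int m + 1/2))" .
  have "2 * x / 3 * cmod (half_kernel n m) \<le> cmod (1 - eexp n (of_int m + 1/2)) * cmod (half_kernel n m)"
    by (rule mult_right_mono[OF l]) simp
  also have "\<dots> = 2" unfolding norm_mult[symmetric] half_kernel_times by simp
  finally have 1: "x * cmod (half_kernel n m) \<le> 3" by simp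
  have "real_of_int \<bar>2 * m + 1\<bar> / n \<le> x"
    using pi_ge_two mult_right_mono[OF pi_ge_two, of "real_of_int \<bar>2 * m + 1\<bar>"] pos n by (simp add: x_def field_simps)
  hence "real_of_int \<bar>2 * m + 1\<bar> / n * cmod (half_kernel n m) \<le> x * cmod (half_kernel n m)"
    by (rule mult_right_mono) simp
  with 1 have "real_of_int \<bar>2 * m + 1\<bar> * cmod (weight n R m) \<le> 3" by (simp add: norm_weight)
  thus ?thesis using pos by (simp add: field_simps)
qed

end

section \<open>Sums of the weight bounds\<close>

lemma harm_le_ln: "n > 0 \<Longrightarrow> harm n \<le> 1 + ln (real n)"
  using decseqD[OF decseq_harm_diff_ln, of 0 "n - 1"] by (simp add: harm_def)

text \<open>The indices m >= 0 and m < 0 both run through odd denominators 2k + 1 >= k + 1, so each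
  half is at most three times a harmonic number.\<close>

lemma sum_odd_reciprocals_le:
  "(\<Sum>m\<in>{- int h..int h}. 3 / real_of_int \<bar>2 * m + 1\<bar>) \<le> 6 * (1 + ln (real h + 1))"
proof -
  have "(\<Sum>m\<in>{- int h..int h}. 3 / real_of_int \<bar>2 * m + 1\<bar>) =
      (\<Sum>m\<in>{0..int h}. 3 / real_of_int \<bar>2 * m + 1\<bar>) + (\<Sum>m\<in>{- int h..-1}. 3 / real_of_int \<bar>2 * m + 1\<bar>)"
    by (subst sum.union_disjoint[symmetric]) (auto intro!: sum.cong)
  also have "(\<Sum>m\<in>{0..int h}. 3 / real_of_int \<bar>2 * m + 1\<bar>) = (\<Sum>k<Suc h. 3 / (2 * real k + 1))"
    by (rule sum.reindex_bij_witness[of _ int nat]) auto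
  also have "(\<Sum>m\<in>{- int h..-1}. 3 / real_of_int \<bar>2 * m + 1\<bar>) = (\<Sum>k<h. 3 / (2 * real k + 1))"
    by (rule sum.reindex_bij_witness[of _ "\<lambda>k. - int k - 1" "\<lambda>m. nat (- m - 1)"]) (auto simp: abs_if)
  also have "(\<Sum>k<h. 3 / (2 * real k + 1)) \<le> (\<Sum>k<Suc h. 3 / (2 * real k + 1))" by simp
  also have "(\<Sum>k<Suc h. 3 / (2 * real k + 1)) \<le> (\<Sum>k<Suc h. 3 * inverse (real (Suc k)))"
    by (intro sum_mono) (simp add: field_simps)
  also have "\<dots> = 3 * harm (Suc h)"
  proof -
    have "(\<Sum>k<Suc h. inverse (real (Suc k))) = (\<Sum>k=1..Suc h. inverse (real k))"
      by (rule sum.reindex_bij_witness[of _ "\<lambda>k. k - 1" Suc]) auto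
    thus ?thesis unfolding harm_def sum_distrib_left[symmetric] by simp
  qed
  also have "harm (Suc h) \<le> 1 + ln (real (Suc h))" by (rule harm_le_ln) simp
  finally show ?thesis by (simp add: add.commute)
qed

lemma sum_telescope_reciprocal:
  assumes "M \<ge> 1"
  shows "(\<Sum>k\<in>{M+1..M+d}. 1 / (real k * (real k - 1))) \<le> 1 / real M - 1 / real (M + d)"
proof (induction d)
  case (Suc d)
  have "{M+1..M+Suc d} = insert (M + Suc d) {M+1..M+d}" by auto
  hence "(\<Sum>k\<in>{M+1..M+Suc d}. 1 / (real k * (real k - 1))) \<le> 1 / (real (M + Suc d) * (real (M + Suc d) - 1)) + (1 / real M - 1 / real (M + d))"
    using Suc by simp
  also have "1 / (real (M + Suc d) * (real (M + Suc d) - 1)) = 1 / real (M + d) - 1 / real (M + Suc d)"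
    using assms by (simp add: field_simps)
  finally show ?case by simp
qed simp

text \<open>As (2m + 1)^2 >= 4 |m| (|m| - 1) for either sign of m, each side of the tail is at most
  9/4 times a telescoping sum bounded by 1 / M; twice 9/4 is rounded up to 5.\<close>

lemma sum_tail_reciprocal_squares_le:
  assumes M: "M \<ge> 1"
  shows "(\<Sum>m\<in>{- int h..int h} - {- int M..int M}. (3 / real_of_int \<bar>2 * m + 1\<bar>)\<^sup>2) \<le> 5 / M"
proof -
  define f where "f = (\<lambda>k::nat. 1 / (real k * (real k - 1)))"
  have bound: "(3 / real_of_int \<bar>2 * m + 1\<bar>)\<^sup>2 \<le> 9 / 4 * f (nat \<bar>m\<bar>)" if "\<bar>m\<bar> > int M" for m
  proof -
    define k where "k = real_of_int \<bar>m\<bar>"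
    have k: "k \<ge> 2" using that M by (simp add: k_def)
    have "(2 * m + 1)\<^sup>2 \<ge> 4 * (\<bar>m\<bar> * (\<bar>m\<bar> - 1))"
      by (cases "m \<ge> 0") (auto simp: power2_eq_square algebra_simps)
    hence "real_of_int ((2 * m + 1)\<^sup>2) \<ge> real_of_int (4 * (\<bar>m\<bar> * (\<bar>m\<bar> - 1)))" by (simp only: of_int_le_iff)
    hence *: "(real_of_int \<bar>2 * m + 1\<bar>)\<^sup>2 \<ge> 4 * (k * (k - 1))" by (simp add: k_def)
    have "9 / (real_of_int \<bar>2 * m + 1\<bar>)\<^sup>2 \<le> 9 / (4 * (k * (k - 1)))"
    proof (rule divide_left_mono[OF *])
      have "0 < 4 * (k * (k - 1))" using k by simp
      thus "0 < (real_of_int \<bar>2 * m + 1\<bar>)\<^sup>2 * (4 * (k * (k - 1)))" using k * by (intro mult_pos_pos) linarith+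
    qed simp
    thus ?thesis by (simp add: f_def k_def power_divide)
  qed
  have tail: "(\<Sum>k\<in>{M+1..h}. f k) \<le> 1 / M"
  proof (cases "h \<ge> M")
    case True
    hence "(\<Sum>k\<in>{M+1..h}. f k) \<le> 1 / real M - 1 / real h"
      using sum_telescope_reciprocal[OF M, of "h - M"] by (simp add: f_def)
    thus ?thesis by (smt (verit) divide_nonneg_nonneg of_nat_0_le_iff)
  qed simp
  have "{- int h..int h} - {- int M..int M} = {int M + 1..int h} \<union> {- int h..- int M - 1}" by auto
  hence "(\<Sum>m\<in>{- int h..int h} - {- int M..int M}. (3 / real_of_int \<bar>2 * m + 1\<bar>)\<^sup>2)
    = (\<Sum>m\<in>{int M + 1..int h}. (3 / real_of_int \<bar>2 * m + 1\<bar>)\<^sup>2) + (\<Sum>m\<in>{- int h..- int M - 1}. (3 / real_of_int \<bar>2 * m + 1\<bar>)\<^sup>2)"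
    by (simp add: sum.union_disjoint)
  also have "\<dots> \<le> (\<Sum>m\<in>{int M + 1..int h}. 9 / 4 * f (nat \<bar>m\<bar>)) + (\<Sum>m\<in>{- int h..- int M - 1}. 9 / 4 * f (nat \<bar>m\<bar>))"
    by (intro add_mono sum_mono bound) auto
  also have "(\<Sum>m\<in>{int M + 1..int h}. 9 / 4 * f (nat \<bar>m\<bar>)) = (\<Sum>k\<in>{M+1..h}. 9 / 4 * f k)"
    by (rule sum.reindex_bij_witness[of _ int nat]) auto
  also have "(\<Sum>m\<in>{- int h..- int M - 1}. 9 / 4 * f (nat \<bar>m\<bar>)) = (\<Sum>k\<in>{M+1..h}. 9 / 4 * f k)"
    by (rule sum.reindex_bij_witness[of _ "\<lambda>k. - int k" "\<lambda>m. nat (- m)"]) auto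
  also have "(\<Sum>k\<in>{M+1..h}. 9 / 4 * f k) + (\<Sum>k\<in>{M+1..h}. 9 / 4 * f k) = 9 / 2 * (\<Sum>k\<in>{M+1..h}. f k)"
    unfolding sum_distrib_left[symmetric] by simp
  also have "\<dots> \<le> 9 / 2 * (1 / M)" by (intro mult_left_mono tail) simp
  also have "\<dots> \<le> 5 / M" using M by (simp add: field_simps)
  finally show ?thesis .
qed

section \<open>The truncated fourth moment\<close>

definition correlation :: "nat \<Rightarrow> int \<Rightarrow> int \<Rightarrow> int \<Rightarrow> int \<Rightarrow> real" where
  "correlation n a b c d = (\<Sum>l\<in>{0..<int n}. of_int (Jacobi (a - l) n) * of_int (Jacobi (b - l) n) *
     of_int (Jacobi (c - l) n) * of_int (Jacobi (d - l) n))"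

lemma abs_Jacobi_prod_le: "\<bar>of_int (Jacobi a n) * of_int (Jacobi b n) * of_int (Jacobi c n) * of_int (Jacobi d n)\<bar> \<le> (1::real)"
proof -
  have "\<bar>real_of_int (Jacobi x n)\<bar> \<le> 1" for x using abs_Jacobi_le_1[of x n] by linarith
  thus ?thesis unfolding abs_mult by (intro mult_le_one mult_nonneg_nonneg abs_ge_zero) auto
qed

text \<open>Chinese remaindering isolates the prime p: the quartic bound gives 4 p^(3/4), the
  cofactor m is bounded trivially, and m p^(3/4) = n p^(-1/4). Only d must be isolated modulo
  p.\<close>

lemma correlation_le_aux:
  assumes n: "odd n" "squarefree n" "prime p" "p dvd n"
    and nd: "\<not> int p dvd d - a" "\<not> int p dvd d - b" "\<not> int p dvd d - c"
  shows "\<bar>correlation n a b c d\<bar> \<le> 4 * real n * real p powr (- 1/4)"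
proof -
  have n0: "n > 0" using n by (cases n) auto
  obtain m where m: "n = p * m" "m > 0" "\<not> p dvd m"
    using squarefree_prime_split[OF n(2) n0 n(3,4)] by blast
  have pp: "prime (int p)" "int p > 2" using odd_prime_factor[of n p] n n0 by (auto simp: prime_factors_dvd)
  have J: "Jacobi x n = Legendre x p * Jacobi x m" for x
    unfolding m(1) by (rule Jacobi_prime_times[OF n(3) m(2,3)])
  define f where "f = (\<lambda>l. real_of_int (Legendre ((l - a) * (l - b) * (l - c) * (l - d)) p))"
  define g where "g = (\<lambda>l. real_of_int (Jacobi (a - l) m) * of_int (Jacobi (b - l) m) * of_int (Jacobi (c - l) m) * of_int (Jacobi (d - l) m))"
  have f: "f l = real_of_int (Legendre (a - l) p * Legendre (b - l) p * Legendre (c - l) p * Legendre (d - l) p)" for l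
  proof -
    have "(l - a) * (l - b) * (l - c) * (l - d) = (a - l) * (b - l) * (c - l) * (d - l)" by (simp add: algebra_simps)
    thus ?thesis unfolding f_def by (simp only: Legendre_mult[OF pp])
  qed
  have "correlation n a b c d = (\<Sum>l\<in>{0..<int p * int m}. f l * g l)"
    unfolding correlation_def J f g_def by (simp add: m(1) mult_ac)
  also have "\<dots> = (\<Sum>l\<in>{0..<int p}. f l) * (\<Sum>l\<in>{0..<int m}. g l)"
  proof (rule sum_residues_mult)
    show "coprime (int p) (int m)" using prime_imp_coprime[OF n(3) m(3)] by (simp only: coprime_int_iff)
    fix x
    have c: "[y - x mod int p = y - x] (mod int p)" for y by (intro cong_diff) auto
    show "f (x mod int p) = f x" unfolding f using Legendre_cong[OF c] by simp
    have c: "[y - x mod int m = y - x] (mod int m)" for y by (intro cong_diff) auto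
    show "g (x mod int m) = g x" unfolding g_def using Jacobi_cong[OF c] by simp
  qed (use pp m in auto)
  finally have "\<bar>correlation n a b c d\<bar> = \<bar>\<Sum>l\<in>{0..<int p}. f l\<bar> * \<bar>\<Sum>l\<in>{0..<int m}. g l\<bar>"
    by (simp add: abs_mult)
  also have "\<dots> \<le> (4 * real_of_int (int p) powr (3/4)) * (\<Sum>l\<in>{0..<int m}. 1)"
  proof (intro mult_mono)
    show "\<bar>\<Sum>l\<in>{0..<int p}. f l\<bar> \<le> 4 * real_of_int (int p) powr (3/4)"
      unfolding f_def by (rule quartic_character_sum_le[OF pp nd])
    show "\<bar>\<Sum>l\<in>{0..<int m}. g l\<bar> \<le> (\<Sum>l\<in>{0..<int m}. 1)"
      using abs_Jacobi_prod_le by (intro order.trans[OF sum_abs] sum_mono) (auto simp: g_def)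
  qed auto
  also have "\<dots> = 4 * real m * (real p powr 1 * real p powr (- 1/4))"
    unfolding powr_add[symmetric] by simp
  also have "\<dots> = 4 * real n * real p powr (- 1/4)" using pp by (simp add: m(1))
  finally show ?thesis .
qed

text \<open>The correlation is symmetric in its shifts, so the isolated one may be moved to the last
  place.\<close>

lemma correlation_le:
  assumes n: "odd n" "squarefree n" "prime p" "p dvd n"
    and np: "\<not> paired a b c d" and nd: "\<And>x y. x \<in> {a, b, c, d} \<Longrightarrow> y \<in> {a, b, c, d} \<Longrightarrow> x \<noteq> y \<Longrightarrow> \<not> int p dvd x - y"
  shows "\<bar>correlation n a b c d\<bar> \<le> 4 * real n * real p powr (- 1/4)"
  using np
proof (cases rule: not_paired_cases)
  case 1
  have "correlation n a b c d = correlation n b c d a" by (simp add: correlation_def mult_ac)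
  thus ?thesis using correlation_le_aux[OF n, of a b c d] nd[of a b] nd[of a c] nd[of a d] 1 by auto
next
  case 2
  have "correlation n a b c d = correlation n a c d b" by (simp add: correlation_def mult_ac)
  thus ?thesis using correlation_le_aux[OF n, of b a c d] nd[of b a] nd[of b c] nd[of b d] 2 by auto
next
  case 3
  have "correlation n a b c d = correlation n a b d c" by (simp add: correlation_def mult_ac)
  thus ?thesis using correlation_le_aux[OF n, of c a b d] nd[of c a] nd[of c b] nd[of c d] 3 by auto
next
  case 4
  thus ?thesis using correlation_le_aux[OF n, of d a b c] nd[of d a] nd[of d b] nd[of d c] by auto
qed

text \<open>The zeros of the symbol in one period. Their number measures both the deviation of
  paired correlations from n and, by \<open>card_gcd_neq_1\<close>, the number of nonzero
  coefficients of V.\<close>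

definition noncoprimes :: "nat \<Rightarrow> int set" where
  "noncoprimes n = {j \<in> {0..<int n}. \<not> coprime j (int n)}"

lemma card_noncoprimes_reflect:
  assumes "n > 0"
  shows "(\<Sum>l\<in>{0..<int n}. of_bool (\<not> coprime (a - l) (int n))) = real (card (noncoprimes n))"
proof -
  have "(\<Sum>l\<in>{0..<int n}. of_bool (\<not> coprime (a - l) (int n))) = (\<Sum>l\<in>{0..<int n}. of_bool (\<not> coprime l (int n)) :: real)"
    by (rule sum_reflect_residues[where f = "\<lambda>l. of_bool (\<not> coprime l (int n))"]) (use assms in \<open>auto simp: coprime_iff_gcd_eq_1 gcd_mod_left\<close>)
  also have "\<dots> = real (card (noncoprimes n))" by (simp add: noncoprimes_def sum_of_bool_eq Int_def)
  finally show ?thesis .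
qed

text \<open>Each summand is a product of two squared symbols, hence 1 unless one of two shifts hits
  a zero of the symbol; the factor 2 is the union bound.\<close>

lemma correlation_paired:
  assumes n: "n > 0" and "paired a b c d"
  shows "\<bar>correlation n a b c d - n\<bar> \<le> 2 * real (card (noncoprimes n))"
proof -
  obtain x y where xy: "correlation n a b c d = (\<Sum>l\<in>{0..<int n}. of_int ((Jacobi (x - l) n)\<^sup>2 * (Jacobi (y - l) n)\<^sup>2))"
  proof -
    have "correlation n a b c d = (\<Sum>l\<in>{0..<int n}. of_int ((Jacobi (a - l) n)\<^sup>2 * (Jacobi (c - l) n)\<^sup>2))" if "a = b" "c = d"
      unfolding correlation_def that by (simp add: power2_eq_square mult_ac)
    moreover have "correlation n a b c d = (\<Sum>l\<in>{0..<int n}. of_int ((Jacobi (a - l) n)\<^sup>2 * (Jacobi (b - l) n)\<^sup>2))" if "a = c" "b = d"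
      unfolding correlation_def that by (simp add: power2_eq_square mult_ac)
    moreover have "correlation n a b c d = (\<Sum>l\<in>{0..<int n}. of_int ((Jacobi (a - l) n)\<^sup>2 * (Jacobi (b - l) n)\<^sup>2))" if "a = d" "b = c"
      unfolding correlation_def that by (simp add: power2_eq_square mult_ac)
    ultimately show ?thesis using assms(2) that unfolding paired_def by blast
  qed
  have "correlation n a b c d - n = - (\<Sum>l\<in>{0..<int n}. 1 - of_int ((Jacobi (x - l) n)\<^sup>2 * (Jacobi (y - l) n)\<^sup>2))"
    unfolding xy sum_subtractf by simp
  hence "\<bar>correlation n a b c d - n\<bar> \<le> (\<Sum>l\<in>{0..<int n}. \<bar>1 - real_of_int ((Jacobi (x - l) n)\<^sup>2 * (Jacobi (y - l) n)\<^sup>2)\<bar>)"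
    by (simp only: abs_minus_cancel sum_abs)
  also have "\<dots> \<le> (\<Sum>l\<in>{0..<int n}. of_bool (\<not> coprime (x - l) (int n)) + of_bool (\<not> coprime (y - l) (int n)))"
    unfolding Jacobi_squared[OF n] by (intro sum_mono) auto
  also have "\<dots> = 2 * real (card (noncoprimes n))"
    unfolding sum.distrib card_noncoprimes_reflect[OF n] by simp
  finally show ?thesis .
qed

lemma norm_power4_complex: "complex_of_real (cmod z ^ 4) = z * z * cnj z * cnj z"
proof -
  have "complex_of_real (cmod z ^ 4) = (complex_of_real ((cmod z)\<^sup>2))\<^sup>2" by (simp add: power_mult[symmetric])
  also have "\<dots> = z * z * cnj z * cnj z" unfolding complex_norm_square by (simp add: power2_eq_square mult_ac)
  finally show ?thesis .
qed

text \<open>The conjugates sit on c and d. Therefore the pairing a = b, c = d gives the squared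
  modulus of the sum of w^2, whereas the two mixed pairings give the square of the sum of
  |w|^2.\<close>

lemma sum_paired_complex:
  fixes w :: "'a \<Rightarrow> complex"
  assumes "finite A"
  shows "(\<Sum>a\<in>A. \<Sum>b\<in>A. \<Sum>c\<in>A. \<Sum>d\<in>A. of_bool (paired a b c d) * (w a * w b * cnj (w c) * cnj (w d))) =
    of_real (2 * (\<Sum>a\<in>A. (cmod (w a))\<^sup>2)\<^sup>2 + (cmod (\<Sum>a\<in>A. (w a)\<^sup>2))\<^sup>2 - 2 * (\<Sum>a\<in>A. cmod (w a) ^ 4))"
proof -
  have 1: "(\<Sum>a\<in>A. \<Sum>c\<in>A. w a * w a * cnj (w c) * cnj (w c)) = of_real ((cmod (\<Sum>a\<in>A. (w a)\<^sup>2))\<^sup>2)"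
    unfolding norm_square_sum by (simp add: power2_eq_square mult_ac)
  have sq: "of_real ((\<Sum>a\<in>A. (cmod (w a))\<^sup>2)\<^sup>2) = (\<Sum>a\<in>A. \<Sum>b\<in>A. (w a * cnj (w a)) * (w b * cnj (w b)))"
    unfolding of_real_power of_real_sum complex_norm_square[symmetric, unfolded of_real_power[symmetric]]
    by (simp only: power2_eq_square[of "sum _ _"] sum_product complex_norm_square flip: of_real_power)
  have 2: "(\<Sum>a\<in>A. \<Sum>b\<in>A. w a * w b * cnj (w a) * cnj (w b)) = of_real ((\<Sum>a\<in>A. (cmod (w a))\<^sup>2)\<^sup>2)"
    unfolding sq by (simp add: mult_ac)
  have 3: "(\<Sum>a\<in>A. \<Sum>b\<in>A. w a * w b * cnj (w b) * cnj (w a)) = of_real ((\<Sum>a\<in>A. (cmod (w a))\<^sup>2)\<^sup>2)"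
    unfolding sq by (simp add: mult_ac)
  have 4: "(\<Sum>a\<in>A. w a * w a * cnj (w a) * cnj (w a)) = of_real (\<Sum>a\<in>A. cmod (w a) ^ 4)"
    unfolding of_real_sum norm_power4_complex ..
  show ?thesis unfolding sum_paired[OF assms] 1 2 3 4 by simp
qed

lemma fourth_moment_expansion:
  "complex_of_real (\<Sum>l\<in>{0..<int n}. cmod (\<Sum>m\<in>I. of_int (Jacobi (m - l) n) * w m) ^ 4) =
    (\<Sum>a\<in>I. \<Sum>b\<in>I. \<Sum>c\<in>I. \<Sum>d\<in>I. of_real (correlation n a b c d) * (w a * w b * cnj (w c) * cnj (w d)))"
proof -
  let ?N = "{0..<int n}"
  have "complex_of_real (\<Sum>l\<in>?N. cmod (\<Sum>m\<in>I. of_int (Jacobi (m - l) n) * w m) ^ 4) =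
    (\<Sum>l\<in>?N. \<Sum>a\<in>I. \<Sum>b\<in>I. \<Sum>c\<in>I. \<Sum>d\<in>I. (of_int (Jacobi (a - l) n) * w a) * (of_int (Jacobi (b - l) n) * w b) *
      (of_int (Jacobi (c - l) n) * cnj (w c)) * (of_int (Jacobi (d - l) n) * cnj (w d)))"
    unfolding of_real_sum norm_power4_complex cnj_sum complex_cnj_mult complex_cnj_of_int sum_product4 ..
  also have "\<dots> = (\<Sum>a\<in>I. \<Sum>b\<in>I. \<Sum>c\<in>I. \<Sum>d\<in>I. \<Sum>l\<in>?N. (of_int (Jacobi (a - l) n) * w a) * (of_int (Jacobi (b - l) n) * w b) *
      (of_int (Jacobi (c - l) n) * cnj (w c)) * (of_int (Jacobi (d - l) n) * cnj (w d)))"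
    by (simp only: sum.swap[of _ _ ?N])
  also have "\<dots> = (\<Sum>a\<in>I. \<Sum>b\<in>I. \<Sum>c\<in>I. \<Sum>d\<in>I. of_real (correlation n a b c d) * (w a * w b * cnj (w c) * cnj (w d)))"
    unfolding correlation_def of_real_sum sum_distrib_right by (intro sum.cong refl) (simp add: mult_ac)
  finally show ?thesis .
qed

text \<open>Differences of retained indices are at most 2M < p, so distinct indices stay incongruent
  modulo p and the correlation bound applies to every unpaired quadruple. The constant 6 is 2 from
  \<open>correlation_paired\<close> times 3 from \<open>sum_paired_le\<close>; the unpaired error is
  charged to all quadruples, which gives a fourth power.\<close>

lemma truncated_fourth_moment:
  fixes n p M :: nat and w :: "int \<Rightarrow> complex"
  assumes n: "odd n" "squarefree n" "prime p" "p dvd n" and M: "2 * M < p"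
  defines "I \<equiv> {- int M..int M}"
  shows "\<bar>(\<Sum>l\<in>{0..<int n}. cmod (\<Sum>m\<in>I. of_int (Jacobi (m - l) n) * w m) ^ 4) -
      n * (2 * (\<Sum>a\<in>I. (cmod (w a))\<^sup>2)\<^sup>2 + (cmod (\<Sum>a\<in>I. (w a)\<^sup>2))\<^sup>2 - 2 * (\<Sum>a\<in>I. cmod (w a) ^ 4))\<bar>
    \<le> 6 * card (noncoprimes n) * (\<Sum>a\<in>I. (cmod (w a))\<^sup>2)\<^sup>2 + 4 * n * p powr (- 1/4) * (\<Sum>a\<in>I. cmod (w a)) ^ 4"
proof -
  have n0: "n > 0" using n by (cases n) auto
  have fin: "finite I" by (simp add: I_def)
  define W where "W = (\<lambda>a b c d. w a * w b * cnj (w c) * cnj (w d))"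
  define V where "V = (\<lambda>a b c d. cmod (w a) * cmod (w b) * cmod (w c) * cmod (w d))"
  define C where "C = 4 * n * p powr (- 1/4)"
  define \<delta> where "\<delta> = real (card (noncoprimes n))"
  have V0: "V a b c d \<ge> 0" for a b c d by (simp add: V_def)
  have C0: "C \<ge> 0" by (simp add: C_def)
  let ?L = "(\<Sum>l\<in>{0..<int n}. cmod (\<Sum>m\<in>I. of_int (Jacobi (m - l) n) * w m) ^ 4)"
  let ?P = "2 * (\<Sum>a\<in>I. (cmod (w a))\<^sup>2)\<^sup>2 + (cmod (\<Sum>a\<in>I. (w a)\<^sup>2))\<^sup>2 - 2 * (\<Sum>a\<in>I. cmod (w a) ^ 4)"
  have "complex_of_real (?L - n * ?P) = complex_of_real ?L - of_nat n * complex_of_real ?P"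
    by (simp only: of_real_diff of_real_mult of_real_of_nat_eq)
  also have "\<dots> = (\<Sum>a\<in>I. \<Sum>b\<in>I. \<Sum>c\<in>I. \<Sum>d\<in>I. of_real (correlation n a b c d) * W a b c d - of_nat n * (of_bool (paired a b c d) * W a b c d))"
    unfolding fourth_moment_expansion sum_paired_complex[OF fin, symmetric]
    by (simp only: W_def sum_distrib_left sum_subtractf)
  also have "\<dots> = (\<Sum>a\<in>I. \<Sum>b\<in>I. \<Sum>c\<in>I. \<Sum>d\<in>I. of_real (correlation n a b c d - n * of_bool (paired a b c d)) * W a b c d)"
    by (intro sum.cong refl) (simp add: algebra_simps)
  finally have eq: "complex_of_real (?L - n * ?P) = \<dots>" .
  have "\<bar>?L - n * ?P\<bar> = cmod (complex_of_real (?L - n * ?P))" by (simp only: norm_of_real)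
  also have "\<dots> \<le> (\<Sum>a\<in>I. \<Sum>b\<in>I. \<Sum>c\<in>I. \<Sum>d\<in>I. cmod (of_real (correlation n a b c d - n * of_bool (paired a b c d)) * W a b c d))"
    unfolding eq by (intro sum_norm_le order.refl)
  also have "\<dots> \<le> (\<Sum>a\<in>I. \<Sum>b\<in>I. \<Sum>c\<in>I. \<Sum>d\<in>I. 2 * \<delta> * (of_bool (paired a b c d) * V a b c d) + C * V a b c d)"
  proof (intro sum_mono)
    fix a b c d assume I: "a \<in> I" "b \<in> I" "c \<in> I" "d \<in> I"
    have "\<bar>correlation n a b c d - n * of_bool (paired a b c d)\<bar> \<le> 2 * \<delta> * of_bool (paired a b c d) + C"
    proof (cases "paired a b c d")
      case True
      thus ?thesis using correlation_paired[OF n0 True] C0 by (simp add: \<delta>_def)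
    next
      case False
      have "\<not> int p dvd x - y" if "x \<in> {a, b, c, d}" "y \<in> {a, b, c, d}" "x \<noteq> y" for x y
      proof
        assume "int p dvd x - y"
        hence "int p \<le> \<bar>x - y\<bar>" using that(3) dvd_imp_le_int[of "x - y" "int p"] by simp
        moreover have "x \<in> I" "y \<in> I" using that I by auto
        ultimately show False using M by (auto simp: I_def)
      qed
      from correlation_le[OF n False this] show ?thesis using False by (simp add: C_def)
    qed
    hence "\<bar>correlation n a b c d - n * of_bool (paired a b c d)\<bar> * V a b c d \<le> (2 * \<delta> * of_bool (paired a b c d) + C) * V a b c d"
      by (rule mult_right_mono[OF _ V0])
    thus "cmod (of_real (correlation n a b c d - n * of_bool (paired a b c d)) * W a b c d) \<le> 2 * \<delta> * (of_bool (paired a b c d) * V a b c d) + C * V a b c d"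
      unfolding norm_mult norm_of_real by (simp add: W_def V_def norm_mult algebra_simps)
  qed
  also have "\<dots> = 2 * \<delta> * (\<Sum>a\<in>I. \<Sum>b\<in>I. \<Sum>c\<in>I. \<Sum>d\<in>I. of_bool (paired a b c d) * V a b c d) + C * (\<Sum>a\<in>I. \<Sum>b\<in>I. \<Sum>c\<in>I. \<Sum>d\<in>I. V a b c d)"
    by (simp only: sum.distrib sum_distrib_left)
  also have "(\<Sum>a\<in>I. \<Sum>b\<in>I. \<Sum>c\<in>I. \<Sum>d\<in>I. V a b c d) = (\<Sum>a\<in>I. cmod (w a)) ^ 4"
    unfolding V_def power4_eq_xxxx sum_product4 ..
  also have "2 * \<delta> * (\<Sum>a\<in>I. \<Sum>b\<in>I. \<Sum>c\<in>I. \<Sum>d\<in>I. of_bool (paired a b c d) * V a b c d) \<le> 2 * \<delta> * (3 * (\<Sum>a\<in>I. (cmod (w a))\<^sup>2)\<^sup>2)"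
    unfolding V_def by (intro mult_left_mono sum_paired_le fin) (simp add: \<delta>_def)
  finally show ?thesis by (simp add: \<delta>_def C_def)
qed

section \<open>Random signs and perturbation\<close>

text \<open>A choice of signs is encoded by the set of indices with sign +1, so that averaging over
  random signs is summation over a power set.\<close>

definition pm_sign :: "'a set \<Rightarrow> 'a \<Rightarrow> complex" where
  "pm_sign T j = (if j \<in> T then 1 else -1)"

text \<open>The two squared moduli are x + y and x - y with y twice the inner product of s and c. In
  the sum of their squares the cross terms cancel, and Cauchy-Schwarz bounds y^2.\<close>

lemma norm_power4_plus_minus:
  assumes "cmod c = 1"
  shows "cmod (s + c) ^ 4 + cmod (s - c) ^ 4 \<le> 2 * cmod s ^ 4 + 12 * (cmod s)\<^sup>2 + 2"
    and "(cmod (s + c))\<^sup>2 + (cmod (s - c))\<^sup>2 = 2 * (cmod s)\<^sup>2 + 2"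
proof -
  define x where "x = (cmod s)\<^sup>2 + 1"
  define y where "y = 2 * (s \<bullet> c)"
  have 1: "(cmod (s + c))\<^sup>2 = x + y" "(cmod (s - c))\<^sup>2 = x - y"
    using assms unfolding x_def y_def by (simp_all add: power2_norm_eq_inner inner_add inner_diff inner_commute norm_eq_1)
  have "\<bar>s \<bullet> c\<bar> \<le> cmod s" using Cauchy_Schwarz_ineq2[of s c] assms by simp
  hence "(s \<bullet> c)\<^sup>2 \<le> (cmod s)\<^sup>2" using abs_le_square_iff[of "s \<bullet> c" "cmod s"] by simp
  hence y: "y\<^sup>2 \<le> 4 * (cmod s)\<^sup>2" by (simp add: y_def power_mult_distrib)
  have p4: "z ^ 4 = (z\<^sup>2)\<^sup>2" for z :: real by simp
  have "cmod (s + c) ^ 4 + cmod (s - c) ^ 4 = 2 * x\<^sup>2 + 2 * y\<^sup>2"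
    unfolding p4 1 by (simp add: power2_eq_square algebra_simps)
  also have "\<dots> \<le> 2 * x\<^sup>2 + 8 * (cmod s)\<^sup>2" using y by simp
  also have "\<dots> = 2 * cmod s ^ 4 + 12 * (cmod s)\<^sup>2 + 2"
    unfolding p4 x_def by (simp add: power2_eq_square algebra_simps)
  finally show "cmod (s + c) ^ 4 + cmod (s - c) ^ 4 \<le> 2 * cmod s ^ 4 + 12 * (cmod s)\<^sup>2 + 2" .
  show "(cmod (s + c))\<^sup>2 + (cmod (s - c))\<^sup>2 = 2 * (cmod s)\<^sup>2 + 2" unfolding 1 by (simp add: x_def)
qed

text \<open>Induction on the number k of signs, pairing the two values of the new sign. The second
  moment is carried along because the fourth moment recursion uses it; the step is 3k^2 + 6k + 1 <=
  3 (k + 1)^2.\<close>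

lemma sum_signs_moments:
  assumes "finite U" and "\<And>j. j \<in> U \<Longrightarrow> cmod (c j) = 1"
  shows "(\<Sum>T\<in>Pow U. (cmod (\<Sum>j\<in>U. pm_sign T j * c j))\<^sup>2) = 2 ^ card U * card U \<and>
    (\<Sum>T\<in>Pow U. cmod (\<Sum>j\<in>U. pm_sign T j * c j) ^ 4) \<le> 2 ^ card U * (3 * (real (card U))\<^sup>2)"
  using assms
proof (induction U rule: finite_induct)
  case (insert a U)
  define s where "s = (\<lambda>T. \<Sum>j\<in>U. pm_sign T j * c j)"
  define k where "k = real (card U)"
  have IH: "(\<Sum>T\<in>Pow U. (cmod (s T))\<^sup>2) = 2 ^ card U * k" "(\<Sum>T\<in>Pow U. cmod (s T) ^ 4) \<le> 2 ^ card U * (3 * k\<^sup>2)"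
    using insert by (auto simp: s_def k_def)
  have c: "cmod (c a) = 1" using insert by simp
  have split: "(\<Sum>T\<in>Pow (insert a U). f (\<Sum>j\<in>insert a U. pm_sign T j * c j)) = (\<Sum>T\<in>Pow U. f (s T + c a) + f (s T - c a))"
    for f :: "complex \<Rightarrow> real"
  proof -
    have inj: "inj_on (insert a) (Pow U)" using insert(2) by (auto simp: inj_on_def)
    have s1: "(\<Sum>j\<in>insert a U. pm_sign T j * c j) = s T - c a" if "T \<in> Pow U" for T
      using insert(1,2) that by (auto simp: s_def pm_sign_def)
    have "(\<Sum>j\<in>U. pm_sign (insert a T) j * c j) = s T" for T
      unfolding s_def by (intro sum.cong refl) (use insert(2) in \<open>auto simp: pm_sign_def\<close>)
    hence s2: "(\<Sum>j\<in>insert a U. pm_sign (insert a T) j * c j) = s T + c a" for T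
      using insert(1,2) by (simp add: pm_sign_def add.commute)
    have "(\<Sum>T\<in>Pow (insert a U). f (\<Sum>j\<in>insert a U. pm_sign T j * c j)) =
       (\<Sum>T\<in>Pow U. f (\<Sum>j\<in>insert a U. pm_sign T j * c j)) + (\<Sum>T\<in>insert a ` Pow U. f (\<Sum>j\<in>insert a U. pm_sign T j * c j))"
      unfolding Pow_insert using insert(1,2) by (intro sum.union_disjoint) auto
    also have "(\<Sum>T\<in>insert a ` Pow U. f (\<Sum>j\<in>insert a U. pm_sign T j * c j)) = (\<Sum>T\<in>Pow U. f (s T + c a))"
      unfolding sum.reindex[OF inj] o_def s2 ..
    also have "(\<Sum>T\<in>Pow U. f (\<Sum>j\<in>insert a U. pm_sign T j * c j)) = (\<Sum>T\<in>Pow U. f (s T - c a))"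
      by (intro sum.cong refl) (simp only: s1)
    finally show ?thesis by (simp add: sum.distrib add.commute)
  qed
  have cP: "real (card (Pow U)) = 2 ^ card U" using insert(1) by (simp add: card_Pow)
  have "(\<Sum>T\<in>Pow (insert a U). (cmod (\<Sum>j\<in>insert a U. pm_sign T j * c j))\<^sup>2) = (\<Sum>T\<in>Pow U. 2 * (cmod (s T))\<^sup>2 + 2)"
    unfolding split[of "\<lambda>z. (cmod z)\<^sup>2"] norm_power4_plus_minus(2)[OF c] ..
  also have "\<dots> = 2 * (2 ^ card U * k) + 2 * 2 ^ card U"
    using cP by (simp add: sum.distrib sum_distrib_left[symmetric] IH)
  finally have A: "(\<Sum>T\<in>Pow (insert a U). (cmod (\<Sum>j\<in>insert a U. pm_sign T j * c j))\<^sup>2) = 2 ^ card (insert a U) * card (insert a U)"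
    using insert(1,2) by (simp add: k_def algebra_simps)
  have "(\<Sum>T\<in>Pow (insert a U). cmod (\<Sum>j\<in>insert a U. pm_sign T j * c j) ^ 4) \<le> (\<Sum>T\<in>Pow U. 2 * cmod (s T) ^ 4 + 12 * (cmod (s T))\<^sup>2 + 2)"
    unfolding split[of "\<lambda>z. cmod z ^ 4"] by (intro sum_mono norm_power4_plus_minus(1)[OF c])
  also have "\<dots> = 2 * (\<Sum>T\<in>Pow U. cmod (s T) ^ 4) + 12 * (2 ^ card U * k) + 2 * 2 ^ card U"
    using cP by (simp add: sum.distrib sum_distrib_left[symmetric] IH(1))
  also have "\<dots> \<le> 2 * (2 ^ card U * (3 * k\<^sup>2)) + 12 * (2 ^ card U * k) + 2 * 2 ^ card U"
    by (intro add_mono mult_left_mono IH(2) order.refl) simp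
  also have "\<dots> \<le> 2 * 2 ^ card U * (3 * (k + 1)\<^sup>2)" by (simp add: power2_eq_square algebra_simps)
  finally have B: "(\<Sum>T\<in>Pow (insert a U). cmod (\<Sum>j\<in>insert a U. pm_sign T j * c j) ^ 4) \<le> 2 ^ card (insert a U) * (3 * (real (card (insert a U)))\<^sup>2)"
    using insert(1,2) by (simp add: k_def add.commute)
  show ?case using A B by blast
qed simp

definition sign_poly :: "nat set \<Rightarrow> nat set \<Rightarrow> complex poly" where
  "sign_poly U T = (\<Sum>j\<in>U. Polynomial.monom (pm_sign T j) j)"

lemma coeff_sign_poly: "finite U \<Longrightarrow> Polynomial.coeff (sign_poly U T) j = (if j \<in> U then pm_sign T j else 0)"
  by (simp add: sign_poly_def coeff_sum)

lemma bij_betw_Vset: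
  assumes U: "U = {j. j < n \<and> gcd j n \<noteq> 1}"
  shows "bij_betw (sign_poly U) (Pow U) (Vset n)"
proof -
  have fin: "finite U" by (simp add: U)
  note co = coeff_sign_poly[OF fin]
  show ?thesis
  proof (rule bij_betw_byWitness[of _ "\<lambda>V. {j \<in> U. Polynomial.coeff V j = 1}"])
    show "\<forall>T\<in>Pow U. {j \<in> U. Polynomial.coeff (sign_poly U T) j = 1} = T"
      by (auto simp: co pm_sign_def split: if_splits)
    show "\<forall>V\<in>Vset n. sign_poly U {j \<in> U. Polynomial.coeff V j = 1} = V"
    proof (intro ballI poly_eqI)
      fix V j assume V: "V \<in> Vset n"
      show "Polynomial.coeff (sign_poly U {j \<in> U. Polynomial.coeff V j = 1}) j = Polynomial.coeff V j"
      proof (cases "j < n")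
        case True
        hence "Polynomial.coeff V j \<in> {0, -1, 1}" "Polynomial.coeff V j = 0 \<longleftrightarrow> gcd j n = 1" using V by (auto simp: Vset_def)
        moreover have "j \<in> U \<longleftrightarrow> gcd j n \<noteq> 1" using True by (simp add: U)
        ultimately show ?thesis by (auto simp: co pm_sign_def)
      next
        case False
        hence "j \<notin> U" "Polynomial.coeff V j = 0" using V by (auto simp: Vset_def U)
        thus ?thesis by (simp add: co)
      qed
    qed
    show "sign_poly U ` Pow U \<subseteq> Vset n"
    proof (rule image_subsetI)
      fix T
      have "Polynomial.coeff (sign_poly U T) j = (if j < n \<and> gcd j n \<noteq> 1 then pm_sign T j else 0)" for j
        unfolding co by (simp add: U)
      thus "sign_poly U T \<in> Vset n" unfolding Vset_def by (simp add: pm_sign_def)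
    qed
    show "(\<lambda>V. {j \<in> U. Polynomial.coeff V j = 1}) ` Vset n \<subseteq> Pow U" by auto
  qed
qed

lemma card_gcd_neq_1: "card {j. j < n \<and> gcd j n \<noteq> 1} = card (noncoprimes n)"
proof (rule bij_betw_same_card)
  have co: "coprime (int x) (int n) \<longleftrightarrow> gcd x n = 1" for x
    by (simp only: coprime_int_iff coprime_iff_gcd_eq_1[of x n])
  have "int ` {j. j < n \<and> gcd j n \<noteq> 1} = noncoprimes n"
  proof (intro equalityI subsetI)
    fix j assume "j \<in> noncoprimes n"
    hence "j = int (nat j)" "nat j < n" "\<not> coprime (int (nat j)) (int n)" by (auto simp: noncoprimes_def)
    thus "j \<in> int ` {j. j < n \<and> gcd j n \<noteq> 1}" unfolding co by blast
  next
    fix j assume "j \<in> int ` {j. j < n \<and> gcd j n \<noteq> 1}"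
    then obtain x where "j = int x" "x < n" "\<not> coprime (int x) (int n)" unfolding co by blast
    thus "j \<in> noncoprimes n" by (simp add: noncoprimes_def)
  qed
  thus "bij_betw int {j. j < n \<and> gcd j n \<noteq> 1} (noncoprimes n)" by (simp add: bij_betw_def)
qed

text \<open>Moves the cyclic shift from coefficients to exponents, so that each random sign keeps
  its original index.\<close>

lemma poly_rot:
  assumes n: "n > 0" and A: "\<And>j. j \<ge> n \<Longrightarrow> Polynomial.coeff A j = 0"
  shows "poly (rot n r A) x = (\<Sum>j<n. Polynomial.coeff A j * x ^ nat ((int j - \<lfloor>real n * r\<rfloor>) mod int n))"
proof -
  define R where "R = \<lfloor>real n * r\<rfloor>"
  note co = coeff_rot[OF n A, where r = r, folded R_def]
  have "poly (rot n r A) x = (\<Sum>i<n. Polynomial.coeff A (nat ((int i + R) mod int n)) * x ^ i)"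
    by (subst poly_eq_sum[of n]) (auto simp: co intro!: sum.cong)
  also have "\<dots> = (\<Sum>j<n. Polynomial.coeff A j * x ^ nat ((int j - R) mod int n))"
  proof (rule sum.reindex_bij_witness[of _ "\<lambda>j. nat ((int j - R) mod int n)" "\<lambda>i. nat ((int i + R) mod int n)"])
    fix i assume i: "i \<in> {..<n}"
    show *: "nat ((int (nat ((int i + R) mod int n)) - R) mod int n) = i" using n i by (simp add: mod_diff_left_eq)
    show "nat ((int i + R) mod int n) \<in> {..<n}" using n by (simp add: nat_less_iff)
    show "Polynomial.coeff A (nat ((int i + R) mod int n)) * x ^ nat ((int (nat ((int i + R) mod int n)) - R) mod int n) =
      Polynomial.coeff A (nat ((int i + R) mod int n)) * x ^ i" unfolding * ..
  next
    fix j assume j: "j \<in> {..<n}"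
    show "nat ((int (nat ((int j - R) mod int n)) + R) mod int n) = j" using n j by (simp add: mod_add_left_eq)
    show "nat ((int j - R) mod int n) \<in> {..<n}" using n by (simp add: nat_less_iff)
  qed
  finally show ?thesis by (simp add: R_def)
qed

text \<open>Exchange the sum over V with the sum over sample points: at each point the value is a
  random sign sum with coefficients of modulus 1.\<close>

lemma sum_lnorm_4_Vset_le:
  assumes n: "n > 0"
  shows "(\<Sum>V\<in>Vset n. lnorm 4 (rot n r V) ^ 4) \<le> card (Vset n) * (3 * (real (card (noncoprimes n)))\<^sup>2)"
proof -
  define U where "U = {j. j < n \<and> gcd j n \<noteq> 1}"
  define \<delta> where "\<delta> = real (card (noncoprimes n))"
  have fin: "finite U" and Un: "U \<subseteq> {..<n}" by (auto simp: U_def)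
  have cU: "real (card U) = \<delta>" unfolding U_def \<delta>_def card_gcd_neq_1 ..
  note bij = bij_betw_Vset[OF U_def]
  have cV: "card (Vset n) = 2 ^ card U"
    using bij_betw_same_card[OF bij] fin by (simp add: card_Pow)
  have co0: "Polynomial.coeff (sign_poly U T) j = 0" if "j \<ge> n" for T j
    using that Un by (auto simp: coeff_sign_poly[OF fin])
  define e where "e = (\<lambda>k j. eexp n (real k / 2) ^ nat ((int j - \<lfloor>real n * r\<rfloor>) mod int n))"
  have poly: "poly (rot n r (sign_poly U T)) (eexp n (real k / 2)) = (\<Sum>j\<in>U. pm_sign T j * e k j)" for T k
  proof -
    have "poly (rot n r (sign_poly U T)) (eexp n (real k / 2)) = (\<Sum>j<n. (if j \<in> U then pm_sign T j else 0) * e k j)"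
      by (subst poly_rot[OF n co0]) (auto simp: coeff_sign_poly[OF fin] e_def)
    also have "\<dots> = (\<Sum>j\<in>U. (if j \<in> U then pm_sign T j else 0) * e k j)"
      using Un by (intro sum.mono_neutral_right) auto
    finally show ?thesis by simp
  qed
  have "(\<Sum>V\<in>Vset n. lnorm 4 (rot n r V) ^ 4) = (\<Sum>T\<in>Pow U. lnorm 4 (rot n r (sign_poly U T)) ^ 4)"
    by (rule sum.reindex_bij_betw[OF bij, symmetric])
  also have "\<dots> = (\<Sum>T\<in>Pow U. (\<Sum>k<2*n. cmod (\<Sum>j\<in>U. pm_sign T j * e k j) ^ 4) / (2 * n))"
  proof (intro sum.cong refl)
    fix T
    show "lnorm 4 (rot n r (sign_poly U T)) ^ 4 = (\<Sum>k<2*n. cmod (\<Sum>j\<in>U. pm_sign T j * e k j) ^ 4) / (2 * n)"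
      by (subst lnorm_4_power4[OF n]) (auto simp: coeff_rot[OF n co0] poly)
  qed
  also have "\<dots> = (\<Sum>k<2*n. \<Sum>T\<in>Pow U. cmod (\<Sum>j\<in>U. pm_sign T j * e k j) ^ 4) / (2 * n)"
    unfolding sum_divide_distrib[symmetric] by (subst sum.swap) (rule refl)
  also have "\<dots> \<le> (\<Sum>k<2*n. 2 ^ card U * (3 * \<delta>\<^sup>2)) / (2 * n)"
    unfolding cU[symmetric]
    by (intro divide_right_mono sum_mono conjunct2[OF sum_signs_moments[OF fin]]) (auto simp: e_def norm_power)
  also have "\<dots> = card (Vset n) * (3 * \<delta>\<^sup>2)" using n by (simp add: cV)
  finally show ?thesis by (simp add: \<delta>_def)
qed

section \<open>Stability of fourth powers under small perturbations\<close>

text \<open>Here x, y, z stand for normalised fourth powers of the norms of X, Y and X + Y, and the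
  two families of inequalities are the triangle inequality in both directions. First t is taken so
  small that the factor (1 + t)^4 costs less than half of the tolerance, then
  \<open>\<delta>\<close> so small that (1 + 1/t)^4 times \<open>\<delta>\<close> is
  absorbed.\<close>

lemma perturbation_power4:
  fixes a \<epsilon> :: real
  assumes "a \<ge> 0" "\<epsilon> > 0"
  obtains \<delta> where "\<delta> > 0"
    "\<And>x y z. \<bar>x - a\<bar> < \<delta> \<Longrightarrow> 0 \<le> y \<Longrightarrow> y < \<delta> \<Longrightarrow>
       (\<And>t. t > 0 \<Longrightarrow> z \<le> (1 + t) ^ 4 * x + (1 + 1 / t) ^ 4 * y) \<Longrightarrow>
       (\<And>t. t > 0 \<Longrightarrow> x \<le> (1 + t) ^ 4 * z + (1 + 1 / t) ^ 4 * y) \<Longrightarrow> \<bar>z - a\<bar> < \<epsilon>"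
proof -
  have "((\<lambda>t. ((1 + t) ^ 4 - 1) * (a + 1)) \<longlongrightarrow> ((1 + 0) ^ 4 - 1) * (a + 1)) (at_right (0::real))"
    by (intro tendsto_intros)
  hence "eventually (\<lambda>t. ((1 + t) ^ 4 - 1) * (a + 1) < \<epsilon> / 2) (at_right 0)"
    using assms(2) by (auto dest: order_tendstoD(2)[of _ _ _ "\<epsilon> / 2"])
  then obtain b where b: "b > 0" "\<And>t. t > 0 \<Longrightarrow> t < b \<Longrightarrow> ((1 + t) ^ 4 - 1) * (a + 1) < \<epsilon> / 2"
    unfolding eventually_at_right_field by blast
  define t where "t = b / 2"
  have t: "t > 0" "((1 + t) ^ 4 - 1) * (a + 1) < \<epsilon> / 2" using b(1) b(2)[of t] by (simp_all add: t_def)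
  define A where "A = (1 + t) ^ 4"
  define B where "B = (1 + 1 / t) ^ 4"
  have A: "A \<ge> 1" using t by (simp add: A_def)
  have B: "B \<ge> 0" by (simp add: B_def)
  define \<delta> where "\<delta> = min 1 (\<epsilon> / (2 * (1 + B)))"
  have d: "\<delta> > 0" "\<delta> \<le> 1" using assms B by (auto simp: \<delta>_def)
  have "\<delta> \<le> \<epsilon> / (2 * (1 + B))" by (simp add: \<delta>_def)
  hence dB: "\<delta> * (1 + B) \<le> \<epsilon> / 2" using B by (simp add: field_simps)
  show ?thesis
  proof (rule that[OF d(1)])
    fix x y z
    assume x: "\<bar>x - a\<bar> < \<delta>" and y: "0 \<le> y" "y < \<delta>"
      and zx: "\<And>t. t > 0 \<Longrightarrow> z \<le> (1 + t) ^ 4 * x + (1 + 1 / t) ^ 4 * y"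
      and xz: "\<And>t. t > 0 \<Longrightarrow> x \<le> (1 + t) ^ 4 * z + (1 + 1 / t) ^ 4 * y"
    have z1: "z \<le> A * x + B * y" and z2: "x \<le> A * z + B * y" using zx[OF t(1)] xz[OF t(1)] by (auto simp: A_def B_def)
    have By: "B * y \<le> B * \<delta>" using B y by (intro mult_left_mono) auto
    have "(A - 1) * x \<le> (A - 1) * (a + 1)" using A x d by (intro mult_left_mono) auto
    hence up: "z - x < \<epsilon> / 2 + B * \<delta>" using z1 By t(2) by (simp add: A_def[symmetric] algebra_simps)
    \<comment> \<open>Restricted to z <= a, since only then is (A - 1) z controlled by the choice of
      t; for z > a the upper estimate suffices.\<close>
    have low: "x - z < \<epsilon> / 2 + B * \<delta>" if "z \<le> a"
    proof -
      have "(A - 1) * z \<le> (A - 1) * (a + 1)" using A that by (intro mult_left_mono) auto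
      thus ?thesis using z2 By t(2) by (simp add: A_def[symmetric] algebra_simps)
    qed
    show "\<bar>z - a\<bar> < \<epsilon>"
    proof (cases "z \<le> a")
      case True
      have "a - x < \<delta>" using x by linarith
      hence "a - z < \<epsilon>" using low[OF True] dB by (simp add: algebra_simps)
      thus ?thesis using True by simp
    next
      case False
      have "x - a < \<delta>" using x by linarith
      hence "z - a < \<epsilon>" using up dB by (simp add: algebra_simps)
      thus ?thesis using False by simp
    qed
  qed
qed

text \<open>If c <= t b, the sum is at most (1 + t) b; otherwise b < c / t and it is at most (1 +
  1/t) c.\<close>

lemma add_power4_le:
  fixes b c t :: real
  assumes "0 \<le> b" "0 \<le> c" "t > 0"
  shows "(b + c) ^ 4 \<le> (1 + t) ^ 4 * b ^ 4 + (1 + 1 / t) ^ 4 * c ^ 4"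
proof (cases "c \<le> t * b")
  case True
  have "(b + c) ^ 4 \<le> ((1 + t) * b) ^ 4" using assms True by (intro power_mono) (auto simp: algebra_simps)
  thus ?thesis using assms unfolding power_mult_distrib by (simp add: add_increasing2)
next
  case False
  hence "(b + c) ^ 4 \<le> ((1 + 1 / t) * c) ^ 4" using assms by (intro power_mono) (auto simp: field_simps)
  thus ?thesis using assms unfolding power_mult_distrib by (simp add: add_increasing)
qed

lemma norm_add_power4_le:
  fixes x y :: complex
  assumes "t > 0"
  shows "cmod (x + y) ^ 4 \<le> (1 + t) ^ 4 * cmod x ^ 4 + (1 + 1 / t) ^ 4 * cmod y ^ 4"
proof -
  have "cmod (x + y) ^ 4 \<le> (cmod x + cmod y) ^ 4" by (intro power_mono norm_triangle_ineq) simp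
  also have "\<dots> \<le> (1 + t) ^ 4 * cmod x ^ 4 + (1 + 1 / t) ^ 4 * cmod y ^ 4"
    using assms by (intro add_power4_le) auto
  finally show ?thesis .
qed

lemma sum_norm_add_power4_le:
  fixes X Y :: "'a \<Rightarrow> complex"
  assumes "t > 0" "c \<ge> 0"
  shows "(\<Sum>k\<in>K. cmod (X k + Y k) ^ 4) / c \<le>
    (1 + t) ^ 4 * ((\<Sum>k\<in>K. cmod (X k) ^ 4) / c) + (1 + 1 / t) ^ 4 * ((\<Sum>k\<in>K. cmod (Y k) ^ 4) / c)"
proof -
  have "(\<Sum>k\<in>K. cmod (X k + Y k) ^ 4) \<le> (\<Sum>k\<in>K. (1 + t) ^ 4 * cmod (X k) ^ 4 + (1 + 1 / t) ^ 4 * cmod (Y k) ^ 4)"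
    by (intro sum_mono norm_add_power4_le assms)
  also have "\<dots> = (1 + t) ^ 4 * (\<Sum>k\<in>K. cmod (X k) ^ 4) + (1 + 1 / t) ^ 4 * (\<Sum>k\<in>K. cmod (Y k) ^ 4)"
    by (simp add: sum.distrib sum_distrib_left)
  finally have "(\<Sum>k\<in>K. cmod (X k + Y k) ^ 4) / c \<le>
    ((1 + t) ^ 4 * (\<Sum>k\<in>K. cmod (X k) ^ 4) + (1 + 1 / t) ^ 4 * (\<Sum>k\<in>K. cmod (Y k) ^ 4)) / c"
    by (rule divide_right_mono[OF _ assms(2)])
  thus ?thesis by (simp add: add_divide_distrib)
qed

section \<open>Density of the zeros of the symbol\<close>

text \<open>Such a residue is a multiple of some prime factor q of n. Each q accounts for at most n
  / p of them, with p the least prime factor, and n has at most log n / log 2 prime factors.\<close>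

lemma card_noncoprimes_le:
  assumes n: "n > 1"
  shows "real (card (noncoprimes n)) \<le> real n * (ln (real n) / ln 2) / real (smallest_prime_factor n)"
proof -
  define p where "p = smallest_prime_factor n"
  have fin: "finite (prime_factors n)" by simp
  have ne: "prime_factors n \<noteq> {}" using n by (auto simp: prime_factorization_empty_iff)
  have pin: "p \<in> prime_factors n" unfolding p_def smallest_prime_factor_def using fin ne by (rule Min_in)
  have pmin: "p \<le> q" if "q \<in> prime_factors n" for q
    unfolding p_def smallest_prime_factor_def using fin that by (rule Min_le)
  have p0: "p > 0" using in_prime_factors_imp_prime[OF pin] by (rule prime_gt_0_nat)
  have "noncoprimes n \<subseteq> (\<Union>q\<in>prime_factors n. (\<lambda>i. int q * int i) ` {..<n div q})"
  proof
    fix j assume "j \<in> noncoprimes n"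
    hence j: "0 \<le> j" "j < int n" "\<not> coprime j (int n)" by (auto simp: noncoprimes_def)
    hence "gcd j (int n) \<noteq> 1" by (simp add: coprime_iff_gcd_eq_1)
    then obtain q where q: "prime q" "q dvd gcd j (int n)" using prime_factor_int[of "gcd j (int n)"] by auto
    have q0: "q > 0" using q by (simp add: prime_gt_0_int)
    have q': "nat q \<in> prime_factors n" using q q0 n by (auto simp: prime_factors_dvd nat_dvd_iff)
    obtain i where i: "j = q * i" using q(2) by (auto elim: dvdE)
    have i0: "i \<ge> 0" using i j q0 by (simp add: zero_le_mult_iff)
    obtain m where m: "n = nat q * m" using q' by (auto simp: prime_factors_dvd elim: dvdE)
    have "q * i < q * int m" using j i m q0 by simp
    hence "i < int m" using q0 by simp
    moreover have "n div nat q = m" using m q0 by simp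
    ultimately have "nat i \<in> {..<n div nat q}" using i0 by (simp add: nat_less_iff)
    moreover have "j = int (nat q) * int (nat i)" using i i0 q0 by simp
    ultimately show "j \<in> (\<Union>q\<in>prime_factors n. (\<lambda>i. int q * int i) ` {..<n div q})" using q' by blast
  qed
  hence "card (noncoprimes n) \<le> card (\<Union>q\<in>prime_factors n. (\<lambda>i. int q * int i) ` {..<n div q})"
    by (intro card_mono) auto
  also have "\<dots> \<le> (\<Sum>q\<in>prime_factors n. card ((\<lambda>i. int q * int i) ` {..<n div q}))"
    by (rule card_UN_le[OF fin])
  also have "\<dots> \<le> (\<Sum>q\<in>prime_factors n. n div p)"
  proof (rule sum_mono)
    fix q assume "q \<in> prime_factors n"
    have "card ((\<lambda>i. int q * int i) ` {..<n div q}) \<le> n div q" using card_image_le[of "{..<n div q}"] by simp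
    also have "\<dots> \<le> n div p" using pmin[OF \<open>q \<in> _\<close>] p0 by (rule div_le_mono2[rotated])
    finally show "card ((\<lambda>i. int q * int i) ` {..<n div q}) \<le> n div p" .
  qed
  also have "\<dots> = card (prime_factors n) * (n div p)" by simp
  finally have "real (card (noncoprimes n)) \<le> real (card (prime_factors n)) * real (n div p)"
    by (simp only: of_nat_mult[symmetric] of_nat_le_iff)
  also have "\<dots> \<le> (ln (real n) / ln 2) * (real n / real p)"
  proof (intro mult_mono)
    show "real (n div p) \<le> real n / real p" by (rule of_nat_div_le_of_nat)
    have "(\<Prod>q\<in>prime_factors n. 2) \<le> (\<Prod>q\<in>prime_factors n. q ^ multiplicity q n)"
    proof (rule prod_mono)
      fix q assume q: "q \<in> prime_factors n"
      hence "q \<ge> 2" "multiplicity q n > 0" by (auto simp: prime_factors_multiplicity prime_ge_2_nat)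
      hence "2 \<le> q \<and> q \<le> q ^ multiplicity q n" using self_le_power[of q "multiplicity q n"] by simp
      thus "0 \<le> (2::nat) \<and> 2 \<le> q ^ multiplicity q n" by linarith
    qed
    also have "\<dots> = n" using prime_factorization_nat[of n] n by simp
    finally have "2 ^ card (prime_factors n) \<le> n" by simp
    hence "real (2 ^ card (prime_factors n)) \<le> real n" by (simp only: of_nat_le_iff)
    hence "ln (2 ^ card (prime_factors n)) \<le> ln (real n)" using n by simp
    thus "real (card (prime_factors n)) \<le> ln (real n) / ln 2" by (simp add: ln_realpow field_simps)
  qed (use n in auto)
  finally show ?thesis by (simp add: p_def mult.commute)
qed

section \<open>The main term and its dependence on r\<close>

text \<open>Equals 1 minus twice the distance from y to the nearest integer, so it is continuous
  although the fractional part is not.\<close>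

definition fold_dist :: "real \<Rightarrow> real" where
  "fold_dist y = \<bar>2 * (y - of_int \<lfloor>y\<rfloor>) - 1\<bar>"

lemma fold_dist_ge: "1 - 2 * \<bar>y - of_int k\<bar> \<le> fold_dist y"
proof -
  define f where "f = y - of_int \<lfloor>y\<rfloor>"
  have f: "0 \<le> f" "f < 1" unfolding f_def by linarith+
  define d where "d = k - \<lfloor>y\<rfloor>"
  have e: "y - of_int k = f - of_int d" by (simp add: f_def d_def)
  have "1 - 2 * \<bar>f - of_int d\<bar> \<le> \<bar>2 * f - 1\<bar>"
  proof (cases "d \<le> 0")
    case True
    hence "real_of_int d \<le> 0" by simp
    thus ?thesis using f by (simp add: abs_if)
  next
    case False
    hence "real_of_int d \<ge> 1" by simp
    thus ?thesis using f by (simp add: abs_if)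
  qed
  thus ?thesis unfolding fold_dist_def f_def[symmetric] e .
qed

lemma fold_dist_eq: "\<exists>k. fold_dist y = 1 - 2 * \<bar>y - of_int k\<bar>"
proof -
  define f where "f = y - of_int \<lfloor>y\<rfloor>"
  have f: "0 \<le> f" "f < 1" unfolding f_def by linarith+
  show ?thesis
  proof (cases "f \<le> 1 / 2")
    case True
    hence "fold_dist y = 1 - 2 * \<bar>y - of_int \<lfloor>y\<rfloor>\<bar>" unfolding fold_dist_def f_def[symmetric] using f by (simp add: abs_if)
    thus ?thesis by blast
  next
    case False
    have "y - of_int (\<lfloor>y\<rfloor> + 1) = f - 1" by (simp add: f_def)
    hence "fold_dist y = 1 - 2 * \<bar>y - of_int (\<lfloor>y\<rfloor> + 1)\<bar>" unfolding fold_dist_def f_def[symmetric] using f False by (simp add: abs_if)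
    thus ?thesis by blast
  qed
qed

text \<open>By \<open>fold_dist_ge\<close> and \<open>fold_dist_eq\<close> the function is the
  maximum of 1 - 2 |y - k| over integers k, and each of these has Lipschitz constant 2.\<close>

lemma fold_dist_lipschitz: "\<bar>fold_dist x - fold_dist y\<bar> \<le> 2 * \<bar>x - y\<bar>"
proof -
  have *: "fold_dist x \<le> fold_dist y + 2 * \<bar>x - y\<bar>" for x y
  proof -
    have lin: "u \<le> v + 2 * c" if "u = 1 - 2 * a" "b \<le> a + c" "1 - 2 * b \<le> v" for a b c u v :: real
      using that by linarith
    obtain k where k: "fold_dist x = 1 - 2 * \<bar>x - of_int k\<bar>" using fold_dist_eq by blast
    have "\<bar>y - of_int k\<bar> \<le> \<bar>x - of_int k\<bar> + \<bar>x - y\<bar>"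
      using abs_triangle_ineq4[of "x - of_int k" "x - y"] by simp
    thus ?thesis using lin[OF k _ fold_dist_ge[of y k]] by blast
  qed
  from *[of x y] *[of y x] show ?thesis
    unfolding abs_minus_commute[of y x] by (intro abs_leI) simp_all
qed

text \<open>Connects the limit of the sum of squared weights with the formula for f:
  \<open>s\<close> is the representative of r in (-1/2, 1/2] used in \<open>fper\<close>.\<close>

lemma fold_dist_minus_double:
  fixes r :: real
  defines "s \<equiv> r - of_int \<lceil>r - 1/2\<rceil>"
  shows "fold_dist (- 2 * r) = \<bar>4 * \<bar>s\<bar> - 1\<bar>"
proof -
  have s: "-1/2 < s" "s \<le> 1/2" unfolding s_def by linarith+
  define c where "c = \<lceil>r - 1/2\<rceil>"
  have r: "- 2 * r = - 2 * s + of_int (- 2 * c)" by (simp add: s_def c_def)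
  have "fold_dist (- 2 * r) = fold_dist (- 2 * s)"
    unfolding r fold_dist_def by (simp only: floor_add_int[symmetric]) simp
  also have "\<dots> = \<bar>4 * \<bar>s\<bar> - 1\<bar>"
  proof (cases "s > 0")
    case True
    hence "\<lfloor>- 2 * s\<rfloor> = -1" using s by linarith
    thus ?thesis using True by (simp add: fold_dist_def)
  next
    case False
    hence "\<lfloor>- 2 * s\<rfloor> = 0" using s by linarith
    thus ?thesis using False by (simp add: fold_dist_def)
  qed
  finally show ?thesis .
qed

definition pair_term :: "int set \<Rightarrow> (int \<Rightarrow> complex) \<Rightarrow> real" where
  "pair_term I w = 2 * (\<Sum>a\<in>I. (cmod (w a))\<^sup>2)\<^sup>2 + (cmod (\<Sum>a\<in>I. (w a)\<^sup>2))\<^sup>2 - 2 * (\<Sum>a\<in>I. cmod (w a) ^ 4)"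

text \<open>With e the discarded mass, the square of the total mass and the squared modulus each
  change by at most 2e and the fourth powers by at most e; weighted with 2, 1 and 2 this gives
  8e.\<close>

lemma pair_term_truncate:
  assumes H: "finite H" "I \<subseteq> H" and one: "(\<Sum>a\<in>H. (cmod (w a))\<^sup>2) = 1"
  shows "\<bar>pair_term I w - pair_term H w\<bar> \<le> 8 * (\<Sum>a\<in>H - I. (cmod (w a))\<^sup>2)"
proof -
  have split: "(\<Sum>a\<in>H. f a) = (\<Sum>a\<in>I. f a) + (\<Sum>a\<in>H - I. f a)" for f :: "int \<Rightarrow> 'a :: comm_monoid_add"
    using sum.subset_diff[OF H(2,1), of f] by (simp add: add.commute)
  define e where "e = (\<Sum>a\<in>H - I. (cmod (w a))\<^sup>2)"
  define A where "A = (\<Sum>a\<in>I. (cmod (w a))\<^sup>2)"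
  have e0: "0 \<le> e" and A0: "0 \<le> A" by (simp_all add: e_def A_def sum_nonneg)
  have Ae: "A + e = 1" using one split[of "\<lambda>a. (cmod (w a))\<^sup>2"] by (simp add: A_def e_def)
  define u where "u = (\<Sum>a\<in>I. (w a)\<^sup>2)"
  define v where "v = (\<Sum>a\<in>H. (w a)\<^sup>2)"
  have u1: "cmod u \<le> 1"
  proof -
    have "cmod u \<le> A" unfolding u_def A_def by (rule sum_norm_le) (simp add: norm_power)
    thus ?thesis using Ae e0 by linarith
  qed
  have v1: "cmod v \<le> 1" unfolding v_def one[symmetric] by (rule sum_norm_le) (simp add: norm_power)
  have "cmod (v - u) \<le> e"
    unfolding v_def u_def split[of "\<lambda>a. (w a)\<^sup>2"] e_def by simp (rule sum_norm_le, simp add: norm_power)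
  hence "\<bar>cmod u - cmod v\<bar> \<le> e" using norm_triangle_ineq3[of v u] by linarith
  hence "\<bar>cmod u - cmod v\<bar> * (cmod u + cmod v) \<le> e * 2" using u1 v1 e0 by (intro mult_mono) auto
  moreover have "(cmod u)\<^sup>2 - (cmod v)\<^sup>2 = (cmod u - cmod v) * (cmod u + cmod v)" by (simp add: power2_eq_square algebra_simps)
  hence "\<bar>(cmod u)\<^sup>2 - (cmod v)\<^sup>2\<bar> = \<bar>cmod u - cmod v\<bar> * (cmod u + cmod v)" by (simp add: abs_mult)
  ultimately have uv: "\<bar>(cmod u)\<^sup>2 - (cmod v)\<^sup>2\<bar> \<le> 2 * e" by linarith
  have "(\<Sum>a\<in>H - I. cmod (w a) ^ 4) \<le> e"
    unfolding e_def
  proof (rule sum_mono)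
    fix a assume "a \<in> H - I"
    hence "(cmod (w a))\<^sup>2 \<le> 1" unfolding one[symmetric] using H(1) by (intro member_le_sum) auto
    hence "(cmod (w a))\<^sup>2 * (cmod (w a))\<^sup>2 \<le> (cmod (w a))\<^sup>2 * 1" by (intro mult_left_mono) auto
    thus "cmod (w a) ^ 4 \<le> (cmod (w a))\<^sup>2" by (simp add: power_add[symmetric])
  qed
  moreover have "(\<Sum>a\<in>H - I. cmod (w a) ^ 4) \<ge> 0" by (simp add: sum_nonneg)
  ultimately have q: "\<bar>(\<Sum>a\<in>H. cmod (w a) ^ 4) - (\<Sum>a\<in>I. cmod (w a) ^ 4)\<bar> \<le> e"
    unfolding split[of "\<lambda>a. cmod (w a) ^ 4"] by simp
  have "\<bar>A\<^sup>2 - 1\<bar> = e * (1 + A)"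
  proof -
    have "1 - A\<^sup>2 = (1 - A) * (1 + A)" by (simp add: power2_eq_square algebra_simps)
    also have "1 - A = e" using Ae by simp
    finally have "1 - A\<^sup>2 = e * (1 + A)" .
    thus ?thesis unfolding abs_minus_commute[of "A\<^sup>2"] using e0 A0 by simp
  qed
  also have "\<dots> \<le> e * 2" using Ae e0 by (intro mult_left_mono) auto
  finally have A2: "\<bar>A\<^sup>2 - 1\<bar> \<le> 2 * e" by simp
  have "\<bar>2 * x + y + 2 * z\<bar> \<le> 8 * e" if "\<bar>x\<bar> \<le> 2 * e" "\<bar>y\<bar> \<le> 2 * e" "\<bar>z\<bar> \<le> e" for x y z :: real
    using that by linarith
  note this[OF A2 uv q]
  moreover have "pair_term I w - pair_term H w = 2 * (A\<^sup>2 - 1) + ((cmod u)\<^sup>2 - (cmod v)\<^sup>2)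
     + 2 * ((\<Sum>a\<in>H. cmod (w a) ^ 4) - (\<Sum>a\<in>I. cmod (w a) ^ 4))"
    by (simp add: pair_term_def one A_def u_def v_def algebra_simps)
  ultimately show ?thesis unfolding e_def[symmetric] by simp
qed

text \<open>The summand 2 in 2u + 2 - n costs 2 / n. Rounding n r to an integer moves the argument
  by at most 2 / n, and Lipschitz constant 2 makes this 4 / n.\<close>

lemma norm_sum_weight_square_approx:
  assumes n: "n > 0" and R: "R = \<lfloor>real n * r\<rfloor>"
  shows "\<bar>cmod (\<Sum>m\<in>{0..<int n}. (weight n R m)\<^sup>2) - fold_dist (- 2 * r)\<bar> \<le> 6 / n"
proof -
  define y where "y = real_of_int (- 2 * R) / real n"
  have "\<lfloor>y\<rfloor> = (- 2 * R) div int n" unfolding y_def using floor_divide_of_int_eq[of "- 2 * R" "int n"] by (simp only: of_int_of_nat_eq)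
  hence "(- 2 * R) mod int n = - 2 * R - \<lfloor>y\<rfloor> * int n" by (simp add: minus_div_mult_eq_mod[symmetric])
  hence "real_of_int ((- 2 * R) mod int n) = of_int (- 2 * R) - of_int \<lfloor>y\<rfloor> * real n"
    by (simp only: of_int_diff of_int_mult of_int_of_nat_eq)
  moreover have "of_int (- 2 * R) = real n * y" using n by (simp add: y_def)
  ultimately have mm: "real_of_int ((- 2 * R) mod int n) = real n * (y - of_int \<lfloor>y\<rfloor>)"
    by (simp add: algebra_simps)
  have "(2 * of_int ((- 2 * R) mod int n) + 2 - real n) / n = (2 * (y - of_int \<lfloor>y\<rfloor>) - 1) + 2 / n"
    unfolding mm using n by (simp add: field_simps)
  moreover have "cmod (\<Sum>m\<in>{0..<int n}. (weight n R m)\<^sup>2) = \<bar>(2 * of_int ((- 2 * R) mod int n) + 2 - real n) / n\<bar>"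
    unfolding norm_sum_weight_square[OF n] by (simp only: abs_divide abs_of_nat)
  ultimately have 1: "cmod (\<Sum>m\<in>{0..<int n}. (weight n R m)\<^sup>2) = \<bar>(2 * (y - of_int \<lfloor>y\<rfloor>) - 1) + 2 / n\<bar>"
    by (simp only:)
  have 2: "\<bar>\<bar>(2 * (y - of_int \<lfloor>y\<rfloor>) - 1) + 2 / n\<bar> - fold_dist y\<bar> \<le> 2 / n"
    unfolding fold_dist_def by (rule order.trans[OF abs_triangle_ineq3]) simp
  have "\<bar>real n * r - of_int R\<bar> \<le> 1" unfolding R by linarith
  moreover have "y - (- 2 * r) = 2 * (real n * r - of_int R) / n" using n by (simp add: y_def field_simps)
  ultimately have "\<bar>y - (- 2 * r)\<bar> \<le> 2 / n" using n by (simp add: abs_mult divide_right_mono)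
  from mult_left_mono[OF this, of 2] have "2 * \<bar>y - (- 2 * r)\<bar> \<le> 4 / n" by simp
  with fold_dist_lipschitz[of y "- 2 * r"] have 3: "\<bar>fold_dist y - fold_dist (- 2 * r)\<bar> \<le> 4 / n" by (rule order.trans)
  have "\<bar>a - c\<bar> \<le> 6 / n" if "\<bar>a - b\<bar> \<le> 2 / n" "\<bar>b - c\<bar> \<le> 4 / n" for a b c :: real
  proof -
    have "\<bar>a - c\<bar> \<le> \<bar>a - b\<bar> + \<bar>b - c\<bar>" by linarith
    also have "\<dots> \<le> 2 / n + 4 / n" using that by (rule add_mono)
    finally show ?thesis by simp
  qed
  from this[OF 2 3] show ?thesis unfolding 1 .
qed

text \<open>The centred system \<open>H\<close> makes the decay of the weights usable. The tail is
  estimated by squared supremum times mean square, 36 (1 + ln n)^2 times 5 / M, which explains 180;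
  the 40 / M is 8 from \<open>pair_term_truncate\<close> times 5.\<close>

lemma fourth_moment_estimates:
  fixes n p M h :: nat and R :: int
  assumes n: "odd n" "squarefree n" "n > 1" "prime p" "p dvd n" and M: "M \<ge> 1" "2 * M < p" and h: "n = 2 * h + 1"
  defines "I \<equiv> {- int M..int M}" and "H \<equiv> {- int h..int h}" and "w \<equiv> weight n R"
  defines "X \<equiv> (\<lambda>K l. \<Sum>m\<in>K. of_int (Jacobi (m - l) n) * w m)"
  shows "\<And>l. X {0..<int n} l = X I l + X (H - I) l"
    and "(\<Sum>l\<in>{0..<int n}. cmod (X (H - I) l) ^ 4) / n \<le> 180 * (1 + ln n)\<^sup>2 / M"
    and "\<bar>(\<Sum>l\<in>{0..<int n}. cmod (X I l) ^ 4) / n - pair_term {0..<int n} w\<bar>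
      \<le> 6 * (card (noncoprimes n) / n) + 4 * p powr (- 1/4) * (6 * (1 + ln (M + 1))) ^ 4 + 40 / M"
proof -
  let ?N = "{0..<int n}"
  have n0: "n > 0" using n by simp
  have "p \<le> n" using n by (auto intro: dvd_imp_le)
  hence Mh: "M \<le> h" using M h by simp
  have IH: "I \<subseteq> H" using Mh by (auto simp: I_def H_def)
  have fin: "finite H" "finite I" by (simp_all add: H_def I_def)
  have Hn: "(\<Sum>m\<in>H. f m) = (\<Sum>m\<in>?N. f m)" if "\<And>x. f (x mod int n) = f x" for f :: "int \<Rightarrow> 'a :: comm_monoid_add"
    unfolding H_def by (rule sum_centered_residues[where f = f]) (use h that in auto)
  have wmod: "w (x mod int n) = w x" for x unfolding w_def by (rule weight_mod[OF n0])
  show "X ?N l = X I l + X (H - I) l" for l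
  proof -
    have "X ?N l = X H l" unfolding X_def
    proof (rule Hn[symmetric])
      fix x
      have "[x mod int n - l = x - l] (mod int n)" by (intro cong_diff) auto
      from Jacobi_cong[OF this] show "of_int (Jacobi (x mod int n - l) n) * w (x mod int n) = of_int (Jacobi (x - l) n) * w x"
        by (simp add: wmod)
    qed
    also have "\<dots> = X I l + X (H - I) l" unfolding X_def using sum.subset_diff[OF IH fin(1)] by (simp add: add.commute)
    finally show ?thesis .
  qed
  have wle: "cmod (w m) \<le> 3 / real_of_int \<bar>2 * m + 1\<bar>" if "m \<in> H" for m
    unfolding w_def using that h by (intro norm_weight_le[OF n0]) (auto simp: H_def)
  have e: "(\<Sum>m\<in>H - I. (cmod (w m))\<^sup>2) \<le> 5 / M"
  proof -
    have "(\<Sum>m\<in>H - I. (cmod (w m))\<^sup>2) \<le> (\<Sum>m\<in>H - I. (3 / real_of_int \<bar>2 * m + 1\<bar>)\<^sup>2)"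
      using wle by (intro sum_mono power_mono) auto
    also have "\<dots> \<le> 5 / M" unfolding H_def I_def by (rule sum_tail_reciprocal_squares_le[OF M(1)])
    finally show ?thesis .
  qed
  show "(\<Sum>l\<in>?N. cmod (X (H - I) l) ^ 4) / n \<le> 180 * (1 + ln n)\<^sup>2 / M"
  proof -
    define L where "L = 6 * (1 + ln (real n))"
    have J1: "cmod (of_int (Jacobi x n)) \<le> 1" for x
      using abs_Jacobi_le_1[of x n] by (simp del: of_int_abs add: of_int_abs[symmetric])
    have sup: "cmod (X (H - I) l) \<le> L" for l
    proof -
      have "cmod (X (H - I) l) \<le> (\<Sum>m\<in>H - I. 3 / real_of_int \<bar>2 * m + 1\<bar>)"
        unfolding X_def
      proof (rule sum_norm_le)
        fix m assume "m \<in> H - I"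
        hence "cmod (of_int (Jacobi (m - l) n)) * cmod (w m) \<le> 1 * (3 / real_of_int \<bar>2 * m + 1\<bar>)"
          by (intro mult_mono J1 wle) auto
        thus "cmod (of_int (Jacobi (m - l) n) * w m) \<le> 3 / real_of_int \<bar>2 * m + 1\<bar>" by (simp add: norm_mult)
      qed
      also have "\<dots> \<le> (\<Sum>m\<in>H. 3 / real_of_int \<bar>2 * m + 1\<bar>)" using fin by (intro sum_mono2) auto
      also have "\<dots> \<le> 6 * (1 + ln (real h + 1))" unfolding H_def by (rule sum_odd_reciprocals_le)
      also have "\<dots> \<le> L" unfolding L_def using h by simp
      finally show ?thesis .
    qed
    have "(\<Sum>l\<in>?N. cmod (X (H - I) l) ^ 4) \<le> (\<Sum>l\<in>?N. L\<^sup>2 * (cmod (X (H - I) l))\<^sup>2)"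
    proof (rule sum_mono)
      fix l
      have "(cmod (X (H - I) l))\<^sup>2 * (cmod (X (H - I) l))\<^sup>2 \<le> L\<^sup>2 * (cmod (X (H - I) l))\<^sup>2"
        by (intro mult_right_mono power_mono sup) auto
      thus "cmod (X (H - I) l) ^ 4 \<le> L\<^sup>2 * (cmod (X (H - I) l))\<^sup>2" by (simp add: power_add[symmetric])
    qed
    also have "\<dots> = L\<^sup>2 * (\<Sum>l\<in>?N. (cmod (X (H - I) l))\<^sup>2)" by (simp add: sum_distrib_left)
    also have "(\<Sum>l\<in>?N. (cmod (X (H - I) l))\<^sup>2) \<le> n * (\<Sum>m\<in>H - I. (cmod (w m))\<^sup>2)"
      unfolding X_def
    proof (rule mean_square_convolution_le[OF n(1,2)])
      fix i j assume ij: "i \<in> H - I" "j \<in> H - I" and c: "[i = j] (mod int n)"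
      show "i = j"
      proof (rule ccontr)
        assume "i \<noteq> j"
        moreover have "int n dvd i - j" using c by (simp add: cong_iff_dvd_diff)
        ultimately have "int n \<le> \<bar>i - j\<bar>" using dvd_imp_le_int[of "i - j" "int n"] by simp
        thus False using ij h by (auto simp: H_def)
      qed
    qed (use fin in simp)
    also have "\<dots> \<le> n * (5 / M)" by (intro mult_left_mono e) simp
    finally have "(\<Sum>l\<in>?N. cmod (X (H - I) l) ^ 4) \<le> L\<^sup>2 * (n * (5 / M))" by (simp add: mult_left_mono)
    hence "(\<Sum>l\<in>?N. cmod (X (H - I) l) ^ 4) / n \<le> L\<^sup>2 * (5 / M)" using n0 by (simp add: divide_le_eq mult_ac)
    also have "\<dots> = 180 * (1 + ln n)\<^sup>2 / M" unfolding L_def power_mult_distrib by simp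
    finally show ?thesis .
  qed
  show "\<bar>(\<Sum>l\<in>?N. cmod (X I l) ^ 4) / n - pair_term ?N w\<bar>
      \<le> 6 * (card (noncoprimes n) / n) + 4 * p powr (- 1/4) * (6 * (1 + ln (M + 1))) ^ 4 + 40 / M"
  proof -
    have one: "(\<Sum>m\<in>H. (cmod (w m))\<^sup>2) = 1"
      using Hn[of "\<lambda>m. (cmod (w m))\<^sup>2"] wmod sum_norm_weight_square[OF n0] by (simp add: w_def)
    have PN: "pair_term H w = pair_term ?N w"
      unfolding pair_term_def using Hn[of "\<lambda>m. (cmod (w m))\<^sup>2"] Hn[of "\<lambda>m. (w m)\<^sup>2"] Hn[of "\<lambda>m. cmod (w m) ^ 4"] wmod by simp
    have A1: "(\<Sum>m\<in>I. (cmod (w m))\<^sup>2) \<le> 1" unfolding one[symmetric] using fin IH by (intro sum_mono2) auto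
    hence A1': "(\<Sum>m\<in>I. (cmod (w m))\<^sup>2)\<^sup>2 \<le> 1" by (intro power_le_one) (auto simp: sum_nonneg)
    have B1: "(\<Sum>m\<in>I. cmod (w m)) \<le> 6 * (1 + ln (real M + 1))"
    proof -
      have "(\<Sum>m\<in>I. cmod (w m)) \<le> (\<Sum>m\<in>I. 3 / real_of_int \<bar>2 * m + 1\<bar>)" using wle IH by (intro sum_mono) auto
      also have "\<dots> \<le> 6 * (1 + ln (real M + 1))" unfolding I_def by (rule sum_odd_reciprocals_le)
      finally show ?thesis .
    qed
    have "\<bar>(\<Sum>l\<in>?N. cmod (X I l) ^ 4) - n * pair_term I w\<bar> \<le>
      6 * card (noncoprimes n) * (\<Sum>a\<in>I. (cmod (w a))\<^sup>2)\<^sup>2 + 4 * n * p powr (- 1/4) * (\<Sum>a\<in>I. cmod (w a)) ^ 4"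
      unfolding X_def I_def pair_term_def by (rule truncated_fourth_moment[OF n(1,2,4,5) M(2)])
    also have "\<dots> \<le> real (6 * card (noncoprimes n)) * 1 + 4 * n * p powr (- 1/4) * (6 * (1 + ln (real M + 1))) ^ 4"
    proof (rule add_mono, goal_cases)
      case 1 show ?case by (rule mult_left_mono[OF A1']) simp
    next
      case 2 show ?case by (intro mult_left_mono power_mono B1) (auto simp: sum_nonneg)
    qed
    finally have "\<bar>(\<Sum>l\<in>?N. cmod (X I l) ^ 4) - n * pair_term I w\<bar> / n \<le>
      (real (6 * card (noncoprimes n)) * 1 + 4 * n * p powr (- 1/4) * (6 * (1 + ln (real M + 1))) ^ 4) / n"
      by (rule divide_right_mono) simp
    also have "\<dots> = 6 * (card (noncoprimes n) / n) + 4 * p powr (- 1/4) * (6 * (1 + ln (real M + 1))) ^ 4"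
      using n0 by (simp add: add_divide_distrib)
    also have "\<bar>(\<Sum>l\<in>?N. cmod (X I l) ^ 4) - n * pair_term I w\<bar> / n = \<bar>(\<Sum>l\<in>?N. cmod (X I l) ^ 4) / n - pair_term I w\<bar>"
    proof -
      have "\<bar>(\<Sum>l\<in>?N. cmod (X I l) ^ 4) - n * pair_term I w\<bar> / n = \<bar>((\<Sum>l\<in>?N. cmod (X I l) ^ 4) - n * pair_term I w) / n\<bar>"
        by (simp only: abs_divide abs_of_nat)
      also have "((\<Sum>l\<in>?N. cmod (X I l) ^ 4) - n * pair_term I w) / n = (\<Sum>l\<in>?N. cmod (X I l) ^ 4) / n - pair_term I w"
        using n0 by (simp add: diff_divide_distrib)
      finally show ?thesis .
    qed
    finally have 1: "\<bar>(\<Sum>l\<in>?N. cmod (X I l) ^ 4) / n - pair_term I w\<bar> \<le>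
       6 * (card (noncoprimes n) / n) + 4 * p powr (- 1/4) * (6 * (1 + ln (real M + 1))) ^ 4" .
    have 2: "\<bar>pair_term I w - pair_term ?N w\<bar> \<le> 40 / M"
      using pair_term_truncate[OF fin(1) IH one] e unfolding PN by simp
    have "\<bar>a - c\<bar> \<le> s + t" if "\<bar>a - b\<bar> \<le> s" "\<bar>b - c\<bar> \<le> t" for a b c s t :: real
      using that by linarith
    from this[OF 1 2] show ?thesis by (simp add: add.commute)
  qed
qed

section \<open>Passage to the limit\<close>

text \<open>The cutoff must stay below half the least prime and still dominate (ln n)^2, which
  bounds the tail. The square root of the prime achieves both.\<close>

definition cutoff :: "nat \<Rightarrow> nat" where
  "cutoff n = nat \<lfloor>sqrt (real (smallest_prime_factor n))\<rfloor>"

context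
  fixes S :: "nat set" and F :: "nat filter"
  assumes S: "\<forall>n\<in>S. odd n \<and> squarefree n \<and> n > 1"
    and lim: "((\<lambda>n. ln (real n) ^ 7 / real (smallest_prime_factor n)) \<longlongrightarrow> 0) F"
    and F: "F = inf at_top (principal S)"
begin

private abbreviation (input) p where "p \<equiv> smallest_prime_factor"

lemma spf_in: "n > 1 \<Longrightarrow> p n \<in> prime_factors n"
  unfolding smallest_prime_factor_def by (rule Min_in) (auto simp: prime_factorization_empty_iff)

lemma eventually_in_S: "eventually (\<lambda>n. n \<in> S) F"
  unfolding F eventually_inf_principal by simp

lemma F_le: "F \<le> at_top"
  unfolding F by simp

lemma eventually_ln_ge_1: "eventually (\<lambda>n. ln (real n) \<ge> 1) F"
proof -
  have "eventually (\<lambda>n::nat. ln (real n) \<ge> 1) at_top" by real_asymp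
  thus ?thesis using F_le filter_leD by blast
qed

lemma inverse_spf_tendsto: "((\<lambda>n. 1 / real (p n)) \<longlongrightarrow> 0) F"
proof (rule tendsto_sandwich[OF _ _ tendsto_const lim])
  show "eventually (\<lambda>n. 1 / real (p n) \<le> ln (real n) ^ 7 / real (p n)) F"
    using eventually_ln_ge_1 by eventually_elim (intro divide_right_mono, auto)
qed simp

lemma spf_at_top: "filterlim (\<lambda>n. real (p n)) at_top F"
proof -
  have "eventually (\<lambda>n. 1 / real (p n) > 0) F"
    using eventually_in_S by eventually_elim (use S spf_in in \<open>auto simp: prime_factors_dvd prime_gt_0_nat\<close>)
  hence "filterlim (\<lambda>n. 1 / real (p n)) (at_right 0) F"
    using inverse_spf_tendsto by (auto simp: filterlim_at elim: eventually_mono)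
  from filterlim_compose[OF filterlim_inverse_at_top_right this]
  show ?thesis by (simp add: inverse_eq_divide)
qed

lemma noncoprimes_tendsto: "((\<lambda>n. real (card (noncoprimes n)) / real n) \<longlongrightarrow> 0) F"
proof (rule tendsto_sandwich[where f = "\<lambda>_. 0" and h = "\<lambda>n. 1 / ln 2 * (ln (real n) ^ 7 / real (p n))"])
  show "eventually (\<lambda>n. real (card (noncoprimes n)) / real n \<le> 1 / ln 2 * (ln (real n) ^ 7 / real (p n))) F"
    using eventually_in_S eventually_ln_ge_1
  proof eventually_elim
    case (elim n)
    have n: "n > 1" using elim S by auto
    have "real (card (noncoprimes n)) / real n \<le> (real n * (ln (real n) / ln 2) / real (p n)) / real n"
      by (intro divide_right_mono card_noncoprimes_le[OF n]) simp
    also have "\<dots> = 1 / ln 2 * (ln (real n) ^ 1 / real (p n))" using n by simp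
    also have "\<dots> \<le> 1 / ln 2 * (ln (real n) ^ 7 / real (p n))"
      using elim by (intro mult_left_mono divide_right_mono power_increasing) auto
    finally show ?case .
  qed
  show "((\<lambda>n. 1 / ln 2 * (ln (real n) ^ 7 / real (p n))) \<longlongrightarrow> 0) F"
    using tendsto_mult_left[OF lim, of "1 / ln 2"] by simp
qed auto

private abbreviation (input) M where "M \<equiv> cutoff"

lemma eventually_M: "eventually (\<lambda>n. M n \<ge> 1 \<and> 2 * M n < p n \<and> M n + 1 \<le> p n \<and> real (M n) \<ge> sqrt (real (p n)) / 2) F"
proof -
  \<comment> \<open>From 9 on the square root s is at least 3, so 2s < s^2, s + 1 <= s^2, and
    rounding s down loses at most half of it.\<close>
  have "eventually (\<lambda>n. real (p n) \<ge> 9) F" using spf_at_top unfolding filterlim_at_top by blast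
  thus ?thesis
  proof eventually_elim
    case (elim n)
    define s where "s = sqrt (real (p n))"
    have s3: "s \<ge> 3" using elim by (simp add: s_def real_le_rsqrt)
    have ss: "s * s = real (p n)" by (simp add: s_def)
    have Ms: "real (M n) \<le> s" "real (M n) > s - 1" using s3 unfolding cutoff_def s_def[symmetric] by linarith+
    have "2 * s < s * s" using s3 by (intro mult_strict_right_mono) auto
    moreover have "s + 1 \<le> s * s" using s3 mult_right_mono[of 3 s s] by linarith
    ultimately have "2 * real (M n) < real (p n)" "real (M n) + 1 \<le> real (p n)" using Ms ss by linarith+
    thus ?case using Ms s3 unfolding s_def[symmetric] by linarith
  qed
qed

text \<open>Uses 1 + L <= 2L and M >= s / 2, where s^2 is the least prime: 180 * 4 * 2 = 1440. Then
  L^2 / s is the square root of L^4 / s^2, controlled by the assumed limit since L >= 1.\<close>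

lemma tail_tendsto: "((\<lambda>n. 180 * (1 + ln (real n))\<^sup>2 / real (M n)) \<longlongrightarrow> 0) F"
proof (rule tendsto_sandwich[where f = "\<lambda>_. 0" and h = "\<lambda>n. 1440 * sqrt (ln (real n) ^ 7 / real (p n))"])
  show "eventually (\<lambda>n. 180 * (1 + ln (real n))\<^sup>2 / real (M n) \<le> 1440 * sqrt (ln (real n) ^ 7 / real (p n))) F"
    using eventually_ln_ge_1 eventually_M
  proof eventually_elim
    case (elim n)
    define L where "L = ln (real n)"
    define s where "s = sqrt (real (p n))"
    have L: "L \<ge> 1" and M: "real (M n) \<ge> s / 2" "M n \<ge> 1" and s: "s > 0" using elim by (auto simp: L_def s_def)
    have "(1 + L)\<^sup>2 \<le> (2 * L)\<^sup>2" using L by (intro power_mono) auto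
    hence "180 * (1 + L)\<^sup>2 / real (M n) \<le> 720 * L\<^sup>2 / (s / 2)"
      using M s by (intro frac_le) (auto simp: power_mult_distrib)
    also have "\<dots> = 1440 * (L\<^sup>2 / s)" by simp
    also have "L\<^sup>2 = sqrt (L ^ 4)" using real_sqrt_abs[of "L\<^sup>2"] by simp
    also have "sqrt (L ^ 4) / s \<le> sqrt (L ^ 7) / s"
      using L s by (intro divide_right_mono real_sqrt_le_mono power_increasing) auto
    also have "sqrt (L ^ 7) / s = sqrt (L ^ 7 / real (p n))" by (simp add: s_def real_sqrt_divide)
    finally show ?case by (simp add: L_def)
  qed
  show "((\<lambda>n. 1440 * sqrt (ln (real n) ^ 7 / real (p n))) \<longlongrightarrow> 0) F"
    using tendsto_mult_left[OF tendsto_real_sqrt[OF lim], of 1440] by simp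
qed auto

lemma inverse_M_tendsto: "((\<lambda>n. 40 / real (M n)) \<longlongrightarrow> 0) F"
proof (rule tendsto_sandwich[OF _ _ tendsto_const tail_tendsto])
  show "eventually (\<lambda>n. 40 / real (M n) \<le> 180 * (1 + ln (real n))\<^sup>2 / real (M n)) F"
    using eventually_ln_ge_1
  proof eventually_elim
    case (elim n)
    have "1\<^sup>2 \<le> (1 + ln (real n))\<^sup>2" using elim by (intro power_mono) auto
    thus ?case by (intro divide_right_mono) auto
  qed
qed simp

text \<open>Replacing M + 1 by the least prime leaves a function of that prime alone, in which the
  power beats the logarithm.\<close>

lemma correlation_error_tendsto:
  "((\<lambda>n. 4 * real (p n) powr (- 1/4) * (6 * (1 + ln (real (M n) + 1))) ^ 4) \<longlongrightarrow> 0) F"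
proof (rule tendsto_sandwich[where f = "\<lambda>_. 0" and h = "\<lambda>n. 4 * real (p n) powr (- 1/4) * (6 * (1 + ln (real (p n)))) ^ 4"])
  show "eventually (\<lambda>n. 4 * real (p n) powr (- 1/4) * (6 * (1 + ln (real (M n) + 1))) ^ 4
      \<le> 4 * real (p n) powr (- 1/4) * (6 * (1 + ln (real (p n)))) ^ 4) F"
    using eventually_M
  proof eventually_elim
    case (elim n)
    hence "real (M n) + 1 \<le> real (p n)" by linarith
    hence "ln (real (M n) + 1) \<le> ln (real (p n))" by (subst ln_le_cancel_iff) auto
    thus ?case by (intro mult_left_mono power_mono) auto
  qed
  have "((\<lambda>x. 4 * x powr (- 1/4) * (6 * (1 + ln x)) ^ 4) \<longlongrightarrow> 0) (at_top :: real filter)" by real_asymp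
  from filterlim_compose[OF this spf_at_top]
  show "((\<lambda>n. 4 * real (p n) powr (- 1/4) * (6 * (1 + ln (real (p n)))) ^ 4) \<longlongrightarrow> 0) F" by simp
qed auto

text \<open>The three sums contribute 2, the limiting square, and -2/3, from total mass 1 and fourth
  power sum tending to 1/3.\<close>

lemma pair_term_tendsto:
  "((\<lambda>n. pair_term {0..<int n} (weight n \<lfloor>real n * r\<rfloor>)) \<longlongrightarrow> 4 / 3 + (fold_dist (- 2 * r))\<^sup>2) F"
proof -
  define g where "g = (\<lambda>n. cmod (\<Sum>m\<in>{0..<int n}. (weight n \<lfloor>real n * r\<rfloor> m)\<^sup>2))"
  have pos: "eventually (\<lambda>n. n > 0) F" using eventually_in_S by eventually_elim (use S in auto)
  have "((\<lambda>n. g n - fold_dist (- 2 * r)) \<longlongrightarrow> 0) F"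
  proof (rule Lim_null_comparison)
    show "eventually (\<lambda>n. norm (g n - fold_dist (- 2 * r)) \<le> 6 / real n) F"
      using pos by eventually_elim (use norm_sum_weight_square_approx in \<open>simp add: g_def\<close>)
    have "((\<lambda>n::nat. 6 / real n) \<longlongrightarrow> 0) at_top" by real_asymp
    thus "((\<lambda>n. 6 / real n) \<longlongrightarrow> 0) F" by (rule tendsto_mono[OF F_le])
  qed
  hence g: "(g \<longlongrightarrow> fold_dist (- 2 * r)) F" by (rule LIM_zero_cancel)
  have "((\<lambda>n::nat. ((real n)\<^sup>2 + 2) / (3 * (real n)\<^sup>2)) \<longlongrightarrow> 1 / 3) at_top" by real_asymp
  hence q: "((\<lambda>n. ((real n)\<^sup>2 + 2) / (3 * (real n)\<^sup>2)) \<longlongrightarrow> 1 / 3) F" by (rule tendsto_mono[OF F_le])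
  have "((\<lambda>n. 2 * 1\<^sup>2 + (g n)\<^sup>2 - 2 * (((real n)\<^sup>2 + 2) / (3 * (real n)\<^sup>2))) \<longlongrightarrow> 2 * 1\<^sup>2 + (fold_dist (- 2 * r))\<^sup>2 - 2 * (1 / 3)) F"
    by (intro tendsto_intros g q)
  moreover have "eventually (\<lambda>n. 2 * 1\<^sup>2 + (g n)\<^sup>2 - 2 * (((real n)\<^sup>2 + 2) / (3 * (real n)\<^sup>2)) = pair_term {0..<int n} (weight n \<lfloor>real n * r\<rfloor>)) F"
    using pos by eventually_elim (simp add: pair_term_def g_def sum_norm_weight_square sum_norm_weight_power4)
  ultimately show ?thesis by (simp add: tendsto_cong)
qed

text \<open>The n-th roots of unity contribute 1/2 in the limit and the intermediate points half of
  4/3 plus the square, which explains 7/6.\<close>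

lemma lnorm_4_charpoly_tendsto:
  "((\<lambda>n. lnorm 4 (rot n r (charpoly n)) ^ 4 / (real n)\<^sup>2) \<longlongrightarrow> 7 / 6 + (fold_dist (- 2 * r))\<^sup>2 / 2) F"
proof -
  define X where "X = (\<lambda>n K l. \<Sum>m\<in>K. of_int (Jacobi (m - l) n) * weight n \<lfloor>real n * r\<rfloor> m)"
  define I where "I = (\<lambda>n. {- int (M n)..int (M n)})"
  define T where "T = (\<lambda>n. {- int (n div 2)..int (n div 2)} - I n)"
  define x y z where "x = (\<lambda>n. (\<Sum>l\<in>{0..<int n}. cmod (X n (I n) l) ^ 4) / real n)"
    and "y = (\<lambda>n. (\<Sum>l\<in>{0..<int n}. cmod (X n (T n) l) ^ 4) / real n)"
    and "z = (\<lambda>n. (\<Sum>l\<in>{0..<int n}. cmod (X n {0..<int n} l) ^ 4) / real n)"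
  define a where "a = 4 / 3 + (fold_dist (- 2 * r))\<^sup>2"
  have est: "eventually (\<lambda>n. (\<forall>l. X n {0..<int n} l = X n (I n) l + X n (T n) l) \<and> y n \<le> 180 * (1 + ln (real n))\<^sup>2 / real (M n) \<and>
      \<bar>x n - pair_term {0..<int n} (weight n \<lfloor>real n * r\<rfloor>)\<bar> \<le>
      6 * (real (card (noncoprimes n)) / real n) + 4 * real (p n) powr (- 1/4) * (6 * (1 + ln (real (M n) + 1))) ^ 4 + 40 / real (M n)) F"
    using eventually_in_S eventually_M
  proof eventually_elim
    case (elim n)
    have n: "odd n" "squarefree n" "n > 1" using elim S by auto
    have pp: "prime (p n)" "p n dvd n" using spf_in[OF n(3)] by auto
    have MM: "M n \<ge> 1" "2 * M n < p n" using elim by auto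
    have h: "n = 2 * (n div 2) + 1" using n(1) by simp
    note e = fourth_moment_estimates[OF n pp MM h, where R = "\<lfloor>real n * r\<rfloor>"]
    show ?case using e unfolding X_def x_def y_def I_def T_def by (simp add: add.commute)
  qed
  have y0: "y n \<ge> 0" for n by (simp add: y_def sum_nonneg)
  have ylim: "(y \<longlongrightarrow> 0) F"
    by (rule tendsto_sandwich[OF _ _ tendsto_const tail_tendsto]) (use y0 in simp, use est in eventually_elim, simp)
  have "((\<lambda>n. x n - pair_term {0..<int n} (weight n \<lfloor>real n * r\<rfloor>)) \<longlongrightarrow> 0) F"
  proof (rule Lim_null_comparison)
    show "eventually (\<lambda>n. norm (x n - pair_term {0..<int n} (weight n \<lfloor>real n * r\<rfloor>)) \<le>
       6 * (real (card (noncoprimes n)) / real n) + 4 * real (p n) powr (- 1/4) * (6 * (1 + ln (real (M n) + 1))) ^ 4 + 40 / real (M n)) F"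
      using est by eventually_elim simp
    show "((\<lambda>n. 6 * (real (card (noncoprimes n)) / real n) + 4 * real (p n) powr (- 1/4) * (6 * (1 + ln (real (M n) + 1))) ^ 4 + 40 / real (M n)) \<longlongrightarrow> 0) F"
      using tendsto_add[OF tendsto_add[OF tendsto_mult_left[OF noncoprimes_tendsto, of 6] correlation_error_tendsto] inverse_M_tendsto] by simp
  qed
  from tendsto_add[OF this pair_term_tendsto[of r]] have xlim: "(x \<longlongrightarrow> a) F" by (simp add: a_def)
  have zlim: "(z \<longlongrightarrow> a) F"
  proof (rule tendstoI)
    fix \<epsilon> :: real assume \<epsilon>: "\<epsilon> > 0"
    have "a \<ge> 0" by (simp add: a_def)
    from perturbation_power4[OF this \<epsilon>] obtain \<delta> where \<delta>: "\<delta> > 0"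
      "\<And>x y z. \<bar>x - a\<bar> < \<delta> \<Longrightarrow> 0 \<le> y \<Longrightarrow> y < \<delta> \<Longrightarrow>
       (\<And>t. t > 0 \<Longrightarrow> z \<le> (1 + t) ^ 4 * x + (1 + 1 / t) ^ 4 * y) \<Longrightarrow>
       (\<And>t. t > 0 \<Longrightarrow> x \<le> (1 + t) ^ 4 * z + (1 + 1 / t) ^ 4 * y) \<Longrightarrow> \<bar>z - a\<bar> < \<epsilon>" by blast
    show "eventually (\<lambda>n. dist (z n) a < \<epsilon>) F"
      using est tendstoD[OF xlim \<delta>(1)] order_tendstoD(2)[OF ylim \<delta>(1)]
    proof eventually_elim
      case (elim n)
      have X: "X n {0..<int n} l = X n (I n) l + X n (T n) l" for l using elim by blast
      \<comment> \<open>The truncated convolution is the full one plus the negated tail, which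
        yields the reverse inequality required by the perturbation lemma.\<close>
      have X': "X n (I n) l = X n {0..<int n} l + - X n (T n) l" for l using X[of l] by simp
      have "\<bar>z n - a\<bar> < \<epsilon>"
      proof (rule \<delta>(2)[of "x n" "y n"])
        fix t :: real assume t: "t > 0"
        show "z n \<le> (1 + t) ^ 4 * x n + (1 + 1 / t) ^ 4 * y n"
          unfolding x_def y_def z_def X by (rule sum_norm_add_power4_le[OF t]) simp
        have "x n = (\<Sum>l\<in>{0..<int n}. cmod (X n {0..<int n} l + - X n (T n) l) ^ 4) / real n"
          unfolding x_def by (simp only: X'[symmetric])
        also have "\<dots> \<le> (1 + t) ^ 4 * z n + (1 + 1 / t) ^ 4 * ((\<Sum>l\<in>{0..<int n}. cmod (- X n (T n) l) ^ 4) / real n)"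
          unfolding z_def by (rule sum_norm_add_power4_le[OF t]) simp
        finally show "x n \<le> (1 + t) ^ 4 * z n + (1 + 1 / t) ^ 4 * y n" by (simp add: y_def)
      qed (use elim y0 in \<open>auto simp: dist_real_def\<close>)
      thus ?case by (simp add: dist_real_def)
    qed
  qed
  have "((\<lambda>n. (1 - real (card (noncoprimes n)) / real n) / 2 + z n / 2) \<longlongrightarrow> (1 - 0) / 2 + a / 2) F"
    by (intro tendsto_intros noncoprimes_tendsto zlim) simp_all
  moreover have "eventually (\<lambda>n. (1 - real (card (noncoprimes n)) / real n) / 2 + z n / 2 = lnorm 4 (rot n r (charpoly n)) ^ 4 / (real n)\<^sup>2) F"
    using eventually_in_S
  proof eventually_elim
    case (elim n)
    have n: "odd n" "squarefree n" "n > 1" using elim S by auto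
    have "{j \<in> {0..<int n}. coprime j (int n)} = {0..<int n} - noncoprimes n" by (auto simp: noncoprimes_def)
    moreover have "noncoprimes n \<subseteq> {0..<int n}" by (auto simp: noncoprimes_def)
    ultimately have c: "real (card {j \<in> {0..<int n}. coprime j (int n)}) = real n - real (card (noncoprimes n))"
      using card_mono[of "{0..<int n}" "noncoprimes n"] by (simp add: card_Diff_subset finite_subset of_nat_diff)
    show ?case unfolding lnorm_4_charpoly[OF n refl] z_def X_def c using n by (simp add: field_simps)
  qed
  ultimately have "((\<lambda>n. lnorm 4 (rot n r (charpoly n)) ^ 4 / (real n)\<^sup>2) \<longlongrightarrow> (1 - 0) / 2 + a / 2) F"
    by (simp only: tendsto_cong)
  thus ?thesis by (simp add: a_def add_divide_distrib)
qed

end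

section \<open>From the fourth norm to the merit factor\<close>

text \<open>The symbol vanishes exactly where V does not, and both polynomials undergo the same
  cyclic shift, so every coefficient of the sum has modulus 1 and the fourth power of the L2 norm is
  n^2.\<close>

lemma merit_charpoly_plus:
  assumes n: "n > 1" "odd n" and V: "V \<in> Vset n"
  shows "merit (rot n r (charpoly n) + rot n r V) = 1 / (lnorm 4 (rot n r (charpoly n) + rot n r V) ^ 4 / (real n)\<^sup>2 - 1)"
proof -
  define R where "R = \<lfloor>real n * r\<rfloor>"
  define A where "A = rot n r (charpoly n) + rot n r V"
  have n0: "n > 0" using n by simp
  have c1: "Polynomial.coeff (charpoly n) j = 0" if "j \<ge> n" for j using that coeff_charpoly[OF n(1)] by simp
  have c2: "Polynomial.coeff V j = 0" if "j \<ge> n" for j using that V by (simp add: Vset_def)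
  have co: "cmod (Polynomial.coeff A i) = 1" if i: "i < n" for i
  proof -
    define j where "j = nat ((int i + R) mod int n)"
    have j: "j < n" using n0 by (simp add: j_def nat_less_iff)
    have A: "Polynomial.coeff A i = of_int (Jacobi (int j) n) + Polynomial.coeff V j"
      using i j by (simp add: A_def coeff_rot[OF n0 c1] coeff_rot[OF n0 c2] coeff_charpoly[OF n(1)] R_def[symmetric] j_def[symmetric])
    have Vj: "Polynomial.coeff V j \<in> {0, -1, 1}" "Polynomial.coeff V j = 0 \<longleftrightarrow> gcd j n = 1" using V j by (auto simp: Vset_def)
    have "Jacobi (int j) n = 0 \<longleftrightarrow> gcd j n \<noteq> 1"
      by (simp only: Jacobi_eq_0_iff[OF n0] coprime_int_iff coprime_iff_gcd_eq_1[of j n])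
    thus ?thesis using Vj Jacobi_cases[of "int j" n] unfolding A by (cases "gcd j n = 1") auto
  qed
  have "lnorm 2 A ^ 4 = (\<Sum>j<n. (cmod (Polynomial.coeff A j))\<^sup>2)\<^sup>2"
    by (rule lnorm_2_power4) (simp add: A_def coeff_rot[OF n0 c1] coeff_rot[OF n0 c2])
  also have "\<dots> = (real n)\<^sup>2" using co by simp
  finally have "merit A = (real n)\<^sup>2 / (lnorm 4 A ^ 4 - (real n)\<^sup>2)" by (simp add: merit_def)
  also have "\<dots> = 1 / (lnorm 4 A ^ 4 / (real n)\<^sup>2 - 1)"
  proof -
    have "lnorm 4 A ^ 4 / (real n)\<^sup>2 - 1 = (lnorm 4 A ^ 4 - (real n)\<^sup>2) / (real n)\<^sup>2"
      using n0 by (simp add: diff_divide_distrib)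
    thus ?thesis by simp
  qed
  finally show ?thesis by (simp add: A_def)
qed

text \<open>All three norms are sampled at the same 2n-th roots of unity, which reduces the claim to
  a pointwise inequality. \<open>c\<close> is the normalisation n^2.\<close>

lemma lnorm_4_add_le:
  assumes n: "n > 0" and A: "\<And>j. j \<ge> n \<Longrightarrow> Polynomial.coeff A j = 0" and B: "\<And>j. j \<ge> n \<Longrightarrow> Polynomial.coeff B j = 0"
    and t: "t > 0" and c: "c \<ge> 0"
  shows "lnorm 4 (A + B) ^ 4 / c \<le> (1 + t) ^ 4 * (lnorm 4 A ^ 4 / c) + (1 + 1 / t) ^ 4 * (lnorm 4 B ^ 4 / c)"
proof -
  have AB: "Polynomial.coeff (A + B) j = 0" if "j \<ge> n" for j using A B that by simp
  have eq: "lnorm 4 A ^ 4 = (\<Sum>k<2*n. cmod (poly A (eexp n (real k / 2))) ^ 4) / (2 * n)"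
    "lnorm 4 B ^ 4 = (\<Sum>k<2*n. cmod (poly B (eexp n (real k / 2))) ^ 4) / (2 * n)"
    "lnorm 4 (A + B) ^ 4 = (\<Sum>k<2*n. cmod (poly (A + B) (eexp n (real k / 2))) ^ 4) / (2 * n)"
    by (rule lnorm_4_power4[OF n A], assumption, rule lnorm_4_power4[OF n B], assumption,
        rule lnorm_4_power4[OF n AB], assumption)
  show ?thesis
    unfolding eq poly_add divide_divide_eq_left
    by (rule sum_norm_add_power4_le[OF t]) (use c in simp)
qed

theorem theorem5:
  fixes S :: "nat set" and r :: real
  assumes "infinite S"
    and "\<forall>n\<in>S. odd n \<and> squarefree n \<and> n > 1"
    and "((\<lambda>n. ln (real n) ^ 7 / real (smallest_prime_factor n)) \<longlongrightarrow> 0)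
           (inf at_top (principal S))"
  shows "\<forall>\<epsilon>>0. ((\<lambda>n. real (card {V \<in> Vset n.
            \<bar>merit (rot n r (charpoly n) + rot n r V) - fper r\<bar> > \<epsilon>})
          / real (card (Vset n))) \<longlongrightarrow> 0) (inf at_top (principal S))"
proof (intro allI impI)
  fix \<epsilon> :: real assume \<epsilon>: "\<epsilon> > 0"
  define F where "F = inf at_top (principal S)"
  define s where "s = r - of_int \<lceil>r - 1/2\<rceil>"
  define a where "a = 7 / 6 + (fold_dist (- 2 * r))\<^sup>2 / 2"
  define x where "x = (\<lambda>n. lnorm 4 (rot n r (charpoly n)) ^ 4 / (real n)\<^sup>2)"
  note S = assms(2) and lim = assms(3)[folded F_def]
  \<comment> \<open>The identity (4q - 1)^2 / 2 = 8 (q - 1/4)^2 turns 7/6 plus half the square into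
    1 + 1/f(r).\<close>
  have a: "a = 1 + (1/6 + 8 * (\<bar>s\<bar> - 1/4)\<^sup>2)"
  proof -
    have "7 / 6 + \<bar>4 * q - 1\<bar>\<^sup>2 / 2 = 1 + (1/6 + 8 * (q - 1/4)\<^sup>2)" for q :: real
      unfolding power2_abs by (simp add: power2_eq_square field_simps)
    thus ?thesis unfolding a_def fold_dist_minus_double s_def[symmetric] .
  qed
  have "fper r = 1 / (a - 1)" unfolding fper_def Let_def s_def[symmetric] a by simp
  have "8 * (\<bar>s\<bar> - 1/4)\<^sup>2 \<ge> 0" by simp
  \<comment> \<open>The strict inequality keeps a away from the pole of 1 / (z - 1), so the merit
    factor depends continuously on the normalised fourth power near a.\<close>
  hence a1: "a > 1" unfolding a by linarith
  have "((\<lambda>z. 1 / (z - 1)) \<longlongrightarrow> 1 / (a - 1)) (nhds a)"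
    using a1 by (intro tendsto_intros filterlim_ident) auto
  hence "eventually (\<lambda>z. dist (1 / (z - 1)) (1 / (a - 1)) < \<epsilon>) (nhds a)" using \<epsilon> by (rule tendstoD)
  then obtain \<eta> where \<eta>: "\<eta> > 0" "\<And>z. \<bar>z - a\<bar> < \<eta> \<Longrightarrow> \<bar>1 / (z - 1) - fper r\<bar> < \<epsilon>"
    unfolding eventually_nhds_metric \<open>fper r = _\<close> dist_real_def by blast
  have "a \<ge> 0" using a1 by simp
  from perturbation_power4[OF this \<eta>(1)] obtain \<delta> where \<delta>: "\<delta> > 0"
      "\<And>x y z. \<bar>x - a\<bar> < \<delta> \<Longrightarrow> 0 \<le> y \<Longrightarrow> y < \<delta> \<Longrightarrow>
       (\<And>t. t > 0 \<Longrightarrow> z \<le> (1 + t) ^ 4 * x + (1 + 1 / t) ^ 4 * y) \<Longrightarrow>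
       (\<And>t. t > 0 \<Longrightarrow> x \<le> (1 + t) ^ 4 * z + (1 + 1 / t) ^ 4 * y) \<Longrightarrow> \<bar>z - a\<bar> < \<eta>" by blast
  have xlim: "(x \<longlongrightarrow> a) F" unfolding x_def a_def by (rule lnorm_4_charpoly_tendsto[OF S lim F_def])
  show "((\<lambda>n. real (card {V \<in> Vset n. \<bar>merit (rot n r (charpoly n) + rot n r V) - fper r\<bar> > \<epsilon>})
          / real (card (Vset n))) \<longlongrightarrow> 0) (inf at_top (principal S))"
    unfolding F_def[symmetric]
  proof (rule tendsto_sandwich[where f = "\<lambda>_. 0" and h = "\<lambda>n. 3 / \<delta> * (real (card (noncoprimes n)) / real n)\<^sup>2"])
    show "((\<lambda>n. 3 / \<delta> * (real (card (noncoprimes n)) / real n)\<^sup>2) \<longlongrightarrow> 0) F"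
      using tendsto_mult_left[OF tendsto_power[OF noncoprimes_tendsto[OF S lim F_def], of 2], of "3 / \<delta>"] by simp
    show "eventually (\<lambda>n. real (card {V \<in> Vset n. \<bar>merit (rot n r (charpoly n) + rot n r V) - fper r\<bar> > \<epsilon>})
          / real (card (Vset n)) \<le> 3 / \<delta> * (real (card (noncoprimes n)) / real n)\<^sup>2) F"
      using eventually_in_S[OF S lim F_def] tendstoD[OF xlim \<delta>(1)]
    proof eventually_elim
      case (elim n)
      have n: "odd n" "n > 1" "n > 0" using elim(1) S by auto
      have xa: "\<bar>x n - a\<bar> < \<delta>" using elim(2) by (simp add: dist_real_def)
      define q where "q = (\<lambda>V. lnorm 4 (rot n r V) ^ 4)"
      define Bad where "Bad = {V \<in> Vset n. \<bar>merit (rot n r (charpoly n) + rot n r V) - fper r\<bar> > \<epsilon>}"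
      have finV: "finite (Vset n)"
        using bij_betw_finite[OF bij_betw_Vset[OF refl, of n]] by simp
      have "card (Vset n) = 2 ^ card {j. j < n \<and> gcd j n \<noteq> 1}"
        using bij_betw_same_card[OF bij_betw_Vset[OF refl, of n]] by (simp add: card_Pow)
      hence cV: "card (Vset n) > 0" by simp
      have q0: "q V \<ge> 0" for V by (simp add: q_def)
      have c1: "Polynomial.coeff (charpoly n) j = 0" if "j \<ge> n" for j using that coeff_charpoly[OF n(2)] by simp
      \<comment> \<open>If the rotated V had normalised fourth power below \<open>\<delta>\<close>,
        the perturbation lemma would bring the merit factor within the tolerance. Bad choices of V
        therefore have a large norm, and there are few of them by Markov's inequality.\<close>
      have big: "q V \<ge> \<delta> * (real n)\<^sup>2" if "V \<in> Bad" for V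
      proof (rule ccontr)
        assume "\<not> q V \<ge> \<delta> * (real n)\<^sup>2"
        hence y: "q V / (real n)\<^sup>2 < \<delta>" using n by (simp add: divide_less_eq)
        have V: "V \<in> Vset n" using that by (simp add: Bad_def)
        have c2: "Polynomial.coeff V j = 0" if "j \<ge> n" for j using that V by (simp add: Vset_def)
        define A where "A = rot n r (charpoly n)"
        define B where "B = rot n r V"
        have A: "Polynomial.coeff A j = 0" if "j \<ge> n" for j using that by (simp add: A_def coeff_rot[OF n(3) c1])
        have B: "Polynomial.coeff B j = 0" if "j \<ge> n" for j using that by (simp add: B_def coeff_rot[OF n(3) c2])
        have AB: "Polynomial.coeff (A + B) j = 0" "Polynomial.coeff (- B) j = 0" if "j \<ge> n" for j using A B that by auto
        \<comment> \<open>Needed to recover \<open>A\<close> as (A + B) + (-B) in the reverse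
          inequality.\<close>
        have mB: "lnorm 4 (- B) = lnorm 4 B" by (simp add: lnorm_def)
        have "\<bar>lnorm 4 (A + B) ^ 4 / (real n)\<^sup>2 - a\<bar> < \<eta>"
        proof (rule \<delta>(2)[OF xa _ y])
          show "0 \<le> q V / (real n)\<^sup>2" using q0 by simp
          fix t :: real assume t: "t > 0"
          show "lnorm 4 (A + B) ^ 4 / (real n)\<^sup>2 \<le> (1 + t) ^ 4 * x n + (1 + 1 / t) ^ 4 * (q V / (real n)\<^sup>2)"
            unfolding x_def q_def A_def[symmetric] B_def[symmetric] by (rule lnorm_4_add_le[OF n(3) A B t]) auto
          show "x n \<le> (1 + t) ^ 4 * (lnorm 4 (A + B) ^ 4 / (real n)\<^sup>2) + (1 + 1 / t) ^ 4 * (q V / (real n)\<^sup>2)"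
            using lnorm_4_add_le[OF n(3) AB t, of "(real n)\<^sup>2"]
            unfolding x_def q_def A_def[symmetric] B_def[symmetric] mB by simp
        qed
        hence "\<bar>merit (A + B) - fper r\<bar> < \<epsilon>"
          using \<eta>(2) unfolding A_def B_def merit_charpoly_plus[OF n(2,1) V] by blast
        thus False using that by (simp add: Bad_def A_def B_def)
      qed
      \<comment> \<open>Markov's inequality against the mean 3 |noncoprimes|^2, which gives the
        factor 3 / \<open>\<delta>\<close>.\<close>
      have "real (card Bad) * (\<delta> * (real n)\<^sup>2) = (\<Sum>V\<in>Bad. \<delta> * (real n)\<^sup>2)" by simp
      also have "\<dots> \<le> (\<Sum>V\<in>Bad. q V)" by (intro sum_mono big)
      also have "\<dots> \<le> (\<Sum>V\<in>Vset n. q V)" using finV q0 by (intro sum_mono2) (auto simp: Bad_def)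
      also have "\<dots> \<le> real (card (Vset n)) * (3 * (real (card (noncoprimes n)))\<^sup>2)"
        unfolding q_def by (rule sum_lnorm_4_Vset_le[OF n(3)])
      finally show ?case using cV n \<delta>(1) unfolding Bad_def[symmetric]
        by (simp add: field_simps power_divide)
    qed
  qed auto
qed

end
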